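(* Let $\{t(e)\}$ be i.i.d. real-valued weights. (i) Assume $\mathbb E[\min\{t_1^+,\dots,t_{2d}^+\}]<\infty$ and $A\in L^1$. Then $T_{x,y}$ is a finite integrable random variable for all $x,y\in\mathbb Z^d$, and there exists a non-random, positively homogeneous, continuous, convex function $\mu:\mathbb R^d\to[0,\infty)$ such that for any sequence $x_n\in\mathbb Z^d$ with $x_n/n\to\xi\in\mathbb R^d$, $$\lim_{n\to\infty}\mathbb E\big[|n^{-1}T_{0,x_n}-\mu(\xi)|\big]=0.$$ (ii) Assume furthermore $\mathbb E[(\min\{t_1^+,\dots,t_{2d}^+\})^d]<\infty$ and $\mathbb E[A^d]<\infty$. Then with probability one $$\lim_{n\to\infty}\sup_{|x|_1\ge n}\frac{|T_{0,x}-\mu(x)|}{|x|_1}=0,$$ and $\mu(\xi)=\lim_{n\to\infty}T_{0,x_n}/n$ for all $\xi\in\mathbb R^d$ and any sequence $x_n\in\mathbb Z^d$ with $x_n/n\to\xi$.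
   Context: Let $d\ge2$. The weights $\{t(e)\}$ on the undirected nearest-neighbor edges of $\mathbb Z^d$ are i.i.d. real random variables, and $t_i$ are i.i.d. copies with $t_i^+=t_i\vee0$. $T_{x,y}$ is the infimum of $\sum_{e\in\pi}t(e)$ over self-avoiding nearest-neighbor paths $\pi$ from $x$ to $y$. The random variable $A$ is defined by $A=2\sup_{x\in\mathbb Z^d}T_{0,x}^-$, where $s^-=(-s)\vee0$. *)

theory Defs
  imports "HOL-Probability.Probability"
begin

definition norm1 :: "int ^ 'd \<Rightarrow> int" where
  "norm1 x = (\<Sum>i\<in>UNIV. \<bar>x $ i\<bar>)"

definition adjacent :: "int ^ 'd \<Rightarrow> int ^ 'd \<Rightarrow> bool" where
  "adjacent x y \<longleftrightarrow> norm1 (x - y) = 1"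

definition lattice_edges :: "(int ^ 'd) set set" where
  "lattice_edges = {{x, y} | x y. adjacent x y}"

definition edges_at :: "int ^ 'd \<Rightarrow> (int ^ 'd) set set" where
  "edges_at x = {{x, y} | y. adjacent x y}"

definition saw :: "int ^ 'd \<Rightarrow> int ^ 'd \<Rightarrow> (int ^ 'd) list set" where
  "saw x y = {p. p \<noteq> [] \<and> hd p = x \<and> last p = y \<and> distinct p \<and>
                 (\<forall>i. Suc i < length p \<longrightarrow> adjacent (p ! i) (p ! Suc i))}"

definition path_weight :: "((int ^ 'd) set \<Rightarrow> real) \<Rightarrow> (int ^ 'd) list \<Rightarrow> real" where
  "path_weight w p = sum_list (map (\<lambda>(a, b). w {a, b}) (zip p (tl p)))"

text \<open>Passage time (extended real, since weights may be negative).\<close>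
definition passage_time ::
    "((int ^ 'd) set \<Rightarrow> 'w \<Rightarrow> real) \<Rightarrow> int ^ 'd \<Rightarrow> int ^ 'd \<Rightarrow> 'w \<Rightarrow> ereal" where
  "passage_time t x y \<omega> = (INF p \<in> saw x y. ereal (path_weight (\<lambda>e. t e \<omega>) p))"

definition A_var :: "((int ^ 'd) set \<Rightarrow> 'w \<Rightarrow> real) \<Rightarrow> 'w \<Rightarrow> ereal" where
  "A_var t \<omega> = 2 * (SUP x. max 0 (- passage_time t 0 x \<omega>))"

definition vec_of_int :: "int ^ 'd \<Rightarrow> real ^ 'd" where
  "vec_of_int x = (\<chi> i. real_of_int (x $ i))"

text \<open>min(t_1^+,...,t_{2d}^+): the weights of the 2d edges at the origin are i.i.d. copies.\<close>
definition min_pos_origin :: "((int ^ 'd) set \<Rightarrow> 'w \<Rightarrow> real) \<Rightarrow> 'w \<Rightarrow> real" where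
  "min_pos_origin t \<omega> = Min ((\<lambda>e. max 0 (t e \<omega>)) ` edges_at 0)"

end

theory Submission
  imports Defs
begin

text \<open>
  When weights may be negative, the passage time \<open>T\<close> is not subadditive: concatenating two self-avoiding
  paths at \<open>y\<close> means erasing loops, which may have negative weight. The erased pieces run between
  \<open>y\<close> and some other vertex, so with \<open>A\<^sub>y = 2 sup\<^sub>v T(y,v)\<^sup>-\<close> one has \<open>T(x,z) \<le> T(x,y) + T(y,z) + A\<^sub>y\<close>, and
  \<open>T(x,y) + A\<^sub>y\<close> is nonnegative, stationary and subadditive. If this process grew too slowly along a
  direction, then by ergodicity almost every position would start a short cheap block, and
  tiling a long segment greedily by such blocks would contradict its mean. This lower bound together with the
  convergence of the means gives convergence in mean, because the process is nonnegative. The matching almost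
  sure upper bound is Birkhoff's theorem, obtained by the same tiling.

  For the shape theorem a far point \<open>x\<close> is compared with a point at distance \<open>\<delta>|x|\<close> in one of finitely
  many directions. Passage over a distance \<open>r\<close> costs more than \<open>C r\<close> with summable probability: \<open>d + 1\<close> disjoint
  corridors are each expensive with probability \<open>O(1/r)\<close>, and their ends are linked to the two end points
  by local connections with finite \<open>d\<close>-th moment, built from \<open>2d\<close> edge-disjoint detours around each edge.
\<close>

subsection \<open>Lattice paths and passage times\<close>

text \<open>A single weight may have infinite mean; only the minimum of \<open>2d\<close>
  independent weights is controlled. The price of a lattice step is therefore the price of the best
  of \<open>2d\<close> edge-disjoint detours, and \<open>step_cost\<close> is an integrable,
  finite-range bound for it. All upper bounds are sums of translates of this one variable.

  The factor 2 in \<open>A\<close> pays for the two pieces that loop erasure removes, one from each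
  path. Only one-sided ergodic statements are used, a lower bound for subadditive processes and an
  upper bound for additive ones; both follow from one dichotomy. They are proved on the product
  space of the edge weights, where translations act as measure-preserving maps.

  The number \<open>d + 1\<close> of corridors comes from counting: the dyadic shell of radius
  \<open>2^k\<close> has O(\<open>2^(d k)\<close>) points, so failure probabilities of order
  \<open>r^-(d+1)\<close> are summable over the lattice, while the 1/r that Chebyshev's inequality
  gives for one corridor is not. The variance needed there exists because \<open>d \<ge> 2\<close>.
  The connections at the two ends of a corridor have only \<open>d\<close>-th moments, which is
  exactly what sums \<open>2^(d k)\<close> times the probability that \<open>Y\<close> exceeds
  \<open>c 2^k\<close>.\<close>

type_synonym 'd config = "(int ^ 'd) set \<Rightarrow> real"

lemma norm1_minus_commute: "norm1 (x - y) = norm1 (y - x)"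
  by (simp add: norm1_def abs_minus_commute)

lemma norm1_minus [simp]: "norm1 (- x) = norm1 x"
  by (simp add: norm1_def)

lemma norm1_nonneg [simp]: "0 \<le> norm1 x"
  by (simp add: norm1_def sum_nonneg)

lemma norm1_zero [simp]: "norm1 0 = 0"
  by (simp add: norm1_def)

lemma norm1_eq_0_iff [simp]: "norm1 x = 0 \<longleftrightarrow> x = 0"
  by (simp add: norm1_def sum_nonneg_eq_0_iff vec_eq_iff)

lemma norm1_triangle: "norm1 (x + y) \<le> norm1 x + norm1 y"
  by (simp add: norm1_def sum.distrib[symmetric] sum_mono abs_triangle_ineq)

lemma component_le_norm1: "\<bar>x $ k\<bar> \<le> norm1 x"
  unfolding norm1_def by (rule member_le_sum) auto

lemma adjacent_sym: "adjacent x y \<longleftrightarrow> adjacent y x"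
  by (simp add: adjacent_def norm1_minus_commute)

lemma adjacent_translate [simp]: "adjacent (z + x) (z + y) \<longleftrightarrow> adjacent x y"
  by (simp add: adjacent_def)

lemma adjacent_neq: "adjacent x y \<Longrightarrow> x \<noteq> y"
  by (auto simp: adjacent_def)

lemma edge_in_lattice: "adjacent x y \<Longrightarrow> {x, y} \<in> lattice_edges"
  by (auto simp: lattice_edges_def)

lemma saw_iff:
  "p \<in> saw x y \<longleftrightarrow> p \<noteq> [] \<and> hd p = x \<and> last p = y \<and> distinct p \<and> successively adjacent p"
  by (auto simp: saw_def successively_conv_nth)

lemma path_weight_simps [simp]:
  "path_weight w [] = 0" "path_weight w [x] = 0"
  "path_weight w (x # y # p) = w {x, y} + path_weight w (y # p)"
  by (simp_all add: path_weight_def)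

lemma path_weight_append:
  "path_weight w (xs @ u # ys) = path_weight w (xs @ [u]) + path_weight w (u # ys)"
proof (induction xs)
  case (Cons x xs)
  then show ?case by (cases xs) auto
qed simp

lemma path_weight_rev: "path_weight w (rev p) = path_weight w p"
proof (induction p rule: induct_list012)
  case (3 x y p)
  have "path_weight w (rev (x # y # p)) = path_weight w (rev p @ [y]) + path_weight w [y, x]"
    using path_weight_append[of w "rev p" y "[x]"] by simp
  then show ?case using 3 by (simp add: insert_commute)
qed simp_all

lemma path_weight_nonneg: "(\<And>e. 0 \<le> w e) \<Longrightarrow> 0 \<le> path_weight w p"
  by (induction p rule: induct_list012) auto

lemma path_weight_cong:
  assumes "successively adjacent p" "\<And>e. e \<in> lattice_edges \<Longrightarrow> w e = w' e"
  shows "path_weight w p = path_weight w' p"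
  using assms by (induction p rule: induct_list012) (auto simp: edge_in_lattice)

lemma path_weight_mono:
  assumes "\<And>e. w e \<le> w' e"
  shows "path_weight w p \<le> path_weight w' p"
  by (induction p rule: induct_list012) (auto intro!: add_mono assms)

lemma rev_saw: "p \<in> saw x y \<Longrightarrow> rev p \<in> saw y x"
  by (auto simp: saw_iff hd_rev last_rev adjacent_sym[symmetric])

lemma saw_singleton: "[x] \<in> saw x x"
  by (simp add: saw_iff)

lemma saw_split:
  assumes "p1 @ u # p2 \<in> saw x y"
  shows "p1 @ [u] \<in> saw x u" "u # p2 \<in> saw u y"
  using assms by (auto simp: saw_iff successively_append_iff hd_append successively_Cons split: if_splits)

text \<open>Cut at the first vertex \<open>u\<close> of \<open>p\<close> that lies on
  \<open>q\<close>: the part of \<open>p\<close> before \<open>u\<close> misses all of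
  \<open>q\<close>, so the spliced list repeats no vertex. The erased pieces \<open>u # p2\<close>
  and \<open>q1 @ [u]\<close> are self-avoiding paths between \<open>u\<close> and \<open>y\<close>,
  which later bounds their weight from below.\<close>

lemma loop_erasure:
  assumes p: "p \<in> saw x y" and q: "q \<in> saw y z"
  obtains p1 p2 q1 q2 u where "p = p1 @ u # p2" "q = q1 @ u # q2" "p1 @ u # q2 \<in> saw x z"
proof -
  have "y \<in> set p" using p by (auto simp: saw_iff)
  moreover have "y \<in> set q" using q by (auto simp: saw_iff)
  ultimately have "\<exists>u\<in>set p. u \<in> set q" by blast
  then obtain p1 u p2 where p1: "p = p1 @ u # p2" "u \<in> set q" "\<forall>v\<in>set p1. v \<notin> set q"
    using split_list_first_prop[of p "\<lambda>u. u \<in> set q"] by blast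
  then obtain q1 q2 where q1: "q = q1 @ u # q2" by (meson split_list)
  have "p1 @ u # q2 \<in> saw x z"
    using p q p1 q1 unfolding saw_iff
    by (auto simp: successively_append_iff hd_append last_append successively_Cons split: if_splits)
  then show ?thesis using p1 q1 that by blast
qed

section \<open>Passage times of a configuration and their behaviour under translation\<close>

definition ptime :: "'d::finite config \<Rightarrow> int ^ 'd \<Rightarrow> int ^ 'd \<Rightarrow> ereal" where
  "ptime w x y = (INF p \<in> saw x y. ereal (path_weight w p))"

lemma passage_time_eq_ptime: "passage_time t x y \<omega> = ptime (\<lambda>e. t e \<omega>) x y"
  by (simp add: passage_time_def ptime_def)

lemma ptime_commute: "ptime w x y = ptime w y x"
proof -
  have "ptime w x y \<le> ptime w y x" for x y
    unfolding ptime_def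
  proof (rule INF_greatest)
    fix p assume "p \<in> saw y x"
    then show "(INF p\<in>saw x y. ereal (path_weight w p)) \<le> ereal (path_weight w p)"
      by (intro INF_lower2[of "rev p"]) (auto simp: rev_saw path_weight_rev)
  qed
  then show ?thesis by (simp add: antisym)
qed

lemma ptime_cong:
  assumes "\<And>e. e \<in> lattice_edges \<Longrightarrow> w e = w' e"
  shows "ptime w x y = ptime w' x y"
  unfolding ptime_def
  by (intro INF_cong refl arg_cong[of _ _ ereal] path_weight_cong assms) (auto simp: saw_iff)

text \<open>The restriction to \<open>lattice_edges\<close> keeps every translate extensional, that
  is, inside the space of the product measure on which translations are to act.\<close>

definition shift :: "int ^ 'd \<Rightarrow> 'd config \<Rightarrow> 'd config" where
  "shift z w = (\<lambda>e\<in>lattice_edges. w ((+) z ` e))"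

lemma image_edge_in_lattice: "e \<in> lattice_edges \<Longrightarrow> (+) z ` e \<in> lattice_edges"
  by (auto simp: lattice_edges_def) (metis adjacent_translate)

lemma shift_shift: "shift y (shift z w) = shift (z + y) w"
  by (auto simp: shift_def restrict_def image_edge_in_lattice image_image add.assoc)

lemma successively_translate:
  "successively adjacent (map ((+) z) p) \<longleftrightarrow> successively adjacent p"
  by (simp add: successively_map)

lemma path_weight_shift:
  assumes "successively adjacent p"
  shows "path_weight (shift z w) p = path_weight w (map ((+) z) p)"
  using assms by (induction p rule: induct_list012) (auto simp: shift_def edge_in_lattice)

lemma saw_translate: "p \<in> saw x y \<Longrightarrow> map ((+) z) p \<in> saw (z + x) (z + y)"
  by (auto simp: saw_iff hd_map last_map distinct_map successively_translate)

lemma saw_translate_image: "saw (z + x) (z + y) = map ((+) z) ` saw x y"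
proof
  show "saw (z + x) (z + y) \<subseteq> map ((+) z) ` saw x y"
  proof
    fix p assume "p \<in> saw (z + x) (z + y)"
    then have "map ((+) (-z)) p \<in> saw x y" using saw_translate[of p "z + x" "z + y" "-z"] by simp
    moreover have "p = map ((+) z) (map ((+) (-z)) p)" by (simp add: map_idI)
    ultimately show "p \<in> map ((+) z) ` saw x y" by blast
  qed
qed (auto simp: saw_translate)

lemma ptime_shift: "ptime (shift z w) x y = ptime w (z + x) (z + y)"
  unfolding ptime_def saw_translate_image image_image
  by (intro INF_cong refl arg_cong[of _ _ ereal] path_weight_shift) (auto simp: saw_iff)

definition units :: "(int ^ 'd) set" where
  "units = {u. norm1 u = 1}"

lemma norm1_axis [simp]: "norm1 (axis k c) = \<bar>c\<bar>"
proof -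
  have "norm1 (axis k c) = (\<Sum>i\<in>UNIV. if i = k then \<bar>c\<bar> else 0)"
    unfolding norm1_def by (intro sum.cong) (auto simp: axis_def)
  then show ?thesis by simp
qed

lemma units_cases:
  assumes "u \<in> units" obtains k c where "u = axis k c" "c = 1 \<or> c = -1"
proof -
  have s: "norm1 u = 1" using assms by (simp add: units_def)
  then have "u \<noteq> 0" by auto
  then obtain k where k: "u $ k \<noteq> 0" by (auto simp: vec_eq_iff)
  have "norm1 u = \<bar>u $ k\<bar> + (\<Sum>i\<in>UNIV - {k}. \<bar>u $ i\<bar>)"
    unfolding norm1_def by (rule sum.remove) auto
  moreover have "0 \<le> (\<Sum>i\<in>UNIV - {k}. \<bar>u $ i\<bar>)" by (simp add: sum_nonneg)
  ultimately have "\<bar>u $ k\<bar> = 1" and z: "(\<Sum>i\<in>UNIV - {k}. \<bar>u $ i\<bar>) = 0" using s k by linarith+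
  from z have "\<forall>i\<in>UNIV - {k}. \<bar>u $ i\<bar> = 0" by (subst (asm) sum_nonneg_eq_0_iff) auto
  then have "u = axis k (u $ k)" by (auto simp: vec_eq_iff axis_def)
  then show ?thesis using that \<open>\<bar>u $ k\<bar> = 1\<close> by (metis abs_if minus_minus)
qed

lemma axis_in_units: "\<bar>c\<bar> = 1 \<Longrightarrow> axis k c \<in> units"
  by (simp add: units_def)

lemma finite_units [simp]: "finite units"
proof -
  have "units \<subseteq> (\<lambda>(k, c). axis k c) ` (UNIV \<times> {1, -1})"
    by (auto elim!: units_cases)
  then show ?thesis by (rule finite_subset) auto
qed

lemma units_nonempty [simp]: "units \<noteq> {}"
  using axis_in_units[of 1] by auto

lemma adjacent_iff_unit: "adjacent x y \<longleftrightarrow> y - x \<in> units"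
  by (simp add: adjacent_def units_def norm1_minus_commute)

lemma edges_at_zero: "edges_at 0 = (\<lambda>u. {0, u}) ` units"
  by (auto simp: edges_at_def adjacent_iff_unit)

subsection \<open>Upper bounds along walks\<close>

text \<open>Weights enter through their positive parts, so erasing a loop can only lower the cost.
  Such bounds add up under concatenation without the correction by the loop gain that passage times
  need.\<close>

definition reach :: "'d::finite config \<Rightarrow> int ^ 'd \<Rightarrow> int ^ 'd \<Rightarrow> real \<Rightarrow> bool" where
  "reach w x y c \<longleftrightarrow> (\<exists>p\<in>saw x y. path_weight (\<lambda>e. max 0 (w e)) p \<le> c)"

lemma reach_refl: "reach w x x 0"
  unfolding reach_def by (intro bexI[OF _ saw_singleton]) auto

lemma reach_mono: "reach w x y c \<Longrightarrow> c \<le> c' \<Longrightarrow> reach w x y c'"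
  by (auto simp: reach_def intro: order_trans)

lemma reach_commute: "reach w x y c \<Longrightarrow> reach w y x c"
  unfolding reach_def using rev_saw path_weight_rev by metis

lemma reach_trans:
  assumes "reach w x y a" "reach w y z b"
  shows "reach w x z (a + b)"
proof -
  let ?w = "\<lambda>e. max 0 (w e)"
  obtain p q where p: "p \<in> saw x y" "path_weight ?w p \<le> a" and q: "q \<in> saw y z" "path_weight ?w q \<le> b"
    using assms by (auto simp: reach_def)
  obtain p1 p2 q1 q2 u where *: "p = p1 @ u # p2" "q = q1 @ u # q2" "p1 @ u # q2 \<in> saw x z"
    using loop_erasure[OF p(1) q(1)] .
  have nn: "0 \<le> path_weight ?w r" for r by (rule path_weight_nonneg) auto
  have "path_weight ?w (p1 @ u # q2) = path_weight ?w (p1 @ [u]) + path_weight ?w (u # q2)"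
    by (rule path_weight_append)
  also have "\<dots> \<le> path_weight ?w p + path_weight ?w q"
    using path_weight_append[of ?w p1 u p2] path_weight_append[of ?w q1 u q2] nn[of "u # p2"] nn[of "q1 @ [u]"]
    unfolding * by linarith
  finally have "path_weight ?w (p1 @ u # q2) \<le> a + b" using p(2) q(2) by linarith
  then show ?thesis using *(3) unfolding reach_def by blast
qed

lemma reach_edge:
  assumes "adjacent x y"
  shows "reach w x y (max 0 (w {x, y}))"
  unfolding reach_def using assms adjacent_neq[OF assms]
  by (intro bexI[of _ "[x, y]"]) (auto simp: saw_iff)

lemma ptime_le_of_reach: "reach w x y c \<Longrightarrow> ptime w x y \<le> ereal c"
proof -
  assume "reach w x y c"
  then obtain p where p: "p \<in> saw x y" "path_weight (\<lambda>e. max 0 (w e)) p \<le> c" by (auto simp: reach_def)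
  have "ptime w x y \<le> ereal (path_weight w p)" unfolding ptime_def by (rule INF_lower[OF p(1)])
  also have "path_weight w p \<le> path_weight (\<lambda>e. max 0 (w e)) p" by (rule path_weight_mono) auto
  finally show ?thesis using p(2) by (meson ereal_less_eq(3) order_trans)
qed

lemma reach_shift:
  assumes "reach (shift z w) x y c" shows "reach w (z + x) (z + y) c"
proof -
  obtain p where p: "p \<in> saw x y" "path_weight (\<lambda>e. max 0 (shift z w e)) p \<le> c"
    using assms by (auto simp: reach_def)
  have adj: "successively adjacent p" using p by (auto simp: saw_iff)
  have "path_weight (\<lambda>e. max 0 (shift z w e)) p = path_weight (shift z (\<lambda>e. max 0 (w e))) p"
    by (rule path_weight_cong[OF adj]) (auto simp: shift_def)
  also have "\<dots> = path_weight (\<lambda>e. max 0 (w e)) (map ((+) z) p)" by (rule path_weight_shift[OF adj])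
  finally show ?thesis unfolding reach_def using p by (intro bexI[OF _ saw_translate[OF p(1)]]) auto
qed

fun path_edges :: "(int ^ 'd) list \<Rightarrow> (int ^ 'd) set set" where
  "path_edges (x # y # p) = insert {x, y} (path_edges (y # p))"
| "path_edges _ = {}"

lemma finite_path_edges [simp]: "finite (path_edges p)"
  by (induction p rule: path_edges.induct) auto

lemma path_edges_lattice: "successively adjacent p \<Longrightarrow> path_edges p \<subseteq> lattice_edges"
  by (induction p rule: path_edges.induct) (auto simp: edge_in_lattice)

text \<open>The walk may repeat vertices, since \<open>reach_trans\<close> erases loops; the detours
  used below never have to be shown self-avoiding.\<close>

lemma reach_walk:
  assumes "successively adjacent p" "p \<noteq> []" "\<And>e. e \<in> path_edges p \<Longrightarrow> max 0 (w e) \<le> c"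
  shows "reach w (hd p) (last p) (c * real (length p - 1))"
  using assms
proof (induction p rule: path_edges.induct)
  case (1 x y p)
  have "reach w x y c" using "1.prems" by (intro reach_mono[OF reach_edge]) auto
  moreover have "reach w y (last (y # p)) (c * real (length (y # p) - 1))"
  proof -
    have "reach w (hd (y # p)) (last (y # p)) (c * real (length (y # p) - 1))"
      by (rule "1.IH") (use "1.prems" in auto)
    then show ?thesis by simp
  qed
  ultimately have "reach w x (last (y # p)) (c + c * real (length (y # p) - 1))" by (rule reach_trans)
  then show ?case by (simp add: algebra_simps)
qed (auto simp: reach_refl)

subsection \<open>Edge-disjoint detours\<close>

text \<open>Here \<^term>\<open>v\<close> is a unit vector orthogonal to \<^term>\<open>s\<close>. As \<^term>\<open>u\<close> runs through the
  unit vectors, these are edge-disjoint walks from the origin to \<^term>\<open>s\<close>.\<close>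
definition detour :: "int ^ 'd \<Rightarrow> int ^ 'd \<Rightarrow> int ^ 'd \<Rightarrow> (int ^ 'd) list" where
  "detour v s u = (if u = s then [0, s] else
     if u = - s then [0, -s, v - s, v + v - s, v + v, v + v + s, v + v + s + s, v + s + s, s + s, s]
     else [0, u, u + s, s])"

lemma detour_ends: "detour v s u \<noteq> []" "hd (detour v s u) = 0" "last (detour v s u) = s"
  by (auto simp: detour_def)

lemma length_detour: "length (detour v s u) - 1 \<le> 9"
  by (auto simp: detour_def)

lemma detour_adjacent:
  assumes "s \<in> units" "u \<in> units" "v \<in> units"
  shows "successively adjacent (detour v s u)"
proof -
  have "- s \<in> units" "- v \<in> units" "- u \<in> units" using assms by (auto simp: units_def)
  then show ?thesis using assms by (auto simp: detour_def adjacent_iff_unit)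
qed

text \<open>Detours for directions \<open>u\<close> orthogonal to \<open>s\<close> stay at positions
  0 and 1 along \<open>s\<close> and at height at most 1 along \<open>v\<close>. The detour that
  starts backwards has to pass over \<open>v\<close> and \<open>v + s\<close>, which the detour
  through \<open>v\<close> may occupy, and so climbs to height 2.\<close>

definition detour_interior :: "int ^ 'd \<Rightarrow> int ^ 'd \<Rightarrow> int ^ 'd \<Rightarrow> (int ^ 'd) set" where
  "detour_interior v s u = (if u = s then {} else
     if u = - s then {-s, v - s, v + v - s, v + v, v + v + s, v + v + s + s, v + s + s, s + s}
     else {u, u + s})"

text \<open>Reduces edge-disjointness to vertex-disjointness of the interiors: only the direct edge
  from 0 to \<open>s\<close> has no interior vertex, and it belongs to the single detour
  \<open>u = s\<close>.\<close>

lemma path_edges_detour: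
  assumes "e \<in> path_edges (detour v s u)"
  shows "e \<subseteq> detour_interior v s u \<union> {0, s}" "u \<noteq> s \<Longrightarrow> e \<inter> detour_interior v s u \<noteq> {}"
  using assms by (auto simp: detour_def detour_interior_def split: if_splits)

lemma detour_interior_ends:
  assumes a: "a \<noteq> b" and s: "s = axis a \<alpha>" "\<alpha> = 1 \<or> \<alpha> = -1" and v: "v = axis b 1" and u: "u \<in> units"
  shows "0 \<notin> detour_interior v s u" "s \<notin> detour_interior v s u"
proof -
  have sa: "s $ a = \<alpha>" "s $ b = 0" "v $ a = 0" "v $ b = 1" using a by (auto simp: s v axis_def)
  have nz: "u \<noteq> 0" using u by (auto simp: units_def)
  have *: "x \<notin> detour_interior v s u" if x: "x = 0 \<or> x = s" for x
  proof
    assume A: "x \<in> detour_interior v s u"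
    then have us: "u \<noteq> s" by (auto simp: detour_interior_def)
    have xa: "x $ b = 0" "x $ a = 0 \<or> x $ a = \<alpha>" using x sa by auto
    show False
    proof (cases "u = - s")
      case True
      then have "- s \<noteq> s" using us by auto
      with A True have "x \<in> {-s, v - s, v + v - s, v + v, v + v + s, v + v + s + s, v + s + s, s + s}"
        by (simp add: detour_interior_def)
      \<comment> \<open>Every vertex of the long detour lies behind 0, beyond \<open>s\<close>, or
        at height 2, whereas 0 and \<open>s\<close> have height 0 and position 0 or
        \<alpha>.\<close>
      then have "(x $ a = - \<alpha> \<or> x $ b = 2 \<or> x $ a = 2 * \<alpha>)" using sa by auto
      then show False using xa s(2) by auto
    next
      case False
      then have "x = u \<or> x = u + s" using A us by (auto simp: detour_interior_def)
      then show False using x us False nz by (auto simp: eq_neg_iff_add_eq_0)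
    qed
  qed
  show "0 \<notin> detour_interior v s u" "s \<notin> detour_interior v s u" using * by auto
qed

lemma detour_interior_disjoint:
  assumes a: "a \<noteq> b" and s: "s = axis a \<alpha>" "\<alpha> = 1 \<or> \<alpha> = -1" and v: "v = axis b 1"
    and u: "u \<in> units" "u' \<in> units" "u \<noteq> u'"
  shows "detour_interior v s u \<inter> detour_interior v s u' = {}"
proof -
  have sa: "s $ a = \<alpha>" "s $ b = 0" "v $ a = 0" "v $ b = 1" using a by (auto simp: s v axis_def)
  have ms: "- s \<noteq> s"
  proof
    assume "- s = s"
    then have "- (s $ a) = s $ a" by (metis vector_uminus_component)
    then show False using sa s(2) by auto
  qed
  have plane: "u $ a = 0" "u $ b \<le> 1" if "u \<in> units" "u \<noteq> s" "u \<noteq> - s" for u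
  proof -
    obtain k c where k: "u = axis k c" "c = 1 \<or> c = -1" using units_cases[OF \<open>u \<in> units\<close>] .
    have "k \<noteq> a"
    proof
      assume "k = a"
      moreover have "- s = axis a (- \<alpha>)" by (simp add: s vec_eq_iff axis_def)
      ultimately show False using k s that by auto
    qed
    then show "u $ a = 0" "u $ b \<le> 1" using k by (auto simp: axis_def)
  qed
  have far: "detour_interior v s (- s) \<inter> detour_interior v s u = {}"
    if u: "u \<in> units" "u \<noteq> s" "u \<noteq> - s" for u
  proof (rule ccontr)
    assume "detour_interior v s (- s) \<inter> detour_interior v s u \<noteq> {}"
    then obtain x where x: "x \<in> detour_interior v s (- s)" "x \<in> detour_interior v s u" by blast
    from x(1) ms have "x \<in> {-s, v - s, v + v - s, v + v, v + v + s, v + v + s + s, v + s + s, s + s}"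
      by (simp add: detour_interior_def)
    then have "(x $ a = - \<alpha> \<or> x $ b = 2 \<or> x $ a = 2 * \<alpha>)" using sa by auto
    moreover from x(2) u have "x = u \<or> x = u + s" by (simp add: detour_interior_def)
    then have "x $ b \<le> 1" "x $ a = 0 \<or> x $ a = \<alpha>" using plane[OF u] sa by auto
    ultimately show False using s(2) by auto
  qed
  consider "u = s \<or> u' = s" | "u = - s" "u' \<noteq> s" | "u' = - s" "u \<noteq> s"
    | "u \<noteq> s" "u \<noteq> - s" "u' \<noteq> s" "u' \<noteq> - s" by blast
  then show ?thesis
  proof cases
    case 1 then show ?thesis by (auto simp: detour_interior_def)
  next
    case 2 then show ?thesis using far[of u'] u by auto
  next
    case 3 then show ?thesis using far[of u] u by auto
  next
    case 4
    show ?thesis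
    proof (rule ccontr)
      assume "\<not> ?thesis"
      then obtain x where x: "x = u \<or> x = u + s" "x = u' \<or> x = u' + s"
        using 4 by (auto simp: detour_interior_def)
      have "u $ a = 0" "u' $ a = 0" using plane 4 u by auto
      moreover have "(u + s) $ a = u $ a + \<alpha>" "(u' + s) $ a = u' $ a + \<alpha>" using sa by auto
      ultimately have "u \<noteq> u' + s" "u' \<noteq> u + s" using s(2) by auto
      then show False using x u(3) by auto
    qed
  qed
qed

lemma path_edges_detour_disjoint:
  assumes a: "a \<noteq> b" and s: "s = axis a \<alpha>" "\<alpha> = 1 \<or> \<alpha> = -1" and v: "v = axis b 1"
    and u: "u \<in> units" "u' \<in> units" "u \<noteq> u'"
  shows "path_edges (detour v s u) \<inter> path_edges (detour v s u') = {}"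
proof (rule ccontr)
  assume "\<not> ?thesis"
  then obtain e where e: "e \<in> path_edges (detour v s u)" "e \<in> path_edges (detour v s u')" by blast
  note ends = detour_interior_ends[OF a s v]
  note dis = detour_interior_disjoint[OF a s v u]
  from e path_edges_detour u have "e \<subseteq> detour_interior v s u \<union> {0, s}" "e \<subseteq> detour_interior v s u' \<union> {0, s}"
    by blast+
  moreover have "e \<inter> detour_interior v s u \<noteq> {} \<or> e \<inter> detour_interior v s u' \<noteq> {}"
    using path_edges_detour(2)[OF e(1)] path_edges_detour(2)[OF e(2)] u(3) by blast
  ultimately show False using dis ends[OF u(1)] ends[OF u(2)] by blast
qed

definition orthogonal_unit :: "int ^ 'd \<Rightarrow> int ^ 'd" where
  "orthogonal_unit s = (SOME v. \<exists>a b \<alpha>. a \<noteq> b \<and> s = axis a \<alpha> \<and> (\<alpha> = 1 \<or> \<alpha> = -1) \<and> v = axis b 1)"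

lemma orthogonal_unit:
  fixes s :: "int ^ 'd"
  assumes "CARD('d) \<ge> 2" "s \<in> units"
  obtains a b \<alpha> where "a \<noteq> b" "s = axis a \<alpha>" "\<alpha> = 1 \<or> \<alpha> = -1" "orthogonal_unit s = axis b 1"
proof -
  obtain a \<alpha> where s: "s = axis a \<alpha>" "\<alpha> = 1 \<or> \<alpha> = -1" using units_cases[OF assms(2)] .
  have "\<exists>b. b \<noteq> a"
  proof (rule ccontr)
    assume "\<nexists>b. b \<noteq> a"
    then have "UNIV = {a}" by auto
    then have "CARD('d) = card {a}" by simp
    then show False using assms(1) by simp
  qed
  then obtain b where "b \<noteq> a" by blast
  then have "\<exists>v. \<exists>a b \<alpha>. a \<noteq> b \<and> s = axis a \<alpha> \<and> (\<alpha> = 1 \<or> \<alpha> = -1) \<and> v = (axis b 1 :: int ^ 'd)"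
    using s by (intro exI[of _ "axis b 1"] exI[of _ a] exI[of _ b] exI[of _ \<alpha>]) auto
  from someI_ex[OF this] show ?thesis using that unfolding orthogonal_unit_def by blast
qed

abbreviation detour_edges :: "int ^ 'd \<Rightarrow> int ^ 'd \<Rightarrow> (int ^ 'd) set set" where
  "detour_edges s u \<equiv> path_edges (detour (orthogonal_unit s) s u)"

text \<open>A transversal picks one edge from every detour. As the detours are edge-disjoint, it
  picks \<open>2d\<close> different edges, whose weights have the same joint law as the weights at
  the origin.\<close>

definition transversals :: "int ^ 'd \<Rightarrow> (int ^ 'd \<Rightarrow> (int ^ 'd) set) set" where
  "transversals s = Pi\<^sub>E units (detour_edges s)"

text \<open>The min-max over the detours equals the max-min over the transversals; replacing the maximum by
  a sum keeps the moments of the minimum of \<open>2d\<close> independent weights.\<close>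
definition step_cost :: "'d::finite config \<Rightarrow> real" where
  "step_cost w = (\<Sum>s\<in>units. \<Sum>c\<in>transversals s. 9 * Min ((\<lambda>u. max 0 (w (c u))) ` units))"

lemma finite_transversals [simp]: "finite (transversals s)"
  unfolding transversals_def by (intro finite_PiE) auto

lemma Min_pos_nonneg: "0 \<le> Min ((\<lambda>u. max 0 (w (c u) :: real)) ` units)"
  by (subst Min_ge_iff) auto

lemma step_cost_nonneg [simp]: "0 \<le> step_cost w"
  unfolding step_cost_def by (intro sum_nonneg mult_nonneg_nonneg Min_pos_nonneg) auto

text \<open>If each detour contained an edge dearer than \<open>step_cost w / 9\<close>, these edges
  would form a transversal whose minimum alone, times 9, exceeds the sum defining
  \<open>step_cost\<close>. So some detour has only cheap edges, and it has at most 9 of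
  them.\<close>

lemma reach_unit_step:
  fixes s :: "int ^ 'd"
  assumes "CARD('d) \<ge> 2" "s \<in> units"
  shows "reach w 0 s (step_cost w)"
proof -
  obtain a b \<alpha> where ab: "a \<noteq> b" "s = axis a \<alpha>" "\<alpha> = 1 \<or> \<alpha> = -1" "orthogonal_unit s = axis b 1"
    using orthogonal_unit[OF assms] .
  have "\<exists>u\<in>units. \<forall>e\<in>detour_edges s u. 9 * max 0 (w e) \<le> step_cost w"
  proof (rule ccontr)
    assume "\<not> ?thesis"
    then have "\<forall>u\<in>units. \<exists>e. e \<in> detour_edges s u \<and> step_cost w < 9 * max 0 (w e)" by (auto simp: not_le)
    then obtain c0 where c0: "\<And>u. u \<in> units \<Longrightarrow> c0 u \<in> detour_edges s u \<and> step_cost w < 9 * max 0 (w (c0 u))"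
      by metis
    define c where "c = restrict c0 units"
    have c: "c \<in> transversals s" using c0 by (auto simp: c_def transversals_def)
    have "step_cost w < 9 * Min ((\<lambda>u. max 0 (w (c u))) ` units)"
    proof -
      have "Min ((\<lambda>u. max 0 (w (c u))) ` units) \<in> (\<lambda>u. max 0 (w (c u))) ` units"
        by (rule Min_in) auto
      then obtain u where "u \<in> units" "Min ((\<lambda>u. max 0 (w (c u))) ` units) = max 0 (w (c u))" by blast
      then show ?thesis using c0[of u] by (simp add: c_def)
    qed
    also have "\<dots> \<le> (\<Sum>c\<in>transversals s. 9 * Min ((\<lambda>u. max 0 (w (c u))) ` units))"
      using c by (intro member_le_sum) (auto intro: Min_pos_nonneg)
    also have "\<dots> \<le> step_cost w"
      unfolding step_cost_def using assms(2)
      by (intro member_le_sum[of s units "\<lambda>s. \<Sum>c\<in>transversals s. 9 * Min ((\<lambda>u. max 0 (w (c u))) ` units)"])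
        (auto intro!: sum_nonneg intro: Min_pos_nonneg)
    finally show False by simp
  qed
  then obtain u where u: "u \<in> units" "\<And>e. e \<in> detour_edges s u \<Longrightarrow> max 0 (w e) \<le> step_cost w / 9"
    by (auto simp: mult.commute)
  let ?p = "detour (orthogonal_unit s) s u"
  have "successively adjacent ?p"
    using assms u ab by (intro detour_adjacent) (auto simp: axis_in_units)
  from reach_walk[OF this detour_ends(1) u(2)]
  have "reach w 0 s (step_cost w / 9 * real (length ?p - 1))" by (simp add: detour_ends)
  moreover have "step_cost w / 9 * real (length ?p - 1) \<le> step_cost w / 9 * 9"
    using length_detour by (intro mult_left_mono) (auto simp: of_nat_le_iff[of _ 9, simplified])
  ultimately show ?thesis by (auto intro: reach_mono)
qed

lemma reach_step:
  fixes x :: "int ^ 'd"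
  assumes "CARD('d) \<ge> 2" "adjacent x y"
  shows "reach w x y (step_cost (shift x w))"
  using reach_shift[OF reach_unit_step[OF assms(1), of "y - x" "shift x w"]] assms(2)
  by (simp add: adjacent_iff_unit)

lemma reach_path:
  assumes "\<And>i. i < n \<Longrightarrow> reach w (\<gamma> i) (\<gamma> (Suc i)) (h i)"
  shows "reach w (\<gamma> 0) (\<gamma> n) (\<Sum>i<n. h i)"
  using assms
proof (induction n)
  case (Suc n)
  then have "reach w (\<gamma> 0) (\<gamma> n) (\<Sum>i<n. h i)" "reach w (\<gamma> n) (\<gamma> (Suc n)) (h n)" by auto
  from reach_trans[OF this] show ?case by simp
qed (simp add: reach_refl)

subsection \<open>Monotone lattice paths\<close>

text \<open>One sign vector \<sigma> serves all steps, so no coordinate ever turns back. Such a path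
  is a geodesic for \<open>norm1\<close>, and translates of it can be kept apart by looking at signs
  of coordinates only.\<close>

definition monotone_path :: "('d::finite \<Rightarrow> int) \<Rightarrow> nat \<Rightarrow> (nat \<Rightarrow> int ^ 'd) \<Rightarrow> bool" where
  "monotone_path \<sigma> n \<gamma> \<longleftrightarrow> (\<forall>k. \<bar>\<sigma> k\<bar> = 1) \<and> (\<forall>i<n. \<exists>k. \<gamma> (Suc i) = \<gamma> i + axis k (\<sigma> k))"

lemma monotone_path_exists:
  fixes y :: "int ^ 'd"
  assumes \<sigma>: "\<And>k. \<bar>\<sigma> k\<bar> = 1" and "\<And>k. 0 \<le> \<sigma> k * y $ k"
  obtains \<gamma> where "monotone_path \<sigma> (nat (norm1 y)) \<gamma>" "\<gamma> 0 = 0" "\<gamma> (nat (norm1 y)) = y"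
proof -
  have "\<exists>\<gamma>. monotone_path \<sigma> n \<gamma> \<and> \<gamma> 0 = 0 \<and> \<gamma> n = y"
    if "n = nat (norm1 y)" "\<And>k. 0 \<le> \<sigma> k * y $ k" for n and y :: "int ^ 'd"
    using that
  proof (induction n arbitrary: y)
    case 0
    then have "norm1 y = 0" using norm1_nonneg[of y] by linarith
    then have "y = 0" by simp
    then show ?case by (intro exI[of _ "\<lambda>_. 0"]) (simp add: monotone_path_def \<sigma>)
  next
    case (Suc n)
    have "y \<noteq> 0" using Suc.prems by auto
    then obtain k where k: "y $ k \<noteq> 0" by (auto simp: vec_eq_iff)
    define y' where "y' = y - axis k (\<sigma> k)"
    have sk: "\<sigma> k = 1 \<or> \<sigma> k = -1" using \<sigma>[of k] by linarith
    have yk: "0 \<le> \<sigma> k * y $ k" by (rule Suc.prems)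
    have "\<bar>y $ k\<bar> = \<bar>y' $ k\<bar> + 1" using sk yk k by (auto simp: y'_def axis_def)
    moreover have "norm1 y = \<bar>y $ k\<bar> + (\<Sum>i\<in>UNIV - {k}. \<bar>y $ i\<bar>)"
      "norm1 y' = \<bar>y' $ k\<bar> + (\<Sum>i\<in>UNIV - {k}. \<bar>y' $ i\<bar>)"
      unfolding norm1_def by (rule sum.remove; simp)+
    moreover have "(\<Sum>i\<in>UNIV - {k}. \<bar>y $ i\<bar>) = (\<Sum>i\<in>UNIV - {k}. \<bar>y' $ i\<bar>)"
      by (intro sum.cong) (auto simp: y'_def axis_def)
    ultimately have "norm1 y = norm1 y' + 1" by linarith
    then have "n = nat (norm1 y')" using Suc.prems(1) by linarith
    moreover have "0 \<le> \<sigma> i * y' $ i" for i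
    proof (cases "i = k")
      case True
      then show ?thesis using sk yk k by (auto simp: y'_def axis_def)
    next
      case False
      then show ?thesis using Suc.prems(2)[of i] by (simp add: y'_def axis_def)
    qed
    ultimately obtain \<gamma> where \<gamma>: "monotone_path \<sigma> n \<gamma>" "\<gamma> 0 = 0" "\<gamma> n = y'" using Suc.IH by blast
    have "monotone_path \<sigma> (Suc n) (\<gamma>(Suc n := y))"
      unfolding monotone_path_def
    proof (intro conjI allI impI)
      fix i assume "i < Suc n"
      then consider "i = n" | "i < n" by linarith
      then show "\<exists>k. (\<gamma>(Suc n := y)) (Suc i) = (\<gamma>(Suc n := y)) i + axis k (\<sigma> k)"
      proof cases
        case 1
        then show ?thesis using \<gamma> by (intro exI[of _ k]) (simp add: y'_def)
      next
        case 2
        then show ?thesis using \<gamma>(1) by (auto simp: monotone_path_def)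
      qed
    qed (rule \<sigma>)
    then show ?case using \<gamma>(2) by (intro exI[of _ "\<gamma>(Suc n := y)"] conjI) (assumption | simp)+
  qed
  then show ?thesis using that assms(2) by blast
qed

lemma monotone_path_adjacent:
  assumes "monotone_path \<sigma> n \<gamma>" "i < n" shows "adjacent (\<gamma> i) (\<gamma> (Suc i))"
proof -
  obtain k where "\<gamma> (Suc i) = \<gamma> i + axis k (\<sigma> k)" "\<bar>\<sigma> k\<bar> = 1"
    using assms by (auto simp: monotone_path_def)
  then show ?thesis by (simp add: adjacent_iff_unit axis_in_units)
qed

text \<open>Each step raises the sum of the signed coordinates by exactly 1 and lowers no signed
  coordinate. For the difference of two points the signed coordinates are thus the absolute values,
  and distance equals difference of indices.\<close>

lemma monotone_path_increasing:
  assumes "monotone_path \<sigma> n \<gamma>" "i \<le> j" "j \<le> n"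
  shows "0 \<le> \<sigma> l * (\<gamma> j - \<gamma> i) $ l" "norm1 (\<gamma> j - \<gamma> i) = int (j - i)"
proof -
  have \<sigma>: "\<bar>\<sigma> k\<bar> = 1" for k using assms(1) by (auto simp: monotone_path_def)
  have ss: "\<sigma> k * \<sigma> k = 1" for k using \<sigma>[of k] by (auto simp: abs_if split: if_splits)
  have inc: "(\<forall>l. 0 \<le> \<sigma> l * (\<gamma> j - \<gamma> i) $ l) \<and> (\<Sum>l\<in>UNIV. \<sigma> l * (\<gamma> j - \<gamma> i) $ l) = int (j - i)"
    using assms(2,3)
  proof (induction j rule: dec_induct)
    case base then show ?case by simp
  next
    case (step m)
    then have "m < n" by simp
    then obtain k where k: "\<gamma> (Suc m) = \<gamma> m + axis k (\<sigma> k)" using assms(1) unfolding monotone_path_def by blast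
    have *: "\<sigma> l * (\<gamma> (Suc m) - \<gamma> i) $ l = \<sigma> l * (\<gamma> m - \<gamma> i) $ l + (if l = k then 1 else 0)" for l
      by (auto simp: k axis_def algebra_simps ss)
    have "(\<Sum>l\<in>UNIV. \<sigma> l * (\<gamma> (Suc m) - \<gamma> i) $ l) = (\<Sum>l\<in>UNIV. \<sigma> l * (\<gamma> m - \<gamma> i) $ l) + 1"
      unfolding * by (subst sum.distrib) simp
    then show ?case using step * by auto
  qed
  then show "0 \<le> \<sigma> l * (\<gamma> j - \<gamma> i) $ l" by blast
  have "\<bar>(\<gamma> j - \<gamma> i) $ l\<bar> = \<sigma> l * (\<gamma> j - \<gamma> i) $ l" for l
  proof -
    have "\<bar>\<sigma> l * (\<gamma> j - \<gamma> i) $ l\<bar> = \<bar>(\<gamma> j - \<gamma> i) $ l\<bar>" using \<sigma>[of l] by (simp add: abs_mult)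
    moreover have "\<bar>\<sigma> l * (\<gamma> j - \<gamma> i) $ l\<bar> = \<sigma> l * (\<gamma> j - \<gamma> i) $ l"
      using inc by (intro abs_of_nonneg) blast
    ultimately show ?thesis by (simp only:)
  qed
  then show "norm1 (\<gamma> j - \<gamma> i) = int (j - i)" using inc by (simp add: norm1_def)
qed

lemma reach_monotone_path:
  fixes \<gamma> :: "nat \<Rightarrow> int ^ 'd"
  assumes "CARD('d) \<ge> 2" "monotone_path \<sigma> n \<gamma>"
  shows "reach w (z + \<gamma> 0) (z + \<gamma> n) (\<Sum>i<n. step_cost (shift (z + \<gamma> i) w))"
  by (rule reach_path[of n w "\<lambda>i. z + \<gamma> i"])
    (use assms monotone_path_adjacent in \<open>auto intro!: reach_step\<close>)

definition orientation :: "int ^ 'd \<Rightarrow> 'd \<Rightarrow> int" where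
  "orientation y k = (if 0 \<le> y $ k then 1 else -1)"

lemma orientation: "\<bar>orientation y k\<bar> = 1" "0 \<le> orientation y k * y $ k"
  by (auto simp: orientation_def)

lemma saw_nonempty:
  fixes x y :: "int ^ 'd"
  assumes "CARD('d) \<ge> 2" shows "saw x y \<noteq> {}"
proof -
  obtain \<gamma> where \<gamma>: "monotone_path (orientation (y - x)) (nat (norm1 (y - x))) \<gamma>" "\<gamma> 0 = 0"
      "\<gamma> (nat (norm1 (y - x))) = y - x"
    using monotone_path_exists[OF orientation] by blast
  from reach_monotone_path[OF assms \<gamma>(1), of "\<lambda>_. 0" x] \<gamma> show ?thesis by (auto simp: reach_def)
qed

subsection \<open>Loop erasure with negative weights\<close>

definition loop_gain :: "'d::finite config \<Rightarrow> int ^ 'd \<Rightarrow> ereal" where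
  "loop_gain w y = 2 * (SUP v. max 0 (- ptime w y v))"

lemma A_var_eq_loop_gain: "A_var t \<omega> = loop_gain (\<lambda>e. t e \<omega>) 0"
  by (simp add: A_var_def loop_gain_def passage_time_eq_ptime)

lemma loop_gain_shift: "loop_gain (shift z w) y = loop_gain w (z + y)"
proof -
  define f where "f v = max 0 (- ptime w (z + y) v)" for v
  have "range ((+) z) = UNIV" by (rule surj_plus)
  then have "f ` range ((+) z) = range f" by (simp only:)
  then have "range (\<lambda>v. f (z + v)) = range f" by (simp only: image_image)
  then have "Sup (range (\<lambda>v. f (z + v))) = Sup (range f)" by (simp only:)
  moreover have "loop_gain (shift z w) y = 2 * Sup (range (\<lambda>v. f (z + v)))"
    by (simp only: loop_gain_def ptime_shift f_def[abs_def])
  moreover have "loop_gain w (z + y) = 2 * Sup (range f)"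
    by (simp only: loop_gain_def f_def[abs_def])
  ultimately show ?thesis by (simp only:)
qed

lemma loop_gain_cong:
  assumes "\<And>e. e \<in> lattice_edges \<Longrightarrow> w e = w' e"
  shows "loop_gain w y = loop_gain w' y"
  unfolding loop_gain_def using ptime_cong[OF assms, where x = y] by simp

text \<open>Finiteness is asked at every vertex so that the event is translation invariant.
  \<open>stime\<close> is set to 0 off this event, so that nonnegativity, subadditivity and
  stationarity hold for all configurations and not just almost surely.\<close>

definition tame :: "'d::finite config \<Rightarrow> bool" where
  "tame w \<longleftrightarrow> (\<forall>y. loop_gain w y < \<infinity>)"

lemma tame_shift: "tame (shift z w) \<longleftrightarrow> tame w"
proof -
  have "loop_gain w y < \<infinity>" if "\<forall>y. loop_gain w (z + y) < \<infinity>" for y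
    using spec[OF that, of "y - z"] by simp
  then show ?thesis unfolding tame_def loop_gain_shift by blast
qed

definition rtime :: "'d::finite config \<Rightarrow> int ^ 'd \<Rightarrow> int ^ 'd \<Rightarrow> real" where
  "rtime w x y = real_of_ereal (ptime w x y)"

definition gain :: "'d::finite config \<Rightarrow> int ^ 'd \<Rightarrow> real" where
  "gain w y = real_of_ereal (loop_gain w y)"

lemma rtime_commute: "rtime w x y = rtime w y x"
  by (simp add: rtime_def ptime_commute)

lemma loop_gain_nonneg: "0 \<le> loop_gain w y"
proof -
  have "0 \<le> (SUP v. max 0 (- ptime w y v))" by (rule SUP_upper2[of y]) auto
  then show ?thesis by (simp add: loop_gain_def)
qed

lemma gain_nonneg: "0 \<le> gain w y"
  by (simp add: gain_def loop_gain_nonneg real_of_ereal_pos)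

lemma loop_gain_eq: "tame w \<Longrightarrow> loop_gain w y = ereal (gain w y)"
  using loop_gain_nonneg[of w y] by (cases "loop_gain w y") (auto simp: gain_def tame_def)

lemma minus_ptime_le: "tame w \<Longrightarrow> - ptime w y v \<le> ereal (gain w y / 2)"
proof -
  assume "tame w"
  have "- ptime w y v \<le> max 0 (- ptime w y v)" by simp
  also have "\<dots> \<le> (SUP v. max 0 (- ptime w y v))" by (rule SUP_upper) auto
  finally have *: "- ptime w y v \<le> (SUP v. max 0 (- ptime w y v))" (is "_ \<le> ?S") .
  have "2 * ?S = ereal (gain w y)" using loop_gain_eq[OF \<open>tame w\<close>] by (simp add: loop_gain_def)
  then have "?S = ereal (gain w y / 2)" by (cases ?S) auto
  then show ?thesis using * by simp
qed

context
  fixes w :: "'d::finite config"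
  assumes dim: "CARD('d) \<ge> 2" and tame: "tame w"
begin

lemma ptime_eq_rtime: "ptime w x y = ereal (rtime w x y)"
proof -
  obtain p where p: "p \<in> saw x y" using saw_nonempty[OF dim, of x y] by auto
  have "ptime w x y \<le> ereal (path_weight w p)" unfolding ptime_def by (rule INF_lower[OF p])
  then show ?thesis using minus_ptime_le[OF tame, of x y] by (cases "ptime w x y") (auto simp: rtime_def)
qed

lemma minus_rtime_le: "- rtime w x y \<le> gain w x / 2"
  using minus_ptime_le[OF tame, of x y] by (simp add: ptime_eq_rtime)

lemma rtime_le_path_weight: "p \<in> saw x y \<Longrightarrow> rtime w x y \<le> path_weight w p"
  using INF_lower[of p "saw x y" "\<lambda>p. ereal (path_weight w p)"] ptime_eq_rtime[of x y]
  by (simp add: ptime_def)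

lemma rtime_approx:
  assumes "0 < e" obtains p where "p \<in> saw x y" "path_weight w p < rtime w x y + e"
proof -
  have "ptime w x y < ereal (rtime w x y + e)" using assms by (simp add: ptime_eq_rtime)
  then show ?thesis using that by (auto simp: ptime_def INF_less_iff)
qed

lemma rtime_le_of_reach: "reach w x y c \<Longrightarrow> rtime w x y \<le> c"
  using ptime_le_of_reach[of w x y c] by (simp add: ptime_eq_rtime)

lemma rtime_triangle: "rtime w x z \<le> rtime w x y + rtime w y z + gain w y"
proof (rule field_le_epsilon)
  fix e :: real assume "0 < e"
  then have "0 < e / 2" by simp
  obtain p where p: "p \<in> saw x y" "path_weight w p < rtime w x y + e / 2" using rtime_approx[OF \<open>0 < e / 2\<close>] .
  obtain q where q: "q \<in> saw y z" "path_weight w q < rtime w y z + e / 2" using rtime_approx[OF \<open>0 < e / 2\<close>] .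
  obtain p1 p2 q1 q2 u where *: "p = p1 @ u # p2" "q = q1 @ u # q2" "p1 @ u # q2 \<in> saw x z"
    using loop_erasure[OF p(1) q(1)] .
  have "u # p2 \<in> saw u y" "q1 @ [u] \<in> saw y u"
    using saw_split p(1) q(1) unfolding *(1,2) by blast+
  then have "rtime w u y \<le> path_weight w (u # p2)" "rtime w y u \<le> path_weight w (q1 @ [u])"
    by (auto intro: rtime_le_path_weight)
  \<comment> \<open>Both erased pieces join \<open>y\<close> to \<open>u\<close>, so each weighs at
    least minus half the gain at \<open>y\<close>; together they cost at most one full gain.\<close>
  then have "- path_weight w (u # p2) \<le> gain w y / 2" "- path_weight w (q1 @ [u]) \<le> gain w y / 2"
    using minus_rtime_le[of y u] rtime_commute[of w u y] by linarith+
  moreover have "rtime w x z \<le> path_weight w (p1 @ [u]) + path_weight w (u # q2)"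
    using rtime_le_path_weight[OF *(3)] path_weight_append[of w p1 u q2] by simp
  moreover have "path_weight w p = path_weight w (p1 @ [u]) + path_weight w (u # p2)"
    "path_weight w q = path_weight w (q1 @ [u]) + path_weight w (u # q2)"
    unfolding *(1,2) by (rule path_weight_append)+
  ultimately show "rtime w x z \<le> rtime w x y + rtime w y z + gain w y + e" using p(2) q(2) by linarith
qed

end

text \<open>Adding the loop gain at the end point turns the passage time into a nonnegative subadditive process.\<close>
definition stime :: "'d::finite config \<Rightarrow> int ^ 'd \<Rightarrow> int ^ 'd \<Rightarrow> real" where
  "stime w x y = (if tame w then rtime w x y + gain w y else 0)"

lemma stime_shift: "stime (shift z w) x y = stime w (z + x) (z + y)"
  by (simp add: stime_def tame_shift rtime_def gain_def ptime_shift loop_gain_shift)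

lemma stime_nonneg:
  fixes w :: "'d::finite config"
  assumes "CARD('d) \<ge> 2" shows "0 \<le> stime w x y"
  using minus_rtime_le[OF assms, of w y x] gain_nonneg[of w y] by (auto simp: stime_def rtime_commute)

lemma stime_triangle:
  fixes w :: "'d::finite config"
  assumes "CARD('d) \<ge> 2" shows "stime w x z \<le> stime w x y + stime w y z"
  using rtime_triangle[OF assms, of w x z y] by (auto simp: stime_def)

lemma stime_le_of_reach:
  fixes w :: "'d::finite config"
  assumes "CARD('d) \<ge> 2" "reach w x y c" "0 \<le> c"
  shows "stime w x y \<le> c + gain w y"
  using rtime_le_of_reach[OF assms(1) _ assms(2)] assms(3) gain_nonneg[of w y] by (auto simp: stime_def)

subsection \<open>Subadditive and additive processes over an ergodic map\<close>

text \<open>The zero-one law is asked for events with one-sided invariance, preimage contained in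
  the event. This is what an inequality such as subadditivity yields directly, without passing to
  null-set modifications.\<close>

locale ergodic_map = prob_space M for M :: "'a measure" +
  fixes \<theta> :: "'a \<Rightarrow> 'a"
  assumes measurable_map [measurable]: "\<theta> \<in> measurable M M"
    and preserving: "distr M M \<theta> = M"
    and ergodic: "\<And>D. D \<in> sets M \<Longrightarrow> (\<And>w. w \<in> space M \<Longrightarrow> \<theta> w \<in> D \<Longrightarrow> w \<in> D) \<Longrightarrow> prob D = 0 \<or> prob D = 1"
begin

lemma measurable_iterate [measurable]: "(\<theta> ^^ n) \<in> measurable M M"
  by (induction n) (auto intro: measurable_comp[OF _ measurable_map])

lemma distr_iterate: "distr M M (\<theta> ^^ n) = M"
proof (induction n)
  case (Suc n)
  have "distr M M (\<theta> ^^ Suc n) = distr (distr M M (\<theta> ^^ n)) M \<theta>"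
    by (subst distr_distr) auto
  then show ?case by (simp only: Suc preserving)
qed (simp add: distr_id2)

lemma iterate_space: "w \<in> space M \<Longrightarrow> (\<theta> ^^ n) w \<in> space M"
  using measurable_iterate[of n] by (rule measurable_space)

lemma integrable_iterate:
  fixes g :: "'a \<Rightarrow> real"
  assumes "integrable M g"
  shows "integrable M (\<lambda>w. g ((\<theta> ^^ n) w))"
  using integrable_distr[OF measurable_iterate[of n], of g] assms by (simp add: distr_iterate)

lemma integral_iterate:
  fixes g :: "'a \<Rightarrow> real"
  assumes "g \<in> borel_measurable M"
  shows "(\<integral>w. g ((\<theta> ^^ n) w) \<partial>M) = integral\<^sup>L M g"
  using integral_distr[OF measurable_iterate[of n], of g] assms by (simp add: distr_iterate)

text \<open>If a good block almost surely starts at the present position, its length can be capped: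
  by dominated convergence the part of the integral of \<open>g\<close> over points without a good
  block of length at most \<open>K\<close> vanishes as \<open>K\<close> grows.\<close>

lemma waiting_time_tail:
  fixes g :: "'a \<Rightarrow> real"
  assumes [measurable]: "\<And>n::nat. Measurable.pred M (Q n)"
    and "AE w in M. \<exists>n\<ge>1. Q n w" and g: "integrable M g" and "e > 0"
  obtains K :: nat where "(\<integral>w. g w * of_bool (\<forall>n\<in>{1..K}. \<not> Q n w) \<partial>M) < e"
proof -
  have [measurable]: "g \<in> borel_measurable M" using g by simp
  have "(\<lambda>K. \<integral>w. g w * of_bool (\<forall>n\<in>{1..K}. \<not> Q n w) \<partial>M) \<longlonglongrightarrow> (\<integral>w. 0 \<partial>M)"
  proof (rule integral_dominated_convergence[where w = "\<lambda>w. norm (g w)"])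
    show "AE w in M. (\<lambda>K. g w * of_bool (\<forall>n\<in>{1..K}. \<not> Q n w)) \<longlonglongrightarrow> 0"
      using assms(2)
    proof eventually_elim
      case (elim w)
      then obtain n where "n \<ge> 1" "Q n w" by auto
      then have "\<forall>\<^sub>F K in sequentially. g w * of_bool (\<forall>n\<in>{1..K}. \<not> Q n w) = 0"
        by (intro eventually_sequentiallyI[of n]) auto
      then show ?case by (rule tendsto_eventually)
    qed
  qed (use g in \<open>auto simp: of_bool_def\<close>)
  then have "\<forall>\<^sub>F K in sequentially. (\<integral>w. g w * of_bool (\<forall>n\<in>{1..K}. \<not> Q n w) \<partial>M) < e"
    using \<open>e > 0\<close> by (simp add: order_tendstoD)
  then show ?thesis using that by (auto simp: eventually_sequentially)
qed

end

text \<open>From the current position jump over a cheap block of length at most \<^term>\<open>K\<close> if one starts there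
  and fits before \<^term>\<open>N\<close>; otherwise make a single step.\<close>
lemma greedy_subadditive:
  fixes F :: "nat \<Rightarrow> nat \<Rightarrow> real"
  assumes sub: "\<And>i j k. i \<le> j \<Longrightarrow> j \<le> k \<Longrightarrow> F i k \<le> F i j + F j k"
    and nn: "\<And>i. 0 \<le> F i (Suc i)" and c: "0 \<le> c"
    and good: "\<And>i. \<not> bad i \<Longrightarrow> \<exists>n\<in>{1..K}. F i (i + n) \<le> c * n"
    and "i \<le> N"
  shows "F i N \<le> c * real (N - i) + (\<Sum>j\<in>{i..<N}. F j (Suc j) * of_bool (bad j \<or> N < j + K)) + F N N"
  using \<open>i \<le> N\<close>
proof (induction i rule: measure_induct_rule[where f = "\<lambda>i. N - i"])
  case (less i)
  let ?g = "\<lambda>j. F j (Suc j) * of_bool (bad j \<or> N < j + K)"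
  have gnn: "0 \<le> ?g j" for j using nn by auto
  consider "i = N" | "i < N" "bad i \<or> N < i + K" | "i < N" "\<not> bad i" "i + K \<le> N"
    using less.prems by linarith
  then show ?case
  proof cases
    case 1 then show ?thesis by simp
  next
    case 2
    have "F i N \<le> F i (Suc i) + F (Suc i) N" using 2 by (intro sub) auto
    also have "F (Suc i) N \<le> c * real (N - Suc i) + (\<Sum>j\<in>{Suc i..<N}. ?g j) + F N N"
      using 2 by (intro less.IH) auto
    also have "c * real (N - Suc i) \<le> c * real (N - i)" using c by (intro mult_left_mono) auto
    finally have "F i N \<le> F i (Suc i) + (c * real (N - i) + (\<Sum>j\<in>{Suc i..<N}. ?g j) + F N N)" by simp
    moreover have "(\<Sum>j\<in>{i..<N}. ?g j) = F i (Suc i) + (\<Sum>j\<in>{Suc i..<N}. ?g j)"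
      using 2 by (subst sum.atLeast_Suc_lessThan) auto
    ultimately show ?thesis by linarith
  next
    case 3
    then obtain n where n: "1 \<le> n" "n \<le> K" "F i (i + n) \<le> c * n" using good by fastforce
    have "F i N \<le> F i (i + n) + F (i + n) N" using n 3 by (intro sub) auto
    also have "F (i + n) N \<le> c * real (N - (i + n)) + (\<Sum>j\<in>{i + n..<N}. ?g j) + F N N"
      using 3 n by (intro less.IH) auto
    also have "(\<Sum>j\<in>{i + n..<N}. ?g j) \<le> (\<Sum>j\<in>{i..<N}. ?g j)"
      using gnn by (intro sum_mono2) auto
    finally have "F i N \<le> c * n + (c * real (N - (i + n)) + (\<Sum>j\<in>{i..<N}. ?g j) + F N N)"
      using n(3) by linarith
    moreover have "c * n + c * real (N - (i + n)) = c * real (N - i)"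
      using 3 n by (simp add: of_nat_diff algebra_simps)
    ultimately show ?thesis by linarith
  qed
qed

text \<open>Counterpart of the previous tiling for lower bounds. A good position with enough room
  either starts a chosen block or lies in one chosen before, so such positions number at most the
  total block length; positions outside the blocks contribute nonnegative terms and are
  dropped.\<close>

lemma greedy_sum:
  fixes h :: "nat \<Rightarrow> real"
  assumes nn: "\<And>i. 0 \<le> h i" and c: "0 \<le> c"
    and good: "\<And>i. \<not> bad i \<Longrightarrow> \<exists>n\<in>{1..K}. c * n \<le> (\<Sum>j\<in>{i..<i + n}. h j)"
    and "i \<le> N"
  shows "c * (\<Sum>j\<in>{i..<N}. of_bool (\<not> bad j \<and> j + K \<le> N)) \<le> (\<Sum>j\<in>{i..<N}. h j)"
  using \<open>i \<le> N\<close>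
proof (induction "N - i" arbitrary: i rule: less_induct)
  case less
  let ?g = "\<lambda>j. of_bool (\<not> bad j \<and> j + K \<le> N) :: real"
  consider "i = N" | "i < N" "bad i \<or> N < i + K" | "i < N" "\<not> bad i" "i + K \<le> N"
    using less.prems by linarith
  then show ?case
  proof cases
    case 1 then show ?thesis by simp
  next
    case 2
    have "c * (\<Sum>j\<in>{i..<N}. ?g j) = c * (\<Sum>j\<in>{Suc i..<N}. ?g j)"
      using 2 by (subst sum.atLeast_Suc_lessThan) auto
    also have "\<dots> \<le> (\<Sum>j\<in>{Suc i..<N}. h j)" using 2 by (intro less.hyps) auto
    also have "\<dots> \<le> (\<Sum>j\<in>{i..<N}. h j)" using nn by (intro sum_mono2) auto
    finally show ?thesis .
  next
    case 3
    then obtain n where n: "1 \<le> n" "n \<le> K" "c * n \<le> (\<Sum>j\<in>{i..<i + n}. h j)" using good by fastforce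
    have split: "(\<Sum>j\<in>{i..<N}. r j) = (\<Sum>j\<in>{i..<i + n}. r j) + (\<Sum>j\<in>{i + n..<N}. r j)" for r :: "nat \<Rightarrow> real"
      using 3 n by (intro sum.atLeastLessThan_concat[symmetric]) auto
    have "(\<Sum>j\<in>{i..<i + n}. ?g j) \<le> (\<Sum>j\<in>{i..<i + n}. 1)" by (intro sum_mono) auto
    then have "c * (\<Sum>j\<in>{i..<i + n}. ?g j) \<le> c * n" using c by (intro mult_left_mono) auto
    moreover have "c * (\<Sum>j\<in>{i + n..<N}. ?g j) \<le> (\<Sum>j\<in>{i + n..<N}. h j)"
      using 3 n by (intro less.hyps) auto
    ultimately show ?thesis using n(3) by (simp add: split distrib_left)
  qed
qed

context ergodic_map
begin

text \<open>The event that \<open>f n / n\<close> has lower limit below \<open>b\<close> is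
  one-sidedly invariant, because moving from \<open>\<theta> w\<close> to \<open>w\<close> changes
  \<open>f\<close> by the fixed amount \<open>g w\<close>, negligible against \<open>n\<close>. Its
  probability is 0 or 1, which gives the two alternatives. The lemma is used for a subadditive
  process and for negated Birkhoff sums.\<close>

lemma growth_dichotomy:
  fixes f :: "nat \<Rightarrow> 'a \<Rightarrow> real"
  assumes [measurable]: "\<And>n. f n \<in> borel_measurable M"
    and sub: "\<And>n w. w \<in> space M \<Longrightarrow> f (Suc n) w \<le> g w + f n (\<theta> w)" and b: "c < b"
  shows "(AE w in M. \<forall>\<^sub>F n in sequentially. c * real n \<le> f n w) \<or> (AE w in M. \<exists>n\<ge>1. f n w \<le> b * real n)"
proof -
  \<comment> \<open>The margin \<open>1 / Suc k\<close> expresses a lower limit strictly below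
    \<open>b\<close>. The quantifier over \<open>k\<close> lets each application of invariance use
    up a little of the margin.\<close>
  define D where "D = {w \<in> space M. \<exists>k::nat. \<forall>N. \<exists>n\<ge>N. f n w < (b - 1 / Suc k) * n}"
  have D [measurable]: "D \<in> sets M" unfolding D_def by measurable
  have "prob D = 0 \<or> prob D = 1"
  proof (rule ergodic[OF D])
    fix w assume w: "w \<in> space M" "\<theta> w \<in> D"
    then obtain k where k: "\<And>N. \<exists>n\<ge>N. f n (\<theta> w) < (b - 1 / Suc k) * n" by (auto simp: D_def)
    define \<delta> :: real where "\<delta> = 1 / Suc k - 1 / Suc (Suc k)"
    have \<delta>: "\<delta> > 0" by (simp add: \<delta>_def frac_less2)
    have "\<exists>n\<ge>N. f n w < (b - 1 / Suc (Suc k)) * n" for N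
    proof -
      \<comment> \<open>From here on the gap \<delta> between two consecutive margins, times
        \<open>n\<close>, absorbs both \<open>g w\<close> and the change of index from
        \<open>n\<close> to \<open>Suc n\<close>.\<close>
      obtain N' :: nat where N': "N' \<ge> (g w + \<bar>b - 1 / Suc (Suc k)\<bar>) / \<delta>"
        using real_arch_simple by blast
      obtain n where n: "n \<ge> max N N'" "f n (\<theta> w) < (b - 1 / Suc k) * n" using k by blast
      have "real n \<ge> (g w + \<bar>b - 1 / Suc (Suc k)\<bar>) / \<delta>" using N' n by linarith
      then have *: "g w + \<bar>b - 1 / Suc (Suc k)\<bar> \<le> \<delta> * n" using \<delta> by (metis pos_divide_le_eq mult.commute)
      have "f (Suc n) w \<le> g w + f n (\<theta> w)" by (rule sub[OF w(1)])
      also have "\<dots> < g w + (b - 1 / Suc k) * n" using n by simp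
      also have "\<dots> = g w - \<delta> * n + (b - 1 / Suc (Suc k)) * n" by (simp add: \<delta>_def algebra_simps)
      also have "\<dots> \<le> (b - 1 / Suc (Suc k)) * n - \<bar>b - 1 / Suc (Suc k)\<bar>" using * by linarith
      also have "\<dots> \<le> (b - 1 / Suc (Suc k)) * Suc n" by (simp add: distrib_left abs_if)
      finally show ?thesis using n by (intro exI[of _ "Suc n"]) auto
    qed
    then show "w \<in> D" using w(1) unfolding D_def mem_Collect_eq by blast
  qed
  then show ?thesis
  proof
    assume "prob D = 0"
    then have "AE w in M. w \<notin> D" using D by (simp add: AE_iff_measurable[OF D] emeasure_eq_measure prob_eq_0)
    then have "AE w in M. \<forall>\<^sub>F n in sequentially. c * real n \<le> f n w"
    proof (rule AE_mp, intro AE_I2 impI)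
      fix w assume w: "w \<in> space M" "w \<notin> D"
      obtain k :: nat where k: "1 / Suc k < b - c" using b by (metis diff_gt_0_iff_gt nat_approx_posE)
      from w obtain N where N: "\<And>n. n \<ge> N \<Longrightarrow> \<not> f n w < (b - 1 / Suc k) * n" unfolding D_def by blast
      show "\<forall>\<^sub>F n in sequentially. c * real n \<le> f n w"
      proof (rule eventually_sequentiallyI[of N])
        fix n assume "n \<ge> N"
        have "c * n \<le> (b - 1 / Suc k) * n" using k by (intro mult_right_mono) auto
        then show "c * n \<le> f n w" using N[OF \<open>n \<ge> N\<close>] by simp
      qed
    qed
    then show ?thesis ..
  next
    assume "prob D = 1"
    then have "AE w in M. w \<in> D" by (simp add: AE_prob_1)
    then have "AE w in M. \<exists>n\<ge>1. f n w \<le> b * n"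
    proof eventually_elim
      case (elim w)
      then obtain k where "\<And>N. \<exists>n\<ge>N. f n w < (b - 1 / Suc k) * n" by (auto simp: D_def)
      from this[of 1] obtain n where n: "n \<ge> 1" "f n w < (b - 1 / Suc k) * n" by auto
      have "(b - 1 / Suc k) * n \<le> b * n" by (intro mult_right_mono) auto
      then show ?case using n by (intro exI[of _ n] conjI) linarith+
    qed
    then show ?thesis ..
  qed
qed

theorem subadditive_lower_bound:
  fixes f :: "nat \<Rightarrow> 'a \<Rightarrow> real"
  assumes int: "\<And>n. integrable M (f n)"
    and nn: "\<And>n w. w \<in> space M \<Longrightarrow> 0 \<le> f n w"
    and sub: "\<And>m n w. w \<in> space M \<Longrightarrow> f (m + n) w \<le> f m w + f n ((\<theta> ^^ m) w)"
    and mean: "\<And>n. m * real n \<le> expectation (f n)" and "c < m"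
  shows "AE w in M. \<forall>\<^sub>F n in sequentially. c * real n \<le> f n w"
proof (cases "c \<le> 0")
  case True
  show ?thesis
  proof (rule AE_I2)
    fix w assume "w \<in> space M"
    then have "c * real n \<le> f n w" for n
      using nn[of w n] True by (meson mult_nonpos_nonneg of_nat_0_le_iff order_trans)
    then show "\<forall>\<^sub>F n in sequentially. c * real n \<le> f n w" by simp
  qed
next
  case False
  \<comment> \<open>The tiling needs a nonnegative rate; for \<open>c \<le> 0\<close> nonnegativity
    of \<open>f\<close> already gave the claim.\<close>
  define b where "b = (c + m) / 2"
  have b: "c < b" "b < m" "0 < b" using False \<open>c < m\<close> by (auto simp: b_def)
  have [measurable]: "f n \<in> borel_measurable M" for n using int by auto
  have "\<not> (AE w in M. \<exists>n\<ge>1. f n w \<le> b * real n)"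
  proof
    assume ex: "AE w in M. \<exists>n\<ge>1. f n w \<le> b * real n"
    obtain K where K: "(\<integral>w. f 1 w * of_bool (\<forall>n\<in>{1..K}. \<not> f n w \<le> b * n) \<partial>M) < m - b"
      by (rule waiting_time_tail[OF _ ex int, of "m - b"]) (use b in auto)
    define bad where "bad w \<longleftrightarrow> (\<forall>n\<in>{1..K}. \<not> f n w \<le> b * n)" for w
    have [measurable]: "Measurable.pred M bad" unfolding bad_def by measurable
    define e where "e = (\<integral>w. f 1 w * of_bool (bad w) \<partial>M)"
    have int_bad: "integrable M (\<lambda>w. f 1 w * of_bool (bad w))"
      by (rule Bochner_Integration.integrable_bound[OF int[of 1]]) auto
    have e: "e < m - b" using K by (simp add: e_def bad_def)
    have Ef1: "0 \<le> expectation (f 1)" using nn by (intro integral_nonneg_AE) auto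
    \<comment> \<open>Expected cost of the tiling: rate \<open>b\<close> on blocks, mean
      \<open>e\<close> for a single step at a bad position, at most \<open>K\<close> further single
      steps near the end, and \<open>f 0\<close>, which need not vanish. Since
      \<open>e < m - b\<close>, this grows more slowly than the mean and is contradictory for large
      \<open>N\<close>.\<close>
    have bound: "m * N \<le> b * N + (N * e + K * expectation (f 1)) + expectation (f 0)" for N :: nat
    proof -
      let ?s = "\<lambda>j w. f 1 ((\<theta> ^^ j) w) * of_bool (bad ((\<theta> ^^ j) w)) + f 1 ((\<theta> ^^ j) w) * of_bool (N < j + K)"
      have ints: "integrable M (?s j)" for j
        using integrable_iterate[OF int_bad, of j] integrable_iterate[OF int[of 1], of j] by auto
      define cnt :: real where "cnt = (\<Sum>j\<in>{0..<N}. of_bool (N < j + K))"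
      have "cnt = real (card {j\<in>{0..<N}. N < j + K})" by (simp add: cnt_def Int_def)
      also have "card {j\<in>{0..<N}. N < j + K} \<le> card {N - K..<N}" by (intro card_mono) auto
      finally have cnt: "cnt \<le> K" by simp
      have "expectation (?s j) = e + expectation (f 1) * of_bool (N < j + K)" for j
        using integrable_iterate[OF int_bad, of j] integrable_iterate[OF int[of 1], of j]
          integral_iterate[of "f 1" j] integral_iterate[of "\<lambda>w. f 1 w * of_bool (bad w)" j]
        by (simp add: e_def)
      then have sums: "(\<Sum>j\<in>{0..<N}. expectation (?s j)) = N * e + expectation (f 1) * cnt"
        by (simp add: sum.distrib sum_distrib_left cnt_def del: sum_mult_of_bool_eq sum_of_bool_eq)
      have "m * N \<le> expectation (f N)" by (rule mean)
      also have "\<dots> \<le> expectation (\<lambda>w. b * N + (\<Sum>j\<in>{0..<N}. ?s j w) + f 0 ((\<theta> ^^ N) w))"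
      proof (rule integral_mono_AE)
        show "integrable M (\<lambda>w. b * N + (\<Sum>j\<in>{0..<N}. ?s j w) + f 0 ((\<theta> ^^ N) w))"
          using ints integrable_iterate[OF int[of 0], of N] by auto
        show "AE w in M. f N w \<le> b * N + (\<Sum>j\<in>{0..<N}. ?s j w) + f 0 ((\<theta> ^^ N) w)"
        proof (rule AE_I2)
          fix w assume w: "w \<in> space M"
          define F where "F i j = f (j - i) ((\<theta> ^^ i) w)" for i j
          have "F 0 N \<le> b * real (N - 0) + (\<Sum>j\<in>{0..<N}. F j (Suc j) * of_bool (bad ((\<theta> ^^ j) w) \<or> N < j + K)) + F N N"
          proof (rule greedy_subadditive)
            fix i j k :: nat assume "i \<le> j" "j \<le> k"
            then show "F i k \<le> F i j + F j k"
              using sub[OF iterate_space[OF w, of i], of "j - i" "k - j"]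
              by (simp add: F_def funpow_add[THEN fun_cong, simplified, symmetric])
          next
            fix i show "0 \<le> F i (Suc i)" using nn iterate_space[OF w] by (simp add: F_def)
          next
            fix i assume "\<not> bad ((\<theta> ^^ i) w)"
            then show "\<exists>n\<in>{1..K}. F i (i + n) \<le> b * n" by (auto simp: F_def bad_def)
          qed (use b in auto)
          also have "(\<Sum>j\<in>{0..<N}. F j (Suc j) * of_bool (bad ((\<theta> ^^ j) w) \<or> N < j + K)) \<le> (\<Sum>j\<in>{0..<N}. ?s j w)"
            using nn[OF iterate_space[OF w]] by (intro sum_mono) (auto simp: F_def)
          finally show "f N w \<le> b * N + (\<Sum>j\<in>{0..<N}. ?s j w) + f 0 ((\<theta> ^^ N) w)"
            by (simp add: F_def)
        qed
      qed (rule int)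
      also have "\<dots> = b * N + (\<Sum>j\<in>{0..<N}. expectation (?s j)) + expectation (f 0)"
        using ints integrable_iterate[OF int[of 0], of N] integral_iterate[of "f 0" N]
        by (simp add: prob_space)
      also have "\<dots> = b * N + (N * e + expectation (f 1) * cnt) + expectation (f 0)" using sums by simp
      also have "expectation (f 1) * cnt \<le> expectation (f 1) * K" using Ef1 cnt by (intro mult_left_mono) auto
      finally show ?thesis by (simp add: mult.commute)
    qed
    define R where "R = K * expectation (f 1) + expectation (f 0)"
    obtain N :: nat where "N > R / (m - b - e)" using reals_Archimedean2 by blast
    then have "R < N * (m - b - e)" using e by (simp add: field_simps)
    then show False using bound[of N] by (simp add: R_def algebra_simps)
  qed
  moreover have "f (Suc n) w \<le> f 1 w + f n (\<theta> w)" if "w \<in> space M" for n w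
    using sub[OF that, of 1 n] by simp
  ultimately show ?thesis using growth_dichotomy[of f "f 1", OF _ _ b(1)] by auto
qed

text \<open>If the claim failed, the dichotomy for the negated sums would let a block of average at
  least \<open>b\<close>, a number above the expectation, start almost everywhere. Packing such
  blocks forces the mean of the sum above its true value.\<close>

theorem birkhoff_upper_bound:
  fixes f :: "'a \<Rightarrow> real"
  assumes int: "integrable M f" and nn: "\<And>w. w \<in> space M \<Longrightarrow> 0 \<le> f w"
    and "expectation f < c"
  shows "AE w in M. \<forall>\<^sub>F n in sequentially. (\<Sum>i<n. f ((\<theta> ^^ i) w)) \<le> c * real n"
proof -
  have [measurable]: "f \<in> borel_measurable M" using int by auto
  have Ef: "0 \<le> expectation f" using nn by (intro integral_nonneg_AE) auto
  define b where "b = (c + expectation f) / 2"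
  have b: "b < c" "expectation f < b" "0 < b" using \<open>expectation f < c\<close> Ef by (auto simp: b_def)
  define S where "S n w = (\<Sum>i<n. f ((\<theta> ^^ i) w))" for n w
  have S [measurable]: "S n \<in> borel_measurable M" for n unfolding S_def by measurable
  have SSuc: "S (Suc n) w = f w + S n (\<theta> w)" for n w
    unfolding S_def sum.lessThan_Suc_shift by (simp add: funpow_swap1)
  have "\<not> (AE w in M. \<exists>n\<ge>1. b * real n \<le> S n w)"
  proof
    assume ex: "AE w in M. \<exists>n\<ge>1. b * real n \<le> S n w"
    \<comment> \<open>The largest tolerable density of bad positions: \<open>b * (1 - e)\<close>
      exceeds the expectation of \<open>f\<close> precisely when
      \<open>e < \<delta>\<close>.\<close>
    define \<delta> where "\<delta> = 1 - expectation f / b"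
    have \<delta>: "\<delta> > 0" using b by (simp add: \<delta>_def)
    obtain K where K: "(\<integral>w. 1 * of_bool (\<forall>n\<in>{1..K}. \<not> b * n \<le> S n w) \<partial>M) < \<delta>"
      by (rule waiting_time_tail[OF _ ex _ \<delta>, of "\<lambda>_. 1"]) auto
    define bad where "bad w \<longleftrightarrow> (\<forall>n\<in>{1..K}. \<not> b * n \<le> S n w)" for w
    have [measurable]: "Measurable.pred M bad" unfolding bad_def by measurable
    define e :: real where "e = (\<integral>w. of_bool (bad w) \<partial>M)"
    have int_bad: "integrable M (\<lambda>w. of_bool (bad w) :: real)"
      by (intro integrable_const_bound[where B = 1]) auto
    have e: "e < \<delta>" using K by (simp add: e_def bad_def)
    have bound: "b * (N - N * e - K) \<le> N * expectation f" for N :: nat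
    proof -
      have ib: "integrable M (\<lambda>w. of_bool (bad ((\<theta> ^^ j) w)) :: real)" for j
        using integrable_iterate[OF int_bad] .
      have "b * (N - N * e - K) = expectation (\<lambda>w. b * ((\<Sum>j\<in>{0..<N}. 1 - of_bool (bad ((\<theta> ^^ j) w))) - real K))"
        using ib integral_iterate[of "\<lambda>w. of_bool (bad w)"]
        by (simp add: prob_space sum_subtractf e_def del: sum_of_bool_eq)
      also have "\<dots> \<le> expectation (\<lambda>w. \<Sum>j\<in>{0..<N}. f ((\<theta> ^^ j) w))"
      proof (rule integral_mono_AE)
        show "integrable M (\<lambda>w. b * ((\<Sum>j\<in>{0..<N}. 1 - of_bool (bad ((\<theta> ^^ j) w))) - real K))"
          using ib by auto
        show "integrable M (\<lambda>w. \<Sum>j\<in>{0..<N}. f ((\<theta> ^^ j) w))"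
          using integrable_iterate[OF int] by auto
        show "AE w in M. b * ((\<Sum>j\<in>{0..<N}. 1 - of_bool (bad ((\<theta> ^^ j) w))) - real K) \<le> (\<Sum>j\<in>{0..<N}. f ((\<theta> ^^ j) w))"
        proof (rule AE_I2)
          fix w assume w: "w \<in> space M"
          have Sij: "S n ((\<theta> ^^ i) w) = (\<Sum>j\<in>{i..<i + n}. f ((\<theta> ^^ j) w))" for n i
            unfolding S_def using sum.shift_bounds_nat_ivl[of "\<lambda>j. f ((\<theta> ^^ j) w)" 0 i n]
            by (simp add: funpow_add lessThan_atLeast0 add.commute)
          have "b * (\<Sum>j\<in>{0..<N}. of_bool (\<not> bad ((\<theta> ^^ j) w) \<and> j + K \<le> N)) \<le> (\<Sum>j\<in>{0..<N}. f ((\<theta> ^^ j) w))"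
          proof (rule greedy_sum)
            fix i assume "\<not> bad ((\<theta> ^^ i) w)"
            then show "\<exists>n\<in>{1..K}. b * n \<le> (\<Sum>j\<in>{i..<i + n}. f ((\<theta> ^^ j) w))"
              by (auto simp: Sij bad_def)
          qed (use b nn iterate_space[OF w] in auto)
          moreover have "(\<Sum>j\<in>{0..<N}. 1 - of_bool (bad ((\<theta> ^^ j) w))) - real K \<le> (\<Sum>j\<in>{0..<N}. of_bool (\<not> bad ((\<theta> ^^ j) w) \<and> j + K \<le> N) :: real)"
          proof -
            have "(\<Sum>j\<in>{0..<N}. 1 - of_bool (bad ((\<theta> ^^ j) w))) \<le> 
              (\<Sum>j\<in>{0..<N}. of_bool (\<not> bad ((\<theta> ^^ j) w) \<and> j + K \<le> N) + of_bool (N < j + K) :: real)"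
              by (intro sum_mono) auto
            also have "\<dots> = (\<Sum>j\<in>{0..<N}. of_bool (\<not> bad ((\<theta> ^^ j) w) \<and> j + K \<le> N)) + real (card {j\<in>{0..<N}. N < j + K})"
              by (simp add: sum.distrib of_bool_def[of "N < _ + K"] sum.If_cases Int_def)
            also have "card {j\<in>{0..<N}. N < j + K} \<le> card {N - K..<N}"
              by (intro card_mono) auto
            finally show ?thesis by simp
          qed
          ultimately show "b * ((\<Sum>j\<in>{0..<N}. 1 - of_bool (bad ((\<theta> ^^ j) w))) - real K) \<le> (\<Sum>j\<in>{0..<N}. f ((\<theta> ^^ j) w))"
            using b(3) by (meson mult_left_mono order_trans less_imp_le)
        qed
      qed
      also have "\<dots> = N * expectation f"
        using integrable_iterate[OF int] integral_iterate[of f] by simp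
      finally show ?thesis .
    qed
    have pos: "b * (1 - e) - expectation f > 0" using e b by (simp add: \<delta>_def field_simps)
    obtain N :: nat where "N > b * K / (b * (1 - e) - expectation f)" using reals_Archimedean2 by blast
    then have "b * K < N * (b * (1 - e) - expectation f)" using pos by (simp add: field_simps)
    then show False using bound[of N] by (simp add: algebra_simps)
  qed
  moreover have "- S (Suc n) w \<le> - f w + - S n (\<theta> w)" for n w
    by (simp add: SSuc)
  ultimately show ?thesis
    using growth_dichotomy[of "\<lambda>n w. - S n w" "\<lambda>w. - f w" "- c" "- b"] b(1) by (auto simp: S_def)
qed

end

subsection \<open>The product space of edge weights\<close>

lemma norm1_smult: "norm1 (c *s x) = \<bar>c\<bar> * norm1 x"
  by (simp add: norm1_def abs_mult sum_distrib_left)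

lemma shift_power:
  assumes "w \<in> extensional lattice_edges"
  shows "(shift z ^^ n) w = shift (int n *s z) w"
proof (induction n)
  case 0
  then show ?case using assms by (simp add: shift_def extensional_restrict image_def)
next
  case (Suc n)
  have "(shift z ^^ Suc n) w = shift z (shift (int n *s z) w)" using Suc by simp
  also have "\<dots> = shift (int (Suc n) *s z) w"
    by (simp add: shift_shift algebra_simps vector_sadd_rdistrib)
  finally show ?case .
qed

lemma far_translates_disjoint:
  assumes "finite F" "F \<subseteq> (lattice_edges :: (int ^ 'd) set set)"
  obtains R where "\<And>x y :: int ^ 'd. norm1 (x - y) > R \<Longrightarrow> (`) ((+) x) ` F \<inter> (`) ((+) y) ` F = {}"
proof -
  define V where "V = \<Union> F"
  have "finite V" using assms by (auto simp: V_def lattice_edges_def)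
  \<comment> \<open>The sum of all pairwise distances is a crude bound for the diameter of
    \<open>V\<close>.\<close>
  define R where "R = (\<Sum>(v, v')\<in>V \<times> V. norm1 (v - v'))"
  have R: "norm1 (v - v') \<le> R" if "v \<in> V" "v' \<in> V" for v v'
    unfolding R_def using member_le_sum[of "(v, v')" "V \<times> V" "\<lambda>(v, v'). norm1 (v - v')"] that \<open>finite V\<close>
    by auto
  have "(`) ((+) x) ` F \<inter> (`) ((+) y) ` F = {}" if "norm1 (x - y) > R" for x y
  proof (rule ccontr)
    assume "\<not> ?thesis"
    then obtain e e' where e: "e \<in> F" "e' \<in> F" "(+) x ` e = (+) y ` e'" by blast
    then have "e \<in> lattice_edges" using assms(2) by blast
    then have "e \<noteq> {}" by (auto simp: lattice_edges_def)
    then obtain v where v: "v \<in> e" by blast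
    then have "x + v \<in> (+) y ` e'" using e by blast
    then obtain v' where v': "v' \<in> e'" "x + v = y + v'" by auto
    then have "x - y = v' - v" by (simp add: algebra_simps)
    then show False using R[of v' v] that v v' e by (auto simp: V_def)
  qed
  then show ?thesis using that by blast
qed

text \<open>The sum is at most its number of terms times the largest term, and the power of the
  largest term is itself one of the summands on the right.\<close>

lemma sum_power_le:
  fixes a :: "'i \<Rightarrow> real"
  assumes "finite I" "\<And>i. i \<in> I \<Longrightarrow> 0 \<le> a i" "p > 0"
  shows "(\<Sum>i\<in>I. a i) ^ p \<le> real (card I) ^ p * (\<Sum>i\<in>I. a i ^ p)"
proof (cases "I = {}")
  case False
  define m where "m = Max (a ` I)"
  have m: "m \<in> a ` I" using assms(1) False unfolding m_def by (intro Max_in) auto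
  have "(\<Sum>i\<in>I. a i) \<le> real (card I) * m"
    using assms(1) by (intro sum_bounded_above) (auto simp: m_def)
  then have "(\<Sum>i\<in>I. a i) ^ p \<le> (real (card I) * m) ^ p"
    using assms by (intro power_mono sum_nonneg) auto
  also have "\<dots> = real (card I) ^ p * m ^ p" by (simp add: power_mult_distrib)
  also have "m ^ p \<le> (\<Sum>i\<in>I. a i ^ p)"
    using m assms by (auto intro!: member_le_sum)
  finally show ?thesis by (simp add: mult_left_mono)
qed (use assms in \<open>simp add: zero_power\<close>)

lemma integrable_sum_power:
  fixes f :: "'i \<Rightarrow> 'a \<Rightarrow> real"
  assumes "finite I" "\<And>i x. i \<in> I \<Longrightarrow> 0 \<le> f i x" "\<And>i. i \<in> I \<Longrightarrow> f i \<in> borel_measurable M"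
    and "\<And>i. i \<in> I \<Longrightarrow> integrable M (\<lambda>x. f i x ^ p)" "p > 0"
  shows "integrable M (\<lambda>x. (\<Sum>i\<in>I. f i x) ^ p)"
proof (rule Bochner_Integration.integrable_bound)
  show "integrable M (\<lambda>x. real (card I) ^ p * (\<Sum>i\<in>I. f i x ^ p))" using assms(4) by simp
  show "(\<lambda>x. (\<Sum>i\<in>I. f i x) ^ p) \<in> borel_measurable M" using assms(3) by simp
  show "AE x in M. norm ((\<Sum>i\<in>I. f i x) ^ p) \<le> norm (real (card I) ^ p * (\<Sum>i\<in>I. f i x ^ p))"
  proof (rule AE_I2)
    fix x
    have "0 \<le> (\<Sum>i\<in>I. f i x) ^ p" using assms(2) by (intro zero_le_power sum_nonneg)
    moreover have "(\<Sum>i\<in>I. f i x) ^ p \<le> real (card I) ^ p * (\<Sum>i\<in>I. f i x ^ p)"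
      by (rule sum_power_le) (use assms in auto)
    ultimately show "norm ((\<Sum>i\<in>I. f i x) ^ p) \<le> norm (real (card I) ^ p * (\<Sum>i\<in>I. f i x ^ p))" by simp
  qed
qed

text \<open>Canonical model: the weights are the coordinates of the product space, indexed by
  lattice edges only. An arbitrary i.i.d. family is pushed forward to it at the very end.\<close>

locale iid_weights =
  fixes N :: "real measure" and P :: "('d::finite) config measure"
  assumes prob_N: "prob_space N" and sets_N: "sets N = sets borel"
    and P_def: "P = PiM lattice_edges (\<lambda>_. N)" and dim: "CARD('d) \<ge> 2"
begin

sublocale prob_space P
  unfolding P_def by (intro prob_space_PiM prob_N)

lemma space_N [simp]: "space N = UNIV"
  using sets_N sets_eq_imp_space_eq by fastforce

lemma space_P: "space P = extensional lattice_edges"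
  by (simp add: P_def space_PiM PiE_def)

lemma shift_in_space [simp]: "shift z w \<in> space P"
  by (simp add: space_P shift_def)

lemma coordinate_measurable [measurable]:
  "e \<in> lattice_edges \<Longrightarrow> (\<lambda>w. w e) \<in> borel_measurable P"
  unfolding P_def using measurable_component_singleton[of e lattice_edges "\<lambda>_. N"]
  by (simp add: measurable_cong_sets[OF refl sets_N])

lemma shift_measurable [measurable]: "shift z \<in> measurable P P"
  unfolding shift_def P_def
  by (intro measurable_restrict measurable_component_singleton) (rule image_edge_in_lattice)

lemma translate_edge_eq_iff: "(+) z ` e = (+) z ` e' \<longleftrightarrow> e = (e' :: (int ^ 'd) set)"
  by (intro inj_image_eq_iff) (simp add: inj_on_def)

text \<open>The common source of two facts: invariance of the measure under translations, and
  equality in law of the weights along any two families of distinct edges.\<close>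

lemma distr_reindex:
  assumes "inj_on c I" "c \<in> I \<rightarrow> lattice_edges"
  shows "distr P (PiM I (\<lambda>_. N)) (\<lambda>w. \<lambda>i\<in>I. w (c i)) = PiM I (\<lambda>_. N)"
  unfolding P_def by (rule distr_PiM_reindex[OF prob_N assms])

lemma distr_shift: "distr P P (shift z) = P"
  using distr_reindex[of "(`) ((+) z)" lattice_edges] image_edge_in_lattice
  by (auto simp: inj_on_def translate_edge_eq_iff shift_def[abs_def] P_def[symmetric])

lemma integral_shift:
  fixes f :: "'d config \<Rightarrow> real"
  assumes "f \<in> borel_measurable P"
  shows "(\<integral>w. f (shift z w) \<partial>P) = integral\<^sup>L P f"
  using integral_distr[OF shift_measurable[of z] assms] by (simp add: distr_shift)

lemma integrable_shift:
  fixes f :: "'d config \<Rightarrow> real"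
  assumes "integrable P f"
  shows "integrable P (\<lambda>w. f (shift z w))"
  using integrable_distr[OF shift_measurable[of z], of f] assms by (simp add: distr_shift)

lemma prob_shift:
  assumes "D \<in> sets P"
  shows "prob {w \<in> space P. shift z w \<in> D} = prob D"
proof -
  have "prob D = measure (distr P P (shift z)) D" by (simp add: distr_shift)
  also have "\<dots> = prob (shift z -` D \<inter> space P)" using assms by (intro measure_distr) auto
  also have "shift z -` D \<inter> space P = {w \<in> space P. shift z w \<in> D}" by auto
  finally show ?thesis by simp
qed

subsection \<open>Independence of functions of disjoint sets of edges\<close>

definition depends_on :: "(int ^ 'd) set set \<Rightarrow> ('d config \<Rightarrow> 'b) \<Rightarrow> bool" where
  "depends_on F f \<longleftrightarrow> (\<forall>w\<in>space P. \<forall>w'\<in>space P. (\<forall>e\<in>F. w e = w' e) \<longrightarrow> f w = f w')"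

lemma depends_onD:
  "depends_on F f \<Longrightarrow> w \<in> space P \<Longrightarrow> w' \<in> space P \<Longrightarrow> (\<And>e. e \<in> F \<Longrightarrow> w e = w' e) \<Longrightarrow> f w = f w'"
  unfolding depends_on_def by blast

lemma depends_on_shift:
  assumes "depends_on F f" "F \<subseteq> lattice_edges"
  shows "depends_on ((`) ((+) z) ` F) (\<lambda>w. f (shift z w))"
  unfolding depends_on_def
proof (intro ballI impI)
  fix w w' :: "'d config"
  assume "\<forall>e\<in>(`) ((+) z) ` F. w e = w' e"
  then show "f (shift z w) = f (shift z w')"
    using assms(2) by (intro depends_onD[OF assms(1)] shift_in_space) (auto simp: shift_def)
qed

lemma lattice_edges_nonempty: "(lattice_edges :: (int ^ 'd) set set) \<noteq> {}"
proof -
  obtain u :: "int ^ 'd" where "u \<in> units" using units_nonempty by blast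
  then have "{0, u} \<in> lattice_edges" by (intro edge_in_lattice) (simp add: adjacent_iff_unit)
  then show ?thesis by blast
qed

lemma indep_coordinates: "indep_vars (\<lambda>_. N) (\<lambda>e w. w e) lattice_edges"
proof -
  have "distr P (PiM lattice_edges (\<lambda>_. N)) (\<lambda>w. \<lambda>e\<in>lattice_edges. w e) = distr P P (\<lambda>w. w)"
    by (intro distr_cong) (auto simp: P_def space_PiM PiE_def extensional_restrict)
  also have "\<dots> = PiM lattice_edges (\<lambda>e. distr P N (\<lambda>w. w e))"
    unfolding distr_id2[OF refl] unfolding P_def
    by (intro PiM_cong refl distr_PiM_component[symmetric] prob_N)
  finally show ?thesis
    using lattice_edges_nonempty
    by (subst indep_vars_iff_distr_eq_PiM') (auto simp: P_def)
qed

text \<open>A function that sees only the edges in \<open>F j\<close> factors through the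
  restriction to \<open>F j\<close>, and restrictions of independent coordinates to disjoint index
  sets are independent.\<close>

lemma indep_local:
  assumes F: "\<And>j. j \<in> J \<Longrightarrow> F j \<subseteq> lattice_edges" "disjoint_family_on F J"
    and f: "\<And>j. j \<in> J \<Longrightarrow> f j \<in> borel_measurable P"
      "\<And>j w w'. j \<in> J \<Longrightarrow> (\<And>e. e \<in> F j \<Longrightarrow> w e = w' e) \<Longrightarrow> f j w = f j w'"
  shows "indep_vars (\<lambda>_. borel) f J"
proof -
  \<comment> \<open>Extension by 0 turns a configuration on \<open>F j\<close> back into a full one,
    so that \<open>f j\<close> becomes a measurable function of the restriction.\<close>
  define ex where "ex j v = (\<lambda>e\<in>lattice_edges. if e \<in> F j then v e else 0 :: real)" for j v
  have ex [measurable]: "ex j \<in> measurable (PiM (F j) (\<lambda>_. N)) P" if "j \<in> J" for j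
  proof -
    have "(\<lambda>v. if e \<in> F j then v e else 0) \<in> measurable (PiM (F j) (\<lambda>_. N)) N" for e
      by (cases "e \<in> F j") (auto intro!: measurable_component_singleton)
    then show ?thesis
      unfolding ex_def[abs_def] P_def by (intro measurable_restrict)
  qed
  have "indep_vars (\<lambda>j. PiM (F j) (\<lambda>_. N)) (\<lambda>j w. restrict (\<lambda>e. w e) (F j)) J"
    by (rule indep_vars_restrict[OF indep_coordinates F])
  then have "indep_vars (\<lambda>_. borel) (\<lambda>j w. f j (ex j (restrict (\<lambda>e. w e) (F j)))) J"
    by (rule indep_vars_compose2[where Y = "\<lambda>j v. f j (ex j v)"]) (rule measurable_compose[OF ex f(1)])
  also have "?this \<longleftrightarrow> indep_vars (\<lambda>_. borel) f J"
  proof (rule indep_vars_cong)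
    fix j assume j: "j \<in> J"
    show "(\<lambda>w. f j (ex j (restrict (\<lambda>e. w e) (F j)))) = f j"
      using F(1)[OF j] by (intro HOL.ext f(2)[OF j]) (auto simp: ex_def)
  qed auto
  finally show ?thesis .
qed

lemma prob_inter_local:
  assumes B: "B \<in> sets P" "depends_on F (\<lambda>w. w \<in> B)" "F \<subseteq> lattice_edges"
    and B': "B' \<in> sets P" "depends_on F' (\<lambda>w. w \<in> B')" "F' \<subseteq> lattice_edges" and "F \<inter> F' = {}"
  shows "prob (B \<inter> B') = prob B * prob B'"
proof -
  \<comment> \<open>\<open>indep_local\<close> speaks of all functions on edges,
    \<open>depends_on\<close> only of points of the space. Evaluating the indicators at the
    restriction bridges the two and changes nothing on the space.\<close>
  define f where "f b w = (indicator (if b then B else B') (restrict w lattice_edges) :: real)" for b w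
  have "indep_vars (\<lambda>_. borel) f UNIV"
  proof (rule indep_local[where F = "\<lambda>b. if b then F else F'"])
    fix b and w w' :: "'d config"
    assume e: "\<And>e. e \<in> (if b then F else F') \<Longrightarrow> w e = w' e"
    have "restrict w lattice_edges \<in> space P" "restrict w' lattice_edges \<in> space P" by (auto simp: space_P)
    then have "restrict w lattice_edges \<in> (if b then B else B') \<longleftrightarrow> restrict w' lattice_edges \<in> (if b then B else B')"
      using e depends_onD[OF B(2), of "restrict w lattice_edges" "restrict w' lattice_edges"]
        depends_onD[OF B'(2), of "restrict w lattice_edges" "restrict w' lattice_edges"]
      by (cases b) (auto simp: restrict_def)
    then show "f b w = f b w'" by (simp add: f_def indicator_def)
  next
    show "disjoint_family_on (\<lambda>b. if b then F else F') UNIV"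
      using \<open>F \<inter> F' = {}\<close> by (auto simp: disjoint_family_on_def)
    next
    fix b
    have "f b \<in> borel_measurable P \<longleftrightarrow> (indicator (if b then B else B') :: _ \<Rightarrow> real) \<in> borel_measurable P"
      by (intro measurable_cong) (simp add: f_def space_P extensional_restrict)
    then show "f b \<in> borel_measurable P" using B(1) B'(1) by auto
  qed (use assms in auto)
  then have "prob (\<Inter>b\<in>UNIV. f b -` {1} \<inter> space P) = (\<Prod>b\<in>UNIV. prob (f b -` {1} \<inter> space P))"
    by (rule indep_varsD) auto
  moreover have "f b -` {1} \<inter> space P = (if b then B else B')" for b
    using sets.sets_into_space[OF B(1)] sets.sets_into_space[OF B'(1)]
    by (auto simp: f_def indicator_def space_P extensional_restrict split: if_splits)
  moreover have "(\<Inter>b\<in>UNIV. if b then B else B') = B \<inter> B'" by (auto split: if_splits)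
  ultimately show ?thesis by (simp add: UNIV_bool mult.commute)
qed

subsection \<open>Ergodicity of the translations\<close>

definition local_approx :: "'d config set \<Rightarrow> bool" where
  "local_approx D \<longleftrightarrow> D \<in> sets P \<and> (\<forall>e>0. \<exists>F B. finite F \<and> F \<subseteq> lattice_edges \<and> B \<in> sets P \<and>
     depends_on F (\<lambda>w. w \<in> B) \<and> prob ((D - B) \<union> (B - D)) < e)"

lemma local_approx_Un:
  assumes "local_approx D" "local_approx D'"
  shows "local_approx (D \<union> D')"
  unfolding local_approx_def
proof (intro conjI allI impI)
  show "D \<union> D' \<in> sets P" using assms by (auto simp: local_approx_def)
  fix e :: real assume "e > 0"
  then have "e / 2 > 0" by simp
  obtain F B where B: "finite F" "F \<subseteq> lattice_edges" "B \<in> sets P" "depends_on F (\<lambda>w. w \<in> B)"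
      "prob ((D - B) \<union> (B - D)) < e / 2"
    using assms(1) \<open>e / 2 > 0\<close> unfolding local_approx_def by blast
  obtain F' B' where B': "finite F'" "F' \<subseteq> lattice_edges" "B' \<in> sets P" "depends_on F' (\<lambda>w. w \<in> B')"
      "prob ((D' - B') \<union> (B' - D')) < e / 2"
    using assms(2) \<open>e / 2 > 0\<close> unfolding local_approx_def by blast
  have D: "D \<in> sets P" "D' \<in> sets P" using assms by (auto simp: local_approx_def)
  have "prob ((D \<union> D' - (B \<union> B')) \<union> (B \<union> B' - (D \<union> D')))
      \<le> prob (((D - B) \<union> (B - D)) \<union> ((D' - B') \<union> (B' - D')))"
    using B B' D by (intro finite_measure_mono) auto
  also have "\<dots> \<le> prob ((D - B) \<union> (B - D)) + prob ((D' - B') \<union> (B' - D'))"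
    using B B' D by (intro measure_Un_le) auto
  finally have "prob ((D \<union> D' - (B \<union> B')) \<union> (B \<union> B' - (D \<union> D'))) < e" using B B' by linarith
  moreover have "depends_on (F \<union> F') (\<lambda>w. w \<in> B \<union> B')"
    using B(4) B'(4) unfolding depends_on_def Un_iff by blast
  ultimately show "\<exists>F B. finite F \<and> F \<subseteq> lattice_edges \<and> B \<in> sets P \<and>
     depends_on F (\<lambda>w. w \<in> B) \<and> prob ((D \<union> D' - B) \<union> (B - (D \<union> D'))) < e"
    using B B' by (intro exI[of _ "F \<union> F'"] exI[of _ "B \<union> B'"]) auto
qed

lemma local_approx_of_local:
  assumes "finite F" "F \<subseteq> lattice_edges" "B \<in> sets P" "depends_on F (\<lambda>w. w \<in> B)"
  shows "local_approx B"
  unfolding local_approx_def using assms by (auto intro!: exI[of _ F] exI[of _ B])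

lemma depends_on_Compl: "depends_on F (\<lambda>w. w \<in> B) \<Longrightarrow> depends_on F (\<lambda>w. w \<in> space P - B)"
  unfolding depends_on_def Diff_iff by blast

text \<open>Cylinders are local, symmetric differences are unchanged under complement, and a
  countable union is approximated by finite ones; so the approximable events exhaust the generated
  sigma-algebra.\<close>

lemma local_approx_all:
  assumes "D \<in> sets P"
  shows "local_approx D"
proof -
  have "D \<in> sigma_sets (\<Pi>\<^sub>E i\<in>lattice_edges. space N) (prod_algebra lattice_edges (\<lambda>_. N))"
    using assms by (simp add: P_def sets_PiM)
  then show ?thesis
  proof (induction rule: sigma_sets.induct)
    case (Basic D)
    then obtain J X where JX: "finite J" "J \<subseteq> lattice_edges" "X \<in> (\<Pi> j\<in>J. sets N)"
        "D = prod_emb lattice_edges (\<lambda>_. N) J (Pi\<^sub>E J X)"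
      by (auto simp: prod_algebra_def)
    have D: "D \<in> sets P"
      using Basic by (simp add: P_def sets_PiM sigma_sets.Basic)
    show ?case
      using JX(1,2) D
    proof (rule local_approx_of_local)
      have "w \<in> D \<longleftrightarrow> (\<forall>e\<in>J. w e \<in> X e)" if "w \<in> space P" for w
        using that JX(4) by (auto simp: prod_emb_iff space_P PiE_iff restrict_def extensional_def)
      then show "depends_on J (\<lambda>w. w \<in> D)" by (simp add: depends_on_def)
    qed
  next
    case Empty
    show ?case by (rule local_approx_of_local[of "{}"]) (auto simp: depends_on_def)
  next
    case (Compl D)
    have sp: "(\<Pi>\<^sub>E i\<in>lattice_edges. space N) = space P" by (simp add: P_def space_PiM)
    have D: "D \<in> sets P" using Compl by (simp add: local_approx_def)
    show ?case unfolding sp local_approx_def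
    proof (intro conjI allI impI)
      show "space P - D \<in> sets P" using D by auto
      fix e :: real assume "e > 0"
      then obtain F B where B: "finite F" "F \<subseteq> lattice_edges" "B \<in> sets P" "depends_on F (\<lambda>w. w \<in> B)"
          "prob ((D - B) \<union> (B - D)) < e"
        using Compl.IH unfolding local_approx_def by blast
      have "((space P - D) - (space P - B)) \<union> ((space P - B) - (space P - D)) = (D - B) \<union> (B - D)"
        using sets.sets_into_space[OF D] sets.sets_into_space[OF B(3)] by blast
      then show "\<exists>F B. finite F \<and> F \<subseteq> lattice_edges \<and> B \<in> sets P \<and>
         depends_on F (\<lambda>w. w \<in> B) \<and> prob ((space P - D - B) \<union> (B - (space P - D))) < e"
        using B(1,2,3,5) depends_on_Compl[OF B(4)] by (intro exI[of _ F] exI[of _ "space P - B"]) simp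
    qed
  next
    case (Union D)
    have D: "D i \<in> sets P" for i using Union by (simp add: local_approx_def)
    define U where "U n = (\<Union>i\<le>n. D i)" for n
    have U: "local_approx (U n)" for n
    proof (induction n)
      case (Suc n)
      then show ?case using local_approx_Un[OF Suc Union.IH[of "Suc n"]] by (simp add: U_def atMost_Suc Un_commute)
    qed (use Union.IH in \<open>simp add: U_def\<close>)
    have UP: "U n \<in> sets P" for n using U by (simp add: local_approx_def)
    have un: "(\<Union>i. D i) = (\<Union>n. U n)" by (auto simp: U_def)
    have lim: "(\<lambda>n. prob (U n)) \<longlonglongrightarrow> prob (\<Union>n. U n)"
      using UP UN_mono[OF atMost_subset_iff[THEN iffD2], of _ _ D D]
      by (intro finite_Lim_measure_incseq) (auto simp: incseq_def U_def intro: order_trans)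
    show ?case unfolding local_approx_def
    proof (intro conjI allI impI)
      show "(\<Union>i. D i) \<in> sets P" using D by auto
      fix e :: real assume "e > 0"
      then have "\<forall>\<^sub>F n in sequentially. prob (\<Union>n. U n) - e / 2 < prob (U n)"
        by (intro order_tendstoD(1)[OF lim]) simp
      then obtain n where n: "prob (\<Union>n. U n) - e / 2 < prob (U n)" by (auto simp: eventually_sequentially)
      have "e / 2 > 0" using \<open>e > 0\<close> by simp
      then obtain F B where B: "finite F" "F \<subseteq> lattice_edges" "B \<in> sets P" "depends_on F (\<lambda>w. w \<in> B)"
          "prob ((U n - B) \<union> (B - U n)) < e / 2"
        using U[of n] unfolding local_approx_def by blast
      have "prob (((\<Union>i. D i) - B) \<union> (B - (\<Union>i. D i))) \<le> prob (((\<Union>n. U n) - U n) \<union> ((U n - B) \<union> (B - U n)))"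
        unfolding un using B UP by (intro finite_measure_mono) auto
      also have "\<dots> \<le> prob ((\<Union>n. U n) - U n) + prob ((U n - B) \<union> (B - U n))"
        using B UP by (intro measure_Un_le) auto
      also have "prob ((\<Union>n. U n) - U n) = prob (\<Union>n. U n) - prob (U n)"
        using UP by (intro finite_measure_Diff) auto
      finally have "prob (((\<Union>i. D i) - B) \<union> (B - (\<Union>i. D i))) < e" using B n by linarith
      then show "\<exists>F B. finite F \<and> F \<subseteq> lattice_edges \<and> B \<in> sets P \<and>
         depends_on F (\<lambda>w. w \<in> B) \<and> prob (((\<Union>i. D i) - B) \<union> (B - (\<Union>i. D i))) < e"
        using B by blast
    qed
  qed
qed

lemma prob_diff_le:
  assumes "D \<in> sets P" "B \<in> sets P"
  shows "\<bar>prob D - prob B\<bar> \<le> prob ((D - B) \<union> (B - D))"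
proof -
  have *: "prob D \<le> prob B + prob ((D - B) \<union> (B - D))" if "D \<in> sets P" "B \<in> sets P" for D B
  proof -
    have "prob D \<le> prob (B \<union> ((D - B) \<union> (B - D)))" using that by (intro finite_measure_mono) auto
    also have "\<dots> \<le> prob B + prob ((D - B) \<union> (B - D))" using that by (intro measure_Un_le) auto
    finally show ?thesis .
  qed
  show ?thesis using *[OF assms] *[OF assms(2,1)] by (simp add: Un_commute)
qed

text \<open>Mixing argument: replace \<open>D\<close> by a local event \<open>B\<close> and
  translate so far that \<open>B\<close> and its translate depend on disjoint edges. Then the
  probability of \<open>D\<close> is close to that of \<open>B\<close> intersected with its
  translate, hence to the square of the probability of \<open>D\<close>.\<close>

lemma shift_zero_one:
  assumes D: "D \<in> sets P" and z: "z \<noteq> 0"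
    and inv: "\<And>w. w \<in> space P \<Longrightarrow> shift z w \<in> D \<Longrightarrow> w \<in> D"
  shows "prob D = 0 \<or> prob D = 1"
proof -
  have "\<bar>prob D - prob D ^ 2\<bar> \<le> e" if "e > 0" for e
  proof -
    \<comment> \<open>Error budget: intersecting with the translate uses the approximation twice,
      and so does comparing the squares; each comparison costs \<open>e / 2\<close>.\<close>
    have "e / 4 > 0" using that by simp
    then obtain F B where B: "finite F" "F \<subseteq> lattice_edges" "B \<in> sets P" "depends_on F (\<lambda>w. w \<in> B)"
        "prob ((D - B) \<union> (B - D)) < e / 4"
      using local_approx_all[OF D] unfolding local_approx_def by blast
    obtain R where R: "\<And>x y :: int ^ 'd. norm1 (x - y) > R \<Longrightarrow> (`) ((+) x) ` F \<inter> (`) ((+) y) ` F = {}"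
      using far_translates_disjoint[OF B(1,2)] by blast
    define n where "n = nat (\<bar>R\<bar> + 1)"
    define y where "y = int n *s z"
    have "norm1 z > 0" using z norm1_nonneg[of z] norm1_eq_0_iff[of z] by linarith
    then have "norm1 y \<ge> int n" unfolding y_def norm1_smult
      using mult_left_mono[of 1 "norm1 z" "\<bar>int n\<bar>"] by simp
    then have disj: "F \<inter> (`) ((+) y) ` F = {}" using R[of 0 y] by (simp add: n_def image_image)
    define S where "S C = {w \<in> space P. shift y w \<in> C}" for C
    have S: "S C \<in> sets P" "prob (S C) = prob C" if "C \<in> sets P" for C
      using that prob_shift[of C y] by (auto simp: S_def)
    have iter: "w \<in> D" if "w \<in> space P" "(shift z ^^ m) w \<in> D" for m w
      using that
    proof (induction m arbitrary: w)
      case (Suc m)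
      have "(shift z ^^ m) (shift z w) \<in> D" using Suc.prems(2) by (simp only: funpow_Suc_right o_apply)
      then have "shift z w \<in> D" by (rule Suc.IH[OF shift_in_space])
      then show ?case by (rule inv[OF Suc.prems(1)])
    qed simp
    \<comment> \<open>Iterating the one-sided invariance \<open>n\<close> times puts the far
      preimage inside \<open>D\<close>; as it has the same probability, the intersection loses
      nothing.\<close>
    have "S D \<subseteq> D"
      using iter[of _ n] by (auto simp: S_def y_def shift_power space_P)
    then have "prob (D \<inter> S D) = prob D" using S[OF D] by (simp add: Int_absorb1)
    moreover
    have Fy: "(`) ((+) y) ` F \<subseteq> lattice_edges" using B(2) image_edge_in_lattice by blast
    ultimately have DSD: "prob (D \<inter> S D) = prob D" by simp
    have "prob (B \<inter> S B) = prob B * prob (S B)"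
    proof (rule prob_inter_local)
      have "depends_on ((`) ((+) y) ` F) (\<lambda>w. shift y w \<in> B)" by (rule depends_on_shift[OF B(4,2)])
      then show "depends_on ((`) ((+) y) ` F) (\<lambda>w. w \<in> S B)" unfolding depends_on_def S_def mem_Collect_eq by blast
    qed (use B S disj Fy in auto)
    moreover have "\<bar>prob (D \<inter> S D) - prob (B \<inter> S B)\<bar> \<le> e / 2"
    proof -
      have "\<bar>prob (D \<inter> S D) - prob (B \<inter> S B)\<bar> \<le> prob ((D \<inter> S D - B \<inter> S B) \<union> (B \<inter> S B - D \<inter> S D))"
        using D B S by (intro prob_diff_le) auto
      also have "\<dots> \<le> prob (((D - B) \<union> (B - D)) \<union> S ((D - B) \<union> (B - D)))"
        using D B S by (intro finite_measure_mono) (auto simp: S_def)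
      also have "\<dots> \<le> prob ((D - B) \<union> (B - D)) + prob (S ((D - B) \<union> (B - D)))"
        using D B S by (intro measure_Un_le) auto
      also have "prob (S ((D - B) \<union> (B - D))) = prob ((D - B) \<union> (B - D))" using D B by (intro S) auto
      finally show ?thesis using B by simp
    qed
    moreover have "\<bar>prob D ^ 2 - prob B ^ 2\<bar> \<le> e / 2"
    proof -
      have "prob D ^ 2 - prob B ^ 2 = (prob D - prob B) * (prob D + prob B)"
        by (simp add: power2_eq_square algebra_simps)
      then have "\<bar>prob D ^ 2 - prob B ^ 2\<bar> = \<bar>prob D - prob B\<bar> * (prob D + prob B)"
        by (simp add: abs_mult)
      also have "\<dots> \<le> \<bar>prob D - prob B\<bar> * 2"
        using prob_le_1[of D] prob_le_1[of B] by (intro mult_left_mono) linarith+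
      also have "\<dots> \<le> e / 4 * 2"
        by (intro mult_right_mono order_trans[OF prob_diff_le[OF D B(3)] less_imp_le[OF B(5)]]) simp
      also have "\<dots> = e / 2" by simp
      finally show ?thesis .
    qed
    ultimately have "\<bar>prob D - prob B ^ 2\<bar> \<le> e / 2" "\<bar>prob D ^ 2 - prob B ^ 2\<bar> \<le> e / 2"
      using DSD S(2)[OF B(3)] by (simp_all add: power2_eq_square)
    from add_mono[OF this] show ?thesis
      using abs_triangle_ineq4[of "prob D - prob B ^ 2" "prob D ^ 2 - prob B ^ 2"] by (simp add: field_simps)
  qed
  then have "\<bar>prob D - prob D ^ 2\<bar> \<le> 0" by (rule dense_ge)
  then have "prob D * (1 - prob D) = 0" by (simp add: power2_eq_square algebra_simps)
  then show ?thesis by auto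
qed

lemma ergodic_shift: "z \<noteq> 0 \<Longrightarrow> ergodic_map P (shift z)"
  by (unfold_locales, rule shift_measurable, rule distr_shift, rule shift_zero_one)

end

subsection \<open>Subadditive functions on the lattice\<close>

lemma fekete_nonneg:
  fixes s :: "nat \<Rightarrow> real"
  assumes sub: "\<And>m n. s (m + n) \<le> s m + s n" and nn: "\<And>n. 0 \<le> s n"
  shows "convergent (\<lambda>n. s n / n)"
proof -
  define L where "L = (INF n\<in>{1..}. s n / n)"
  have bdd: "bdd_below ((\<lambda>n. s n / n) ` {1..})" using nn by (intro bdd_belowI[of _ 0]) auto
  have L: "L \<le> s n / n" if "n \<ge> 1" for n
    unfolding L_def using that by (intro cINF_lower[OF bdd]) auto
  have mult: "s (q * k + r) \<le> q * s k + s r" for q k r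
  proof (induction q)
    case (Suc q)
    have "s (Suc q * k + r) \<le> s k + s (q * k + r)" using sub[of k "q * k + r"] by (simp add: add.assoc)
    then show ?case using Suc by (simp add: algebra_simps)
  qed simp
  have "(\<lambda>n. s n / n) \<longlonglongrightarrow> L"
  proof (rule LIMSEQ_I)
    fix e :: real assume "e > 0"
    have "\<exists>k\<in>{1..}. s k / k < L + e / 2"
      using \<open>e > 0\<close> cINF_less_iff[OF _ bdd, of "L + e / 2"] by (simp add: L_def)
    then obtain k where k: "k \<ge> 1" "s k / k < L + e / 2" by auto
    \<comment> \<open>A bound for \<open>s\<close> at every remainder modulo \<open>k\<close>,
      uniform in \<open>n\<close>.\<close>
    define S where "S = (\<Sum>r<k. s r)"
    obtain N :: nat where N: "N > 2 * S / e" using reals_Archimedean2 by blast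
    have "norm (s n / n - L) < e" if n: "n \<ge> max 1 N" for n
    proof -
      have "s n \<le> (n div k) * s k + s (n mod k)" using mult[of "n div k" k "n mod k"] by simp
      also have "s (n mod k) \<le> S"
        unfolding S_def using k nn by (intro member_le_sum) auto
      also have "(n div k) * s k \<le> n * (s k / k)"
      proof -
        have "real (n div k) * k \<le> n" by (metis of_nat_le_iff of_nat_mult div_times_less_eq_dividend)
        then have "real (n div k) \<le> n / k" using k by (simp add: field_simps)
        then have "real (n div k) * s k \<le> n / k * s k" using nn by (intro mult_right_mono) auto
        then show ?thesis by simp
      qed
      finally have "s n / n \<le> s k / k + S / n" using n by (simp add: field_simps)
      moreover have "S / n < e / 2"
      proof -
        have "2 * S / e < n" using N n by linarith
        then show ?thesis using \<open>e > 0\<close> n by (simp add: field_simps)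
      qed
      ultimately have "s n / n - L < e" using k(2) by linarith
      moreover have "L \<le> s n / n" using L n by simp
      ultimately show ?thesis by simp
    qed
    then show "\<exists>N. \<forall>n\<ge>N. norm (s n / n - L) < e" by blast
  qed
  then show ?thesis by (rule convergentI)
qed

section \<open>Real vectors and rounding to the lattice\<close>

definition l1 :: "real ^ 'd \<Rightarrow> real" where
  "l1 \<xi> = (\<Sum>i\<in>UNIV. \<bar>\<xi> $ i\<bar>)"

lemma l1_vec_of_int: "l1 (vec_of_int x) = norm1 x"
  by (simp add: l1_def norm1_def vec_of_int_def)

lemma l1_le_norm: "l1 \<xi> \<le> CARD('d) * norm (\<xi> :: real ^ 'd)"
  unfolding l1_def using sum_bounded_above[of UNIV "\<lambda>i. \<bar>\<xi> $ i\<bar>" "norm \<xi>"]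
  by (simp add: component_le_norm_cart)

lemma norm_le_l1: "norm \<xi> \<le> l1 \<xi>"
  unfolding l1_def by (rule norm_le_l1_cart)

lemma l1_nonneg [simp]: "0 \<le> l1 \<xi>"
  by (simp add: l1_def sum_nonneg)

lemma l1_scaleR: "l1 (c *\<^sub>R \<xi>) = \<bar>c\<bar> * l1 \<xi>"
  by (simp add: l1_def abs_mult sum_distrib_left)

lemma l1_triangle: "l1 (\<xi> + \<eta>) \<le> l1 \<xi> + l1 \<eta>"
  by (simp add: l1_def sum.distrib[symmetric] sum_mono abs_triangle_ineq)

lemma vec_of_int_add: "vec_of_int (x + y) = vec_of_int x + vec_of_int y"
  by (simp add: vec_of_int_def vec_eq_iff)

lemma vec_of_int_diff: "vec_of_int (x - y) = vec_of_int x - vec_of_int y"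
  by (simp add: vec_of_int_def vec_eq_iff)

lemma vec_of_int_smult: "vec_of_int (c *s x) = real_of_int c *\<^sub>R vec_of_int x"
  by (simp add: vec_of_int_def vec_eq_iff)

lemma multiples_limit:
  "(\<lambda>n. (1 / real n) *\<^sub>R vec_of_int (int n *s x)) \<longlonglongrightarrow> vec_of_int x"
proof (rule Lim_transform_eventually[OF tendsto_const])
  show "\<forall>\<^sub>F n in sequentially. vec_of_int x = (1 / real n) *\<^sub>R vec_of_int (int n *s x)"
    by (rule eventually_sequentiallyI[of 1]) (simp add: vec_of_int_smult)
qed

definition vfloor :: "real ^ 'd \<Rightarrow> int ^ 'd" where
  "vfloor \<xi> = (\<chi> i. \<lfloor>\<xi> $ i\<rfloor>)"

lemma l1_vfloor: "l1 (vec_of_int (vfloor \<xi>) - \<xi>) \<le> CARD('d)" for \<xi> :: "real ^ 'd"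
proof -
  have "\<bar>(vec_of_int (vfloor \<xi>) - \<xi>) $ i\<bar> \<le> 1" for i
    by (simp add: vec_of_int_def vfloor_def abs_le_iff) linarith
  then show ?thesis unfolding l1_def using sum_bounded_above[of UNIV _ 1] by force
qed

text \<open>The factor \<open>k n\<close> covers two uses: constant 1 for the direction itself, and
  the integer part of \<open>c * n\<close> divided by \<open>n\<close> for the multiple by a real
  \<open>c\<close>.\<close>

lemma vfloor_limit:
  fixes \<xi> :: "real ^ 'd"
  assumes "k \<longlonglongrightarrow> c"
  shows "(\<lambda>n. (1 / real n) *\<^sub>R vec_of_int (vfloor ((k n * real n) *\<^sub>R \<xi>))) \<longlonglongrightarrow> c *\<^sub>R \<xi>"
proof -
  have "(\<lambda>n. (1 / real n) *\<^sub>R vec_of_int (vfloor ((k n * real n) *\<^sub>R \<xi>)) - k n *\<^sub>R \<xi>) \<longlonglongrightarrow> 0"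
  proof (rule Lim_null_comparison)
    show "(\<lambda>n. real CARD('d) / real n) \<longlonglongrightarrow> 0" by (rule lim_const_over_n)
    show "\<forall>\<^sub>F n in sequentially. norm ((1 / real n) *\<^sub>R vec_of_int (vfloor ((k n * real n) *\<^sub>R \<xi>)) - k n *\<^sub>R \<xi>)
        \<le> real CARD('d) / real n"
    proof (rule eventually_sequentiallyI[of 1])
      fix n :: nat assume n: "n \<ge> 1"
      have "(1 / real n) *\<^sub>R vec_of_int (vfloor ((k n * real n) *\<^sub>R \<xi>)) - k n *\<^sub>R \<xi>
          = (1 / real n) *\<^sub>R (vec_of_int (vfloor ((k n * real n) *\<^sub>R \<xi>)) - (k n * real n) *\<^sub>R \<xi>)"
        using n by (simp add: scaleR_right_diff_distrib)
      also have "norm \<dots> \<le> (1 / real n) * CARD('d)"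
        using order_trans[OF norm_le_l1 l1_vfloor, of "(k n * real n) *\<^sub>R \<xi>"]
        by (auto intro!: divide_right_mono)
      finally show "norm ((1 / real n) *\<^sub>R vec_of_int (vfloor ((k n * real n) *\<^sub>R \<xi>)) - k n *\<^sub>R \<xi>)
        \<le> real CARD('d) / real n" by simp
    qed
  qed
  moreover have "(\<lambda>n. k n *\<^sub>R \<xi>) \<longlonglongrightarrow> c *\<^sub>R \<xi>" by (intro tendsto_intros assms)
  ultimately show ?thesis using tendsto_add[of _ 0 sequentially "\<lambda>n. k n *\<^sub>R \<xi>" "c *\<^sub>R \<xi>"] by fastforce
qed

locale subadditive_lattice_function =
  fixes a :: "int ^ 'd \<Rightarrow> real" and C0 C1 :: real
  assumes nonneg: "\<And>x. 0 \<le> a x" and subadditive: "\<And>x y. a (x + y) \<le> a x + a y"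
    and bound: "\<And>x. a x \<le> C0 + C1 * norm1 x" and C: "0 \<le> C0" "0 \<le> C1"
begin

lemma difference: "a x \<le> a y + C0 + C1 * norm1 (x - y)"
  using subadditive[of y "x - y"] bound[of "x - y"] by simp

definition \<mu> :: "real ^ 'd \<Rightarrow> real" where
  "\<mu> \<xi> = lim (\<lambda>n. a (vfloor (real n *\<^sub>R \<xi>)) / n)"

text \<open>Rounding is additive only up to a vector with entries -1, 0 or 1. The constant
  \<open>K\<close> bounds \<open>a\<close> at such vectors, and adding it to \<open>a\<close> makes
  the sequence along the rounded ray exactly subadditive.\<close>

lemma floor_limit: "(\<lambda>n. a (vfloor (real n *\<^sub>R \<xi>)) / n) \<longlonglongrightarrow> \<mu> \<xi>"
proof -
  define K where "K = C0 + C1 * CARD('d)"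
  define s where "s n = a (vfloor (real n *\<^sub>R \<xi>)) + K" for n
  have "convergent (\<lambda>n. s n / n)"
  proof (rule fekete_nonneg)
    show "0 \<le> s n" for n using nonneg C by (simp add: s_def K_def)
    fix m n
    let ?f = "\<lambda>n. vfloor (real n *\<^sub>R \<xi>)"
    define r where "r = ?f (m + n) - (?f m + ?f n)"
    have "\<bar>r $ i\<bar> \<le> 1" for i
      by (simp add: r_def vfloor_def distrib_right) linarith
    then have "norm1 r \<le> CARD('d)" unfolding norm1_def using sum_bounded_above[of UNIV "\<lambda>i. \<bar>r $ i\<bar>" 1] by simp
    then have "C1 * norm1 r \<le> C1 * CARD('d)" using C by (intro mult_left_mono) linarith+
    then have "a (?f (m + n)) \<le> a (?f m + ?f n) + K"
      using difference[of "?f (m + n)" "?f m + ?f n"] by (simp add: r_def K_def)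
    then show "s (m + n) \<le> s m + s n" using subadditive[of "?f m" "?f n"] by (simp add: s_def)
  qed
  then obtain L where "(\<lambda>n. s n / n) \<longlonglongrightarrow> L" by (auto simp: convergent_def)
  then have "(\<lambda>n. s n / n - K / n) \<longlonglongrightarrow> L - 0" by (intro tendsto_diff lim_const_over_n)
  then have "(\<lambda>n. a (vfloor (real n *\<^sub>R \<xi>)) / n) \<longlonglongrightarrow> L" by (simp add: s_def add_divide_distrib)
  then show ?thesis unfolding \<mu>_def by (simp add: limI)
qed

text \<open>Two lattice sequences with the same asymptotic direction differ by o(n), and by
  \<open>difference\<close> the values of \<open>a\<close> then differ by o(n) as well.\<close>

lemma lattice_limit:
  assumes "(\<lambda>n. (1 / real n) *\<^sub>R vec_of_int (xs n)) \<longlonglongrightarrow> \<xi>"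
  shows "(\<lambda>n. a (xs n) / n) \<longlonglongrightarrow> \<mu> \<xi>"
proof -
  define ys where "ys n = vfloor (real n *\<^sub>R \<xi>)" for n
  have "(\<lambda>n. (1 / real n) *\<^sub>R vec_of_int (ys n)) \<longlonglongrightarrow> 1 *\<^sub>R \<xi>"
    using vfloor_limit[of "\<lambda>_. 1" 1 \<xi>] by (simp add: ys_def)
  then have "(\<lambda>n. (1 / real n) *\<^sub>R vec_of_int (xs n) - (1 / real n) *\<^sub>R vec_of_int (ys n)) \<longlonglongrightarrow> \<xi> - 1 *\<^sub>R \<xi>"
    by (intro tendsto_diff assms)
  then have d0: "(\<lambda>n. norm ((1 / real n) *\<^sub>R vec_of_int (xs n - ys n))) \<longlonglongrightarrow> 0"
    by (simp add: vec_of_int_diff scaleR_right_diff_distrib tendsto_norm_zero)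
  have "(\<lambda>n. a (xs n) / n - a (ys n) / n) \<longlonglongrightarrow> 0"
  proof (rule Lim_null_comparison)
    have "(\<lambda>n. C0 / n + C1 * (real CARD('d) * norm ((1 / real n) *\<^sub>R vec_of_int (xs n - ys n)))) \<longlonglongrightarrow> 0 + C1 * (real CARD('d) * 0)"
      by (intro tendsto_intros d0 lim_const_over_n)
    then show "(\<lambda>n. C0 / n + C1 * (real CARD('d) * norm ((1 / real n) *\<^sub>R vec_of_int (xs n - ys n)))) \<longlonglongrightarrow> 0" by simp
    show "\<forall>\<^sub>F n in sequentially. norm (a (xs n) / n - a (ys n) / n)
       \<le> C0 / n + C1 * (real CARD('d) * norm ((1 / real n) *\<^sub>R vec_of_int (xs n - ys n)))"
    proof (rule eventually_sequentiallyI[of 1])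
      fix n :: nat assume n: "n \<ge> 1"
      have "norm (a (xs n) / n - a (ys n) / n) = \<bar>a (xs n) - a (ys n)\<bar> / n"
        by (simp add: diff_divide_distrib[symmetric])
      also have "\<dots> \<le> (C0 + C1 * norm1 (xs n - ys n)) / n"
        using difference[of "xs n" "ys n"] difference[of "ys n" "xs n"]
        by (intro divide_right_mono) (auto simp: norm1_minus_commute[of "ys n"] abs_le_iff)
      also have "\<dots> = C0 / n + C1 * l1 ((1 / real n) *\<^sub>R vec_of_int (xs n - ys n))"
        using n by (simp add: l1_scaleR l1_vec_of_int add_divide_distrib)
      also have "\<dots> \<le> C0 / n + C1 * (real CARD('d) * norm ((1 / real n) *\<^sub>R vec_of_int (xs n - ys n)))"
        using C by (intro add_left_mono mult_left_mono l1_le_norm)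
      finally show "norm (a (xs n) / n - a (ys n) / n)
       \<le> C0 / n + C1 * (real CARD('d) * norm ((1 / real n) *\<^sub>R vec_of_int (xs n - ys n)))" .
    qed
  qed
  from tendsto_add[OF this floor_limit[of \<xi>]] show ?thesis by (simp add: ys_def)
qed

lemma limit_nonneg: "0 \<le> \<mu> \<xi>"
  by (rule LIMSEQ_le_const[OF floor_limit]) (auto simp: nonneg)

text \<open>For \<open>c > 0\<close> the points obtained by rounding \<open>k n\<close> times \<xi>,
  with \<open>k n\<close> the integer part of \<open>c * n\<close>, are read in two ways: divided by
  \<open>n\<close> they tend to the multiple of \<xi>, divided by \<open>k n\<close> they follow the
  sequence that defines the limit at \<xi>.\<close>

lemma limit_homogeneous:
  assumes "0 \<le> c" shows "\<mu> (c *\<^sub>R \<xi>) = c * \<mu> \<xi>"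
proof (cases "c = 0")
  case True
  have "(\<lambda>n. a 0 / n) \<longlonglongrightarrow> \<mu> 0" by (rule lattice_limit) (simp add: vec_of_int_def vec_eq_iff zero_vec_def[symmetric])
  then have "\<mu> 0 = 0" using lim_const_over_n LIMSEQ_unique by blast
  then show ?thesis using True by simp
next
  case False
  then have c: "c > 0" using assms by simp
  define k where "k n = nat \<lfloor>c * real n\<rfloor>" for n
  have klim: "(\<lambda>n. real (k n) / real n) \<longlonglongrightarrow> c"
  proof (rule tendsto_sandwich)
    show "\<forall>\<^sub>F n in sequentially. c - 1 / real n \<le> real (k n) / real n"
    proof (rule eventually_sequentiallyI[of 1])
      fix n :: nat assume "n \<ge> 1"
      have "c * n - 1 \<le> k n" unfolding k_def by linarith
      then have "(c * n - 1) / n \<le> k n / n" by (intro divide_right_mono) auto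
      then show "c - 1 / real n \<le> real (k n) / real n" using \<open>n \<ge> 1\<close> by (simp add: diff_divide_distrib)
    qed
    show "\<forall>\<^sub>F n in sequentially. real (k n) / real n \<le> c"
    proof (rule eventually_sequentiallyI[of 1])
      fix n :: nat assume "n \<ge> 1"
      have "0 \<le> c * n" using c by simp
      then have "k n \<le> c * n" unfolding k_def by linarith
      then show "real (k n) / real n \<le> c" using \<open>n \<ge> 1\<close> by (simp add: field_simps)
    qed
    have "(\<lambda>n. c - 1 / real n) \<longlonglongrightarrow> c - 0" by (intro tendsto_intros lim_const_over_n)
    then show "(\<lambda>n. c - 1 / real n) \<longlonglongrightarrow> c" by simp
  qed simp
  have kinf: "filterlim k at_top sequentially"
    unfolding filterlim_at_top
  proof
    fix Z
    obtain N :: nat where N: "N \<ge> (real Z + 1) / c" using real_arch_simple by blast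
    show "\<forall>\<^sub>F n in sequentially. Z \<le> k n"
    proof (rule eventually_sequentiallyI[of N])
      fix n assume "n \<ge> N"
      then have "real Z + 1 \<le> c * n" using N c by (simp add: field_simps) (metis mult.commute mult_left_mono of_nat_le_iff order_trans less_imp_le)
      then show "Z \<le> k n" unfolding k_def by linarith
    qed
  qed
  define xs where "xs n = vfloor (real (k n) *\<^sub>R \<xi>)" for n
  have "(\<lambda>n. (1 / real n) *\<^sub>R vec_of_int (vfloor ((real (k n) / real n * real n) *\<^sub>R \<xi>))) \<longlonglongrightarrow> c *\<^sub>R \<xi>"
    by (rule vfloor_limit[OF klim])
  moreover have "\<forall>\<^sub>F n in sequentially. (1 / real n) *\<^sub>R vec_of_int (vfloor ((real (k n) / real n * real n) *\<^sub>R \<xi>))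
      = (1 / real n) *\<^sub>R vec_of_int (xs n)"
    by (rule eventually_sequentiallyI[of 1]) (simp add: xs_def)
  ultimately have "(\<lambda>n. (1 / real n) *\<^sub>R vec_of_int (xs n)) \<longlonglongrightarrow> c *\<^sub>R \<xi>"
    by (rule Lim_transform_eventually)
  then have 1: "(\<lambda>n. a (xs n) / n) \<longlonglongrightarrow> \<mu> (c *\<^sub>R \<xi>)" by (rule lattice_limit)
  have "(\<lambda>n. a (xs n) / k n) \<longlonglongrightarrow> \<mu> \<xi>"
    using filterlim_compose[OF floor_limit[of \<xi>] kinf] by (simp add: xs_def)
  then have "(\<lambda>n. a (xs n) / k n * (real (k n) / real n)) \<longlonglongrightarrow> \<mu> \<xi> * c" by (rule tendsto_mult[OF _ klim])
  moreover have "\<forall>\<^sub>F n in sequentially. a (xs n) / k n * (real (k n) / real n) = a (xs n) / n"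
    using filterlim_at_top[THEN iffD1, OF kinf, THEN spec, of 1] by eventually_elim simp
  ultimately have "(\<lambda>n. a (xs n) / n) \<longlonglongrightarrow> \<mu> \<xi> * c" by (rule Lim_transform_eventually)
  then show ?thesis using 1 LIMSEQ_unique by (metis mult.commute)
qed

lemma limit_subadditive: "\<mu> (\<xi> + \<eta>) \<le> \<mu> \<xi> + \<mu> \<eta>"
proof (rule LIMSEQ_le)
  let ?f = "\<lambda>\<xi> n. vfloor (real n *\<^sub>R \<xi>)"
  have "(\<lambda>n. (1 / real n) *\<^sub>R vec_of_int (?f \<xi> n) + (1 / real n) *\<^sub>R vec_of_int (?f \<eta> n)) \<longlonglongrightarrow> 1 *\<^sub>R \<xi> + 1 *\<^sub>R \<eta>"
    using vfloor_limit[of "\<lambda>_. 1" 1] by (intro tendsto_add) auto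
  then show "(\<lambda>n. a (?f \<xi> n + ?f \<eta> n) / n) \<longlonglongrightarrow> \<mu> (\<xi> + \<eta>)"
    by (intro lattice_limit) (simp add: vec_of_int_add scaleR_right_distrib)
  show "(\<lambda>n. a (?f \<xi> n) / n + a (?f \<eta> n) / n) \<longlonglongrightarrow> \<mu> \<xi> + \<mu> \<eta>"
    by (intro tendsto_add floor_limit)
  show "\<exists>N. \<forall>n\<ge>N. a (?f \<xi> n + ?f \<eta> n) / n \<le> a (?f \<xi> n) / n + a (?f \<eta> n) / n"
    using subadditive by (auto simp: add_divide_distrib[symmetric] intro!: divide_right_mono)
qed

lemma limit_le_l1: "\<mu> \<xi> \<le> C1 * l1 \<xi>"
proof (rule LIMSEQ_le[OF floor_limit])
  have "(\<lambda>n. C1 * l1 \<xi> + (C0 + C1 * CARD('d)) / n) \<longlonglongrightarrow> C1 * l1 \<xi> + 0"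
    by (intro tendsto_intros lim_const_over_n)
  then show "(\<lambda>n. C1 * l1 \<xi> + (C0 + C1 * CARD('d)) / n) \<longlonglongrightarrow> C1 * l1 \<xi>" by simp
  show "\<exists>N. \<forall>n\<ge>N. a (vfloor (real n *\<^sub>R \<xi>)) / real n \<le> C1 * l1 \<xi> + (C0 + C1 * CARD('d)) / n"
  proof (intro exI[of _ 1] allI impI)
    fix n :: nat assume n: "1 \<le> n"
    have "norm1 (vfloor (real n *\<^sub>R \<xi>)) = l1 (real n *\<^sub>R \<xi> + (vec_of_int (vfloor (real n *\<^sub>R \<xi>)) - real n *\<^sub>R \<xi>))"
      by (simp add: l1_vec_of_int)
    also have "\<dots> \<le> real n * l1 \<xi> + CARD('d)"
      using l1_triangle[of "real n *\<^sub>R \<xi>" "vec_of_int (vfloor (real n *\<^sub>R \<xi>)) - real n *\<^sub>R \<xi>"] l1_vfloor[of "real n *\<^sub>R \<xi>"]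
      by (simp add: l1_scaleR)
    finally have "C1 * norm1 (vfloor (real n *\<^sub>R \<xi>)) \<le> C1 * (real n * l1 \<xi> + CARD('d))"
      using C by (intro mult_left_mono)
    then have "a (vfloor (real n *\<^sub>R \<xi>)) \<le> C0 + C1 * (real n * l1 \<xi> + CARD('d))"
      using bound[of "vfloor (real n *\<^sub>R \<xi>)"] by linarith
    then have "a (vfloor (real n *\<^sub>R \<xi>)) / n \<le> (C0 + C1 * (real n * l1 \<xi> + CARD('d))) / n"
      by (intro divide_right_mono) auto
    also have "\<dots> = C1 * l1 \<xi> + (C0 + C1 * CARD('d)) / n" using n by (simp add: field_simps)
    finally show "a (vfloor (real n *\<^sub>R \<xi>)) / real n \<le> C1 * l1 \<xi> + (C0 + C1 * CARD('d)) / n" .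
  qed
qed

lemma limit_lipschitz: "\<bar>\<mu> \<xi> - \<mu> \<eta>\<bar> \<le> C1 * l1 (\<xi> - \<eta>)"
proof -
  have *: "\<mu> \<xi> - \<mu> \<eta> \<le> C1 * l1 (\<xi> - \<eta>)" for \<xi> \<eta>
    using limit_subadditive[of \<eta> "\<xi> - \<eta>"] limit_le_l1[of "\<xi> - \<eta>"] by simp
  have "l1 (\<eta> - \<xi>) = l1 (\<xi> - \<eta>)" by (simp add: l1_def abs_minus_commute)
  then show ?thesis using *[of \<xi> \<eta>] *[of \<eta> \<xi>] by (simp add: abs_le_iff)
qed

lemma limit_continuous: "continuous_on UNIV \<mu>"
proof (rule continuous_at_imp_continuous_on, rule ballI)
  fix \<xi> :: "real ^ 'd"
  have "((\<lambda>\<eta>. \<mu> \<eta> - \<mu> \<xi>) \<longlongrightarrow> 0) (at \<xi>)"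
  proof (rule Lim_null_comparison)
    show "\<forall>\<^sub>F \<eta> in at \<xi>. norm (\<mu> \<eta> - \<mu> \<xi>) \<le> C1 * (real CARD('d) * norm (\<eta> - \<xi>))"
      using limit_lipschitz l1_le_norm C by (auto intro!: always_eventually order_trans[OF limit_lipschitz] mult_left_mono)
    have "((\<lambda>\<eta>. C1 * (real CARD('d) * norm (\<eta> - \<xi>))) \<longlongrightarrow> C1 * (real CARD('d) * norm (\<xi> - \<xi>))) (at \<xi>)"
      by (intro tendsto_intros)
    then show "((\<lambda>\<eta>. C1 * (real CARD('d) * norm (\<eta> - \<xi>))) \<longlongrightarrow> 0) (at \<xi>)" by simp
  qed
  then show "isCont \<mu> \<xi>" by (simp add: isCont_def LIM_zero_iff)
qed

lemma limit_convex: "convex_on UNIV \<mu>"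
proof (rule convex_onI)
  fix t :: real and \<xi> \<eta> :: "real ^ 'd" assume t: "0 < t" "t < 1"
  have "\<mu> ((1 - t) *\<^sub>R \<xi> + t *\<^sub>R \<eta>) \<le> \<mu> ((1 - t) *\<^sub>R \<xi>) + \<mu> (t *\<^sub>R \<eta>)" by (rule limit_subadditive)
  then show "\<mu> ((1 - t) *\<^sub>R \<xi> + t *\<^sub>R \<eta>) \<le> (1 - t) * \<mu> \<xi> + t * \<mu> \<eta>"
    using t by (simp add: limit_homogeneous)
qed simp

text \<open>The limit along multiples of \<open>x\<close> is also an infimum. Applied to multiples
  of a vector, this supplies the lower bound on means that \<open>subadditive_lower_bound\<close>
  requires.\<close>

lemma limit_le: "\<mu> (vec_of_int x) \<le> a x"
proof (rule LIMSEQ_le)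
  show "(\<lambda>n. a (int n *s x) / n) \<longlonglongrightarrow> \<mu> (vec_of_int x)"
    by (rule lattice_limit[OF multiples_limit])
  have *: "a (int n *s x) \<le> a 0 + n * a x" for n
  proof (induction n)
    case (Suc n)
    have "int (Suc n) *s x = int n *s x + x" by (simp add: vec_eq_iff algebra_simps)
    then show ?case using Suc subadditive[of "int n *s x" x] by (simp add: algebra_simps)
  qed simp
  have "(\<lambda>n. a 0 / n + a x) \<longlonglongrightarrow> 0 + a x" by (intro tendsto_intros lim_const_over_n)
  then show "(\<lambda>n. a 0 / n + a x) \<longlonglongrightarrow> a x" by simp
  show "\<exists>N. \<forall>n\<ge>N. a (int n *s x) / n \<le> a 0 / n + a x"
  proof (intro exI[of _ 1] allI impI)
    fix n :: nat assume "1 \<le> n"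
    then show "a (int n *s x) / n \<le> a 0 / n + a x" using *[of n] by (simp add: field_simps)
  qed
qed

end

context iid_weights
begin

subsection \<open>Moments of the local step cost\<close>

lemma Min_measurable [measurable]:
  "c \<in> units \<rightarrow> lattice_edges \<Longrightarrow> (\<lambda>w. Min ((\<lambda>u. max 0 (w (c u))) ` units)) \<in> borel_measurable P"
  by (intro borel_measurable_Min) (auto intro!: borel_measurable_max coordinate_measurable)

text \<open>The minimum over any \<open>2d\<close> distinct edges has the same law, so moments
  assumed at the origin pass to every transversal of the detours.\<close>

lemma integrable_Min_iff:
  fixes c :: "int ^ 'd \<Rightarrow> (int ^ 'd) set"
  assumes "inj_on c units" "c \<in> units \<rightarrow> lattice_edges"
  shows "integrable P (\<lambda>w. Min ((\<lambda>u. max 0 (w (c u))) ` units) ^ p) \<longleftrightarrow>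
    integrable (PiM (units :: (int ^ 'd) set) (\<lambda>_. N)) (\<lambda>v. Min ((\<lambda>u. max 0 (v u)) ` units) ^ p)"
proof -
  let ?Q = "PiM (units :: (int ^ 'd) set) (\<lambda>_. N)"
  define g :: "(int ^ 'd \<Rightarrow> real) \<Rightarrow> real" where "g v = Min ((\<lambda>u. max 0 (v u)) ` units) ^ p" for v
  have comp: "(\<lambda>v. v u) \<in> borel_measurable ?Q" if "u \<in> units" for u
    using measurable_component_singleton[OF that, of "\<lambda>_. N"] by (simp add: measurable_cong_sets[OF refl sets_N])
  have g [measurable]: "g \<in> borel_measurable ?Q"
    unfolding g_def by (intro borel_measurable_power borel_measurable_Min borel_measurable_max comp) auto
  have r: "(\<lambda>w. \<lambda>u\<in>units. w (c u)) \<in> measurable P ?Q"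
    unfolding P_def using assms(2) by (intro measurable_restrict measurable_component_singleton) auto
  have "integrable P (\<lambda>w. g (\<lambda>u\<in>units. w (c u))) \<longleftrightarrow> integrable ?Q g"
    using integrable_distr_eq[OF r g] distr_reindex[OF assms] by simp
  moreover have "g (\<lambda>u\<in>units. w (c u)) = Min ((\<lambda>u. max 0 (w (c u))) ` units) ^ p" for w
    unfolding g_def by (intro arg_cong[of _ _ "\<lambda>A. Min A ^ p"] image_cong) auto
  ultimately show ?thesis by (simp add: g_def[abs_def])
qed

lemma transversal_inj:
  fixes s :: "int ^ 'd"
  assumes "s \<in> units" "c \<in> transversals s"
  shows "inj_on c units" "c \<in> units \<rightarrow> lattice_edges"
proof -
  obtain a b \<alpha> where ab: "a \<noteq> b" "s = axis a \<alpha>" "\<alpha> = 1 \<or> \<alpha> = -1" "orthogonal_unit s = axis b 1"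
    using orthogonal_unit[OF dim assms(1)] .
  have c: "c u \<in> detour_edges s u" if "u \<in> units" for u using assms(2) that by (auto simp: transversals_def)
  show "inj_on c units"
  proof (rule inj_onI, rule ccontr)
    fix u u' assume u: "u \<in> units" "u' \<in> units" "c u = c u'" "u \<noteq> u'"
    have "c u \<in> detour_edges s u \<inter> detour_edges s u'" using c[OF u(1)] c[OF u(2)] u(3) by simp
    then show False using path_edges_detour_disjoint[OF ab u(1,2,4)] by simp
  qed
  show "c \<in> units \<rightarrow> lattice_edges"
  proof
    fix u :: "int ^ 'd" assume "u \<in> units"
    then have "successively adjacent (detour (orthogonal_unit s) s u)"
      using assms(1) ab(4) by (intro detour_adjacent) (auto simp: axis_in_units)
    then show "c u \<in> lattice_edges" using path_edges_lattice c[OF \<open>u \<in> units\<close>] by blast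
  qed
qed

lemma step_cost_measurable [measurable]: "step_cost \<in> borel_measurable P"
  unfolding step_cost_def[abs_def] using transversal_inj(2)
  by (intro borel_measurable_sum borel_measurable_times Min_measurable) auto

lemma step_cost_shift_measurable [measurable]: "(\<lambda>w. step_cost (shift x w)) \<in> borel_measurable P"
  by measurable

lemma step_cost_power_integrable:
  assumes "integrable P (\<lambda>w. Min ((\<lambda>u. max 0 (w {0, u})) ` units) ^ p)" "p > 0"
  shows "integrable P (\<lambda>w. step_cost w ^ p)"
proof -
  have o: "inj_on (\<lambda>u. {0, u}) (units :: (int ^ 'd) set)" "(\<lambda>u. {0, u}) \<in> (units :: (int ^ 'd) set) \<rightarrow> lattice_edges"
    by (auto simp: inj_on_def doubleton_eq_iff adjacent_iff_unit intro!: edge_in_lattice)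
  have m: "(\<lambda>w. Min ((\<lambda>u. max 0 (w (c u))) ` units)) \<in> borel_measurable P"
    if "s \<in> units" "c \<in> transversals s" for s c
    using transversal_inj[OF that] by (intro Min_measurable)
  have i: "integrable P (\<lambda>w. Min ((\<lambda>u. max 0 (w (c u))) ` units) ^ p)"
    if "s \<in> units" "c \<in> transversals s" for s c
    using assms(1) unfolding integrable_Min_iff[OF o] integrable_Min_iff[OF transversal_inj[OF that]] .
  show ?thesis
    unfolding step_cost_def
  proof (rule integrable_sum_power[OF _ _ _ _ assms(2)])
    fix s :: "int ^ 'd" assume s: "s \<in> units"
    show "integrable P (\<lambda>w. (\<Sum>c\<in>transversals s. 9 * Min ((\<lambda>u. max 0 (w (c u))) ` units)) ^ p)"
    proof (rule integrable_sum_power[OF _ _ _ _ assms(2)])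
      fix c assume c: "c \<in> transversals s"
      show "(\<lambda>w. 9 * Min ((\<lambda>u. max 0 (w (c u))) ` units)) \<in> borel_measurable P"
        using m[OF s c] by simp
      show "integrable P (\<lambda>w. (9 * Min ((\<lambda>u. max 0 (w (c u))) ` units)) ^ p)"
        using i[OF s c] by (simp add: power_mult_distrib)
    qed (auto intro: Min_pos_nonneg)
    show "(\<lambda>w. \<Sum>c\<in>transversals s. 9 * Min ((\<lambda>u. max 0 (w (c u))) ` units)) \<in> borel_measurable P"
      using m[OF s] by (intro borel_measurable_sum borel_measurable_times) auto
  qed (auto intro!: sum_nonneg intro: Min_pos_nonneg)
qed

definition step_support :: "(int ^ 'd) set set" where
  "step_support = (\<Union>s\<in>units. \<Union>u\<in>units. detour_edges s u)"

lemma step_support: "finite step_support" "step_support \<subseteq> lattice_edges"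
proof -
  show "finite step_support" by (simp add: step_support_def)
  show "step_support \<subseteq> lattice_edges"
    unfolding step_support_def
  proof (intro UN_least)
    fix s u :: "int ^ 'd" assume su: "s \<in> units" "u \<in> units"
    obtain a b \<alpha> where ab: "a \<noteq> b" "s = axis a \<alpha>" "\<alpha> = 1 \<or> \<alpha> = -1" "orthogonal_unit s = axis b 1"
      using orthogonal_unit[OF dim su(1)] .
    have "successively adjacent (detour (orthogonal_unit s) s u)"
      using su ab(4) by (intro detour_adjacent) (auto simp: axis_in_units)
    then show "detour_edges s u \<subseteq> lattice_edges" by (rule path_edges_lattice)
  qed
qed

lemma step_cost_local:
  assumes "\<And>e. e \<in> step_support \<Longrightarrow> w e = w' e"
  shows "step_cost w = step_cost w'"
  unfolding step_cost_def
proof (intro sum.cong refl arg_cong[of _ _ "\<lambda>A. 9 * Min A"] image_cong arg_cong[of _ _ "max 0"] assms)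
  fix s u :: "int ^ 'd" and c
  assume "s \<in> units" "c \<in> transversals s" "u \<in> units"
  then show "c u \<in> step_support" by (auto simp: step_support_def transversals_def)
qed

lemma step_cost_shift_local:
  assumes "\<And>e. e \<in> (`) ((+) x) ` step_support \<Longrightarrow> w e = w' e"
  shows "step_cost (shift x w) = step_cost (shift x w')"
  using assms step_support(2) by (intro step_cost_local) (auto simp: shift_def)

subsection \<open>Measurability\<close>

lemma path_weight_measurable:
  "successively adjacent p \<Longrightarrow> (\<lambda>w. path_weight w p) \<in> borel_measurable P"
  by (induction p rule: induct_list012) (auto intro!: borel_measurable_add coordinate_measurable edge_in_lattice)

lemma ptime_measurable [measurable]: "(\<lambda>w. ptime w x y) \<in> borel_measurable P"
  unfolding ptime_def
  by (intro borel_measurable_INF borel_measurable_ereal path_weight_measurable) (auto simp: saw_iff)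

lemma loop_gain_measurable [measurable]: "(\<lambda>w. loop_gain w y) \<in> borel_measurable P"
  unfolding loop_gain_def by measurable

lemma tame_measurable [measurable]: "Measurable.pred P tame"
  unfolding tame_def[abs_def] by measurable

lemma gain_measurable [measurable]: "(\<lambda>w. gain w y) \<in> borel_measurable P"
  unfolding gain_def by measurable

lemma rtime_measurable [measurable]: "(\<lambda>w. rtime w x y) \<in> borel_measurable P"
  unfolding rtime_def by measurable

lemma stime_measurable [measurable]: "(\<lambda>w. stime w x y) \<in> borel_measurable P"
  unfolding stime_def by measurable

lemma AE_shift:
  assumes "AE w in P. Q w" shows "AE w in P. Q (shift z w)"
proof -
  have "AE w in distr P P (shift z). Q w" using assms by (simp only: distr_shift)
  then show ?thesis by (rule AE_distrD[OF shift_measurable])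
qed

lemma gain_shift: "gain w y = gain (shift y w) 0"
  by (simp add: gain_def loop_gain_shift)

end

locale first_passage = iid_weights N P for N and P :: "('d::finite) config measure" +
  assumes min_integrable: "integrable P (\<lambda>w. Min ((\<lambda>u. max 0 (w {0, u})) ` units))"
    and gain_finite: "(\<integral>\<^sup>+w. e2ennreal (loop_gain w 0) \<partial>P) < \<infinity>"
begin

text \<open>Integrability gives finiteness at the origin; invariance of the measure carries it to
  each of the countably many vertices.\<close>

lemma AE_tame: "AE w in P. tame w"
proof -
  have "AE w in P. e2ennreal (loop_gain w 0) \<noteq> \<infinity>"
    using gain_finite by (intro nn_integral_PInf_AE) auto
  then have "AE w in P. loop_gain w 0 < \<infinity>"
    by eventually_elim (auto simp: less_top[symmetric])
  then have "AE w in P. loop_gain (shift y w) 0 < \<infinity>" for y by (rule AE_shift)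
  then have "AE w in P. loop_gain w y < \<infinity>" for y by (simp add: loop_gain_shift)
  then show ?thesis by (simp add: tame_def AE_all_countable)
qed

lemma gain_power_integrable:
  assumes "(\<integral>\<^sup>+w. e2ennreal (loop_gain w 0) ^ p \<partial>P) < \<infinity>"
  shows "integrable P (\<lambda>w. gain w 0 ^ p)"
proof -
  have "(\<integral>\<^sup>+w. ennreal (norm (gain w 0 ^ p)) \<partial>P) = (\<integral>\<^sup>+w. e2ennreal (loop_gain w 0) ^ p \<partial>P)"
  proof (rule nn_integral_cong_AE)
    show "AE w in P. ennreal (norm (gain w 0 ^ p)) = e2ennreal (loop_gain w 0) ^ p"
      using AE_tame by eventually_elim (simp add: loop_gain_eq gain_nonneg ennreal_power)
  qed
  then show ?thesis using assms by (simp add: integrable_iff_bounded)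
qed

lemma gain_integrable: "integrable P (\<lambda>w. gain w y)"
proof -
  have "integrable P (\<lambda>w. gain w 0)" using gain_power_integrable[of 1] gain_finite by simp
  then show ?thesis unfolding gain_shift[of _ y] by (rule integrable_shift)
qed

lemma step_cost_integrable: "integrable P (\<lambda>w. step_cost (shift x w))"
  using step_cost_power_integrable[of 1] min_integrable by (intro integrable_shift) simp

lemma path_from_origin:
  fixes y :: "int ^ 'd"
  obtains \<gamma> where "monotone_path (orientation y) (nat (norm1 y)) \<gamma>" "\<gamma> 0 = 0" "\<gamma> (nat (norm1 y)) = y"
  using monotone_path_exists[OF orientation] by blast

text \<open>Dominate by the step costs along a geodesic plus the gain at its end. By stationarity
  the mean of this bound is affine in \<open>norm1 y\<close>, the growth condition that the limit
  function needs.\<close>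

lemma stime_from_origin_integrable: "integrable P (\<lambda>w. stime w 0 y)"
  and expectation_stime_le: "expectation (\<lambda>w. stime w 0 y) \<le> expectation (\<lambda>w. gain w 0) + expectation step_cost * norm1 y"
proof -
  define n where "n = nat (norm1 y)"
  obtain \<gamma> where \<gamma>: "monotone_path (orientation y) n \<gamma>" "\<gamma> 0 = 0" "\<gamma> n = y"
    using path_from_origin unfolding n_def .
  define g where "g w = (\<Sum>i<n. step_cost (shift (\<gamma> i) w)) + gain w y" for w
  have le: "stime w 0 y \<le> g w" for w
    unfolding g_def using \<gamma> reach_monotone_path[OF dim \<gamma>(1), of w 0]
    by (intro stime_le_of_reach[OF dim]) (auto intro: sum_nonneg)
  have gi: "integrable P g" unfolding g_def using step_cost_integrable gain_integrable by auto
  show i: "integrable P (\<lambda>w. stime w 0 y)"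
  proof (rule Bochner_Integration.integrable_bound[OF gi])
    show "AE w in P. norm (stime w 0 y) \<le> norm (g w)"
    proof (rule AE_I2)
      fix w show "norm (stime w 0 y) \<le> norm (g w)" using le[of w] stime_nonneg[OF dim, of w 0 y] by simp
    qed
  qed simp
  have "expectation (\<lambda>w. stime w 0 y) \<le> expectation g" by (rule integral_mono[OF i gi le])
  also have "expectation g = (\<Sum>i<n. expectation (\<lambda>w. step_cost (shift (\<gamma> i) w))) + expectation (\<lambda>w. gain w y)"
    unfolding g_def using step_cost_integrable gain_integrable by simp
  also have "\<dots> = n * expectation step_cost + expectation (\<lambda>w. gain w 0)"
    using integral_shift[of "\<lambda>w. gain w 0" y] by (simp add: integral_shift gain_shift[of _ y])
  finally show "expectation (\<lambda>w. stime w 0 y) \<le> expectation (\<lambda>w. gain w 0) + expectation step_cost * norm1 y"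
    by (simp add: n_def mult.commute)
qed

lemma stime_eq_shift: "stime w x y = stime (shift x w) 0 (y - x)"
  by (simp add: stime_shift)

lemma stime_integrable: "integrable P (\<lambda>w. stime w x y)"
  unfolding stime_eq_shift[of _ x y] by (rule integrable_shift[OF stime_from_origin_integrable])

lemma expectation_stime: "expectation (\<lambda>w. stime w x y) = expectation (\<lambda>w. stime w 0 (y - x))"
  unfolding stime_eq_shift[of _ x y] by (rule integral_shift) simp

lemma AE_rtime_eq: "AE w in P. \<forall>x y. ptime w x y = ereal (rtime w x y) \<and> rtime w x y = stime w x y - gain w y"
  using AE_tame by eventually_elim (simp add: ptime_eq_rtime[OF dim] stime_def)

lemma rtime_integrable: "integrable P (\<lambda>w. rtime w x y)"
proof -
  have "integrable P (\<lambda>w. stime w x y - gain w y)" using stime_integrable gain_integrable by auto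
  moreover have "AE w in P. rtime w x y = stime w x y - gain w y" using AE_rtime_eq by eventually_elim simp
  ultimately show ?thesis by (subst integrable_cong_AE[where g = "\<lambda>w. stime w x y - gain w y"]) auto
qed

definition mean_time :: "int ^ 'd \<Rightarrow> real" where
  "mean_time x = expectation (\<lambda>w. stime w 0 x)"

sublocale limit: subadditive_lattice_function mean_time "expectation (\<lambda>w. gain w 0)" "expectation step_cost"
proof
  show "0 \<le> mean_time x" for x
    unfolding mean_time_def by (intro integral_nonneg_AE AE_I2 stime_nonneg[OF dim])
  show "mean_time x \<le> expectation (\<lambda>w. gain w 0) + expectation step_cost * norm1 x" for x
    unfolding mean_time_def by (rule expectation_stime_le)
  show "0 \<le> expectation (\<lambda>w. gain w 0)" by (intro integral_nonneg_AE AE_I2 gain_nonneg)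
  show "0 \<le> expectation step_cost" by (intro integral_nonneg_AE AE_I2 step_cost_nonneg)
  fix x y
  have "mean_time (x + y) \<le> expectation (\<lambda>w. stime w 0 x + stime w x (x + y))"
    unfolding mean_time_def
    by (intro integral_mono stime_integrable Bochner_Integration.integrable_add stime_triangle[OF dim])
  also have "\<dots> = mean_time x + expectation (\<lambda>w. stime w x (x + y))"
    by (simp add: stime_integrable mean_time_def)
  also have "expectation (\<lambda>w. stime w x (x + y)) = mean_time y"
    using expectation_stime[of x "x + y"] by (simp add: mean_time_def)
  finally show "mean_time (x + y) \<le> mean_time x + mean_time y" .
qed

notation limit.\<mu> ("\<mu>")

text \<open>Translation by \<open>v\<close> is the ergodic map; its powers are translations by
  multiples of \<open>v\<close>, so subadditivity on the lattice becomes subadditivity over the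
  map.\<close>

lemma multiples_lower:
  fixes v :: "int ^ 'd"
  assumes "v \<noteq> 0" "c < \<mu> (vec_of_int v)"
  shows "AE w in P. \<forall>\<^sub>F n in sequentially. c * real n \<le> stime w 0 (int n *s v)"
proof -
  interpret erg: ergodic_map P "shift v" by (rule ergodic_shift[OF assms(1)])
  show ?thesis
  proof (rule erg.subadditive_lower_bound[OF stime_from_origin_integrable _ _ _ assms(2)])
    show "0 \<le> stime w 0 (int n *s v)" for n w by (rule stime_nonneg[OF dim])
    show "\<mu> (vec_of_int v) * real n \<le> expectation (\<lambda>w. stime w 0 (int n *s v))" for n
      using limit.limit_le[of "int n *s v"] by (simp add: vec_of_int_smult limit.limit_homogeneous mean_time_def mult.commute)
    fix m n and w assume w: "w \<in> space P"
    have "stime w 0 (int (m + n) *s v) \<le> stime w 0 (int m *s v) + stime w (int m *s v) (int (m + n) *s v)"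
      by (rule stime_triangle[OF dim])
    also have "stime w (int m *s v) (int (m + n) *s v) = stime ((shift v ^^ m) w) 0 (int n *s v)"
      using w by (simp add: shift_power space_P stime_shift vector_sadd_rdistrib)
    finally show "stime w 0 (int (m + n) *s v) \<le> stime w 0 (int m *s v) + stime ((shift v ^^ m) w) 0 (int n *s v)" .
  qed
qed

text \<open>Splitting the way into steps of length \<open>v\<close> gives only the rate
  \<open>mean_time v\<close>, which may exceed the limit; applying this to a large multiple of
  \<open>v\<close> closes the gap later. The gain at 0 appears because \<open>stime\<close> from a
  point to itself need not vanish.\<close>

lemma multiples_upper:
  fixes v :: "int ^ 'd"
  assumes "v \<noteq> 0" "mean_time v < c"
  shows "AE w in P. \<forall>\<^sub>F n in sequentially. stime w 0 (int n *s v) \<le> gain w 0 + c * real n"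
proof -
  interpret erg: ergodic_map P "shift v" by (rule ergodic_shift[OF assms(1)])
  have "AE w in P. \<forall>\<^sub>F n in sequentially. (\<Sum>i<n. stime ((shift v ^^ i) w) 0 v) \<le> c * real n"
    using assms(2) by (intro erg.birkhoff_upper_bound stime_from_origin_integrable stime_nonneg[OF dim]) (simp add: mean_time_def)
  then show ?thesis
  proof (rule AE_mp, intro AE_I2 impI)
    fix w assume w: "w \<in> space P" and ev: "\<forall>\<^sub>F n in sequentially. (\<Sum>i<n. stime ((shift v ^^ i) w) 0 v) \<le> c * real n"
    have "stime w 0 (int n *s v) \<le> gain w 0 + (\<Sum>i<n. stime ((shift v ^^ i) w) 0 v)" for n
    proof (induction n)
      case 0
      then show ?case using stime_le_of_reach[OF dim reach_refl, of w 0] by simp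
    next
      case (Suc n)
      have "stime w 0 (int (Suc n) *s v) \<le> stime w 0 (int n *s v) + stime w (int n *s v) (int (Suc n) *s v)"
        by (rule stime_triangle[OF dim])
      also have "stime w (int n *s v) (int (Suc n) *s v) = stime ((shift v ^^ n) w) 0 v"
        using w by (simp add: shift_power space_P stime_shift vector_sadd_rdistrib add.commute)
      finally show ?case using Suc by simp
    qed
    note le = this
    show "\<forall>\<^sub>F n in sequentially. stime w 0 (int n *s v) \<le> gain w 0 + c * real n"
      using ev
    proof (rule eventually_mono)
      fix n assume "(\<Sum>i<n. stime ((shift v ^^ i) w) 0 v) \<le> c * real n"
      then show "stime w 0 (int n *s v) \<le> gain w 0 + c * real n" using le[of n] by linarith
    qed
  qed
qed

end

context first_passage
begin

subsection \<open>Convergence in mean\<close>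

lemma integrable_abs_diff:
  "integrable P (\<lambda>w. \<bar>stime w x y / n - c\<bar>)"
  using stime_integrable by (intro Bochner_Integration.integrable_abs Bochner_Integration.integrable_diff) auto

text \<open>Writes the absolute value of \<open>X - m\<close> as
  \<open>(X - m) + 2 * max 0 (m - X)\<close>. The first term has mean tending to 0; the second tends
  to 0 almost surely by the lower bound and lies between 0 and \<open>m\<close> because
  \<open>X\<close> is nonnegative.\<close>

lemma multiples_L1:
  fixes v :: "int ^ 'd"
  shows "(\<lambda>n. expectation (\<lambda>w. \<bar>stime w 0 (int n *s v) / n - \<mu> (vec_of_int v)\<bar>)) \<longlonglongrightarrow> 0"
proof (cases "v = 0")
  case True
  have z: "vec_of_int (0 :: int ^ 'd) = 0" by (simp add: vec_of_int_def vec_eq_iff)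
  have "\<mu> 0 = 0" using limit.limit_homogeneous[of 0 0] by simp
  moreover have "(\<lambda>n. mean_time 0 / n) \<longlonglongrightarrow> 0" by (rule lim_const_over_n)
  ultimately show ?thesis using True z stime_nonneg[OF dim]
    by (simp add: mean_time_def)
next
  case False
  define m where "m = \<mu> (vec_of_int v)"
  have m: "0 \<le> m" unfolding m_def by (rule limit.limit_nonneg)
  define X where "X n w = stime w 0 (int n *s v) / n" for n w
  have Xi: "integrable P (X n)" for n unfolding X_def using stime_integrable by auto
  have [measurable]: "X n \<in> borel_measurable P" for n using Xi by auto
  have Xnn: "0 \<le> X n w" for n w unfolding X_def using stime_nonneg[OF dim] by simp
  have "(\<lambda>n. expectation (\<lambda>w. max 0 (m - X n w))) \<longlonglongrightarrow> expectation (\<lambda>_. 0)"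
  proof (rule integral_dominated_convergence[where w = "\<lambda>_. m"])
    have "AE w in P. \<forall>k. \<forall>\<^sub>F n in sequentially. (m - 1 / Suc k) * real n \<le> stime w 0 (int n *s v)"
      unfolding AE_all_countable m_def by (intro allI multiples_lower[OF False]) simp
    then show "AE w in P. (\<lambda>n. max 0 (m - X n w)) \<longlonglongrightarrow> 0"
    proof eventually_elim
      case (elim w)
      show ?case
      proof (rule LIMSEQ_I)
        fix e :: real assume "e > 0"
        then obtain k :: nat where k: "1 / Suc k < e" by (metis nat_approx_posE)
        obtain N where N: "\<And>n. n \<ge> N \<Longrightarrow> (m - 1 / Suc k) * real n \<le> stime w 0 (int n *s v)"
          using elim[rule_format, of k] by (auto simp: eventually_sequentially)
        have "norm (max 0 (m - X n w) - 0) < e" if n: "n \<ge> max 1 N" for n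
        proof -
          have "m - 1 / Suc k \<le> X n w" using N[of n] n by (simp add: X_def pos_le_divide_eq)
          then show ?thesis using k \<open>e > 0\<close> by simp
        qed
        then show "\<exists>N. \<forall>n\<ge>N. norm (max 0 (m - X n w) - 0) < e" by blast
      qed
    qed
    show "AE w in P. norm (max 0 (m - X n w)) \<le> m" for n using Xnn m by (intro AE_I2) auto
  qed auto
  moreover have "(\<lambda>n. mean_time (int n *s v) / n) \<longlonglongrightarrow> m"
    unfolding m_def by (rule limit.lattice_limit[OF multiples_limit])
  ultimately have "(\<lambda>n. mean_time (int n *s v) / n - m + 2 * expectation (\<lambda>w. max 0 (m - X n w))) \<longlonglongrightarrow> m - m + 2 * expectation (\<lambda>_. 0)"
    by (intro tendsto_intros)
  moreover have "expectation (\<lambda>w. \<bar>X n w - m\<bar>) = mean_time (int n *s v) / n - m + 2 * expectation (\<lambda>w. max 0 (m - X n w))" for n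
  proof -
    have mi: "integrable P (\<lambda>w. max 0 (m - X n w))"
      using Xi by (intro Bochner_Integration.integrable_max) auto
    have "expectation (\<lambda>w. \<bar>X n w - m\<bar>) = expectation (\<lambda>w. X n w - m + 2 * max 0 (m - X n w))"
      by (intro Bochner_Integration.integral_cong) (auto simp: max_def)
    also have "\<dots> = expectation (X n) - m + 2 * expectation (\<lambda>w. max 0 (m - X n w))"
      using Xi mi by (simp add: prob_space)
    also have "expectation (X n) = mean_time (int n *s v) / n" by (simp add: X_def[abs_def] mean_time_def)
    finally show ?thesis .
  qed
  ultimately show ?thesis by (simp add: X_def m_def)
qed

lemma stime_difference_L1:
  "expectation (\<lambda>w. \<bar>stime w 0 x - stime w 0 y\<bar>)
    \<le> 2 * (expectation (\<lambda>w. gain w 0) + expectation step_cost * norm1 (x - y))"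
proof -
  have "expectation (\<lambda>w. \<bar>stime w 0 x - stime w 0 y\<bar>) \<le> expectation (\<lambda>w. stime w x y + stime w y x)"
  proof (intro integral_mono Bochner_Integration.integrable_add Bochner_Integration.integrable_abs
      Bochner_Integration.integrable_diff stime_integrable)
    fix w
    show "\<bar>stime w 0 x - stime w 0 y\<bar> \<le> stime w x y + stime w y x"
      using stime_triangle[OF dim, of w 0 y x] stime_triangle[OF dim, of w 0 x y]
        stime_nonneg[OF dim, of w x y] stime_nonneg[OF dim, of w y x] by linarith
  qed
  also have "\<dots> = mean_time (y - x) + mean_time (x - y)"
    using expectation_stime[of x y] expectation_stime[of y x] by (simp add: stime_integrable mean_time_def)
  finally show ?thesis
    using limit.bound[of "y - x"] limit.bound[of "x - y"] by (simp add: norm1_minus_commute[of y])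
qed

text \<open>A general direction is approximated by the rational one \<open>v / K\<close>, and
  \<open>xs n\<close> is compared with the multiple \<open>n div K\<close> of \<open>v\<close>,
  where convergence is known. The remaining error is proportional to the distance between the two
  directions.\<close>

lemma stime_L1:
  fixes \<xi> :: "real ^ 'd"
  assumes xs: "(\<lambda>n. (1 / real n) *\<^sub>R vec_of_int (xs n)) \<longlonglongrightarrow> \<xi>"
  shows "(\<lambda>n. expectation (\<lambda>w. \<bar>stime w 0 (xs n) / n - \<mu> \<xi>\<bar>)) \<longlonglongrightarrow> 0"
proof (rule LIMSEQ_I)
  fix e :: real assume e: "e > 0"
  define C0 C1 where "C0 = expectation (\<lambda>w. gain w 0)" and "C1 = expectation step_cost"
  have C: "0 \<le> C0" "0 \<le> C1" using limit.C by (auto simp: C0_def C1_def)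
  \<comment> \<open>The limiting error is at most \<open>3 * C1\<close> times the distance of the
    directions: twice from moving the end point, once from the Lipschitz bound of the limit
    function. Rounding makes this distance at most \<open>CARD('d) / K\<close>.\<close>
  obtain K :: nat where K: "K > 3 * C1 * CARD('d) / e" using reals_Archimedean2 by blast
  have K0: "K > 0" using K C e by (metis divide_nonneg_pos mult_nonneg_nonneg of_nat_0_le_iff of_nat_0_less_iff order_le_less_trans zero_le_numeral)
  define v where "v = vfloor (real K *\<^sub>R \<xi>)"
  define \<eta> where "\<eta> = (1 / real K) *\<^sub>R vec_of_int v"
  have "\<eta> - \<xi> = (1 / real K) *\<^sub>R (vec_of_int v - real K *\<^sub>R \<xi>)"
    using K0 by (simp add: \<eta>_def scaleR_right_diff_distrib)
  then have "l1 (\<eta> - \<xi>) \<le> CARD('d) / K"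
    using l1_vfloor[of "real K *\<^sub>R \<xi>"] K0 by (simp add: v_def l1_scaleR divide_right_mono)
  then have "3 * C1 * l1 (\<eta> - \<xi>) \<le> 3 * C1 * (CARD('d) / K)" using C by (intro mult_left_mono) auto
  also have "\<dots> < e" using K K0 e by (simp add: field_simps)
  finally have small: "3 * C1 * l1 (\<eta> - \<xi>) < e" .
  define D where "D n = expectation (\<lambda>w. \<bar>stime w 0 (int n *s v) / n - \<mu> (vec_of_int v)\<bar>)" for n
  define j where "j n = n div K" for n
  \<comment> \<open>The error terms in order: the additive constant and the distance for moving the
    end point, the error along multiples of \<open>v\<close>, and the error from replacing
    \<open>1 / K\<close> by \<open>j n / n\<close> and the direction \<xi> by
    \<open>v / K\<close>.\<close>
  define Q where "Q n = 2 * C0 / n + 2 * C1 * l1 ((1 / real n) *\<^sub>R vec_of_int (xs n) - (real (j n) / real n) *\<^sub>R vec_of_int v)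
      + (real (j n) / real n) * D (j n) + \<bar>(real (j n) / real n) * \<mu> (vec_of_int v) - \<mu> \<xi>\<bar>" for n
  have jinf: "filterlim j at_top sequentially"
    unfolding filterlim_at_top
  proof
    fix Z show "\<forall>\<^sub>F n in sequentially. Z \<le> j n"
      using K0 by (intro eventually_sequentiallyI[of "Z * K"]) (simp add: j_def less_eq_div_iff_mult_less_eq)
  qed
  have jK: "real (j n) \<le> real n / K" "real n / K - 1 \<le> real (j n)" for n
  proof -
    have "real n = real (j n) * real K + real (n mod K)"
      unfolding j_def by (metis div_mult_mod_eq of_nat_add of_nat_mult)
    moreover have "real (n mod K) < K" using K0 by simp
    ultimately show "real (j n) \<le> real n / K" "real n / K - 1 \<le> real (j n)"
      using K0 by (simp_all add: field_simps)
  qed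
  have jlim: "(\<lambda>n. real (j n) / real n) \<longlonglongrightarrow> 1 / K"
  proof (rule tendsto_sandwich)
    show "\<forall>\<^sub>F n in sequentially. 1 / K - 1 / real n \<le> real (j n) / real n"
    proof (rule eventually_sequentiallyI[of 1])
      fix n :: nat assume n: "n \<ge> 1"
      have "(real n / K - 1) / n \<le> real (j n) / n" by (intro divide_right_mono jK) auto
      then show "1 / K - 1 / real n \<le> real (j n) / real n" using n by (simp add: diff_divide_distrib)
    qed
    show "\<forall>\<^sub>F n in sequentially. real (j n) / real n \<le> 1 / K"
    proof (rule eventually_sequentiallyI[of 1])
      fix n :: nat assume n: "n \<ge> 1"
      have "real (j n) / n \<le> real n / K / n" by (intro divide_right_mono jK) auto
      then show "real (j n) / real n \<le> 1 / K" using n by simp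
    qed
    have "(\<lambda>n. 1 / K - 1 / real n) \<longlonglongrightarrow> 1 / K - 0" by (intro tendsto_intros lim_const_over_n)
    then show "(\<lambda>n. 1 / K - 1 / real n) \<longlonglongrightarrow> 1 / K" by simp
  qed simp
  have "(\<lambda>n. D (j n)) \<longlonglongrightarrow> 0"
    using filterlim_compose[OF multiples_L1[of v] jinf] by (simp add: D_def)
  then have "Q \<longlonglongrightarrow> 0 + 2 * C1 * l1 (\<xi> - (1 / K) *\<^sub>R vec_of_int v) + (1 / K) * 0 + \<bar>(1 / K) * \<mu> (vec_of_int v) - \<mu> \<xi>\<bar>"
    unfolding Q_def l1_def by (intro tendsto_intros lim_const_over_n jlim xs)
  moreover have "0 + 2 * C1 * l1 (\<xi> - (1 / K) *\<^sub>R vec_of_int v) + (1 / K) * 0 + \<bar>(1 / K) * \<mu> (vec_of_int v) - \<mu> \<xi>\<bar> < e"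
  proof -
    have "l1 (\<xi> - (1 / K) *\<^sub>R vec_of_int v) = l1 (\<eta> - \<xi>)" by (simp add: l1_def \<eta>_def abs_minus_commute)
    moreover have "(1 / K) * \<mu> (vec_of_int v) = \<mu> \<eta>" by (simp add: \<eta>_def limit.limit_homogeneous)
    ultimately show ?thesis using small limit.limit_lipschitz[of \<eta> \<xi>] by (simp add: C1_def)
  qed
  ultimately have "\<forall>\<^sub>F n in sequentially. Q n < e" by (rule order_tendstoD)
  then obtain N where N: "\<And>n. n \<ge> N \<Longrightarrow> Q n < e" by (auto simp: eventually_sequentially)
  have "norm (expectation (\<lambda>w. \<bar>stime w 0 (xs n) / n - \<mu> \<xi>\<bar>) - 0) < e" if n: "n \<ge> max N K" for n
  proof -
    let ?z = "int (j n) *s v"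
    have n0: "n > 0" using n K0 by auto
    have j0: "j n > 0" using n K0 by (simp add: j_def div_greater_zero_iff)
    have "expectation (\<lambda>w. \<bar>stime w 0 (xs n) / n - \<mu> \<xi>\<bar>)
      \<le> expectation (\<lambda>w. \<bar>stime w 0 (xs n) - stime w 0 ?z\<bar> / n
          + ((real (j n) / real n) * \<bar>stime w 0 ?z / j n - \<mu> (vec_of_int v)\<bar>
          + \<bar>(real (j n) / real n) * \<mu> (vec_of_int v) - \<mu> \<xi>\<bar>))"
    proof (rule integral_mono)
      show "integrable P (\<lambda>w. \<bar>stime w 0 (xs n) - stime w 0 ?z\<bar> / n
          + ((real (j n) / real n) * \<bar>stime w 0 ?z / j n - \<mu> (vec_of_int v)\<bar>
          + \<bar>(real (j n) / real n) * \<mu> (vec_of_int v) - \<mu> \<xi>\<bar>))"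
        by (intro Bochner_Integration.integrable_add integrable_divide integrable_mult_right
            Bochner_Integration.integrable_abs Bochner_Integration.integrable_diff stime_integrable) auto
      fix w
      have "stime w 0 (xs n) / n - \<mu> \<xi> = (stime w 0 (xs n) - stime w 0 ?z) / n
          + ((real (j n) / real n) * (stime w 0 ?z / j n - \<mu> (vec_of_int v))
          + ((real (j n) / real n) * \<mu> (vec_of_int v) - \<mu> \<xi>))"
        using n0 j0 by (simp add: field_simps)
      also have "\<bar>\<dots>\<bar> \<le> \<bar>(stime w 0 (xs n) - stime w 0 ?z) / n\<bar>
          + (\<bar>(real (j n) / real n) * (stime w 0 ?z / j n - \<mu> (vec_of_int v))\<bar>
          + \<bar>(real (j n) / real n) * \<mu> (vec_of_int v) - \<mu> \<xi>\<bar>)"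
        by (rule order_trans[OF abs_triangle_ineq add_left_mono[OF abs_triangle_ineq]])
      finally show "\<bar>stime w 0 (xs n) / n - \<mu> \<xi>\<bar> \<le> \<bar>stime w 0 (xs n) - stime w 0 ?z\<bar> / n
          + ((real (j n) / real n) * \<bar>stime w 0 ?z / j n - \<mu> (vec_of_int v)\<bar>
          + \<bar>(real (j n) / real n) * \<mu> (vec_of_int v) - \<mu> \<xi>\<bar>)"
        by (simp add: abs_mult)
    qed (rule integrable_abs_diff)
    also have "\<dots> = expectation (\<lambda>w. \<bar>stime w 0 (xs n) - stime w 0 ?z\<bar>) / n
          + ((real (j n) / real n) * D (j n) + \<bar>(real (j n) / real n) * \<mu> (vec_of_int v) - \<mu> \<xi>\<bar>)"
      using integrable_abs_diff[of 0 ?z "j n" "\<mu> (vec_of_int v)"] stime_integrable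
      by (simp add: D_def prob_space)
    also have "expectation (\<lambda>w. \<bar>stime w 0 (xs n) - stime w 0 ?z\<bar>) / n \<le> 2 * (C0 + C1 * norm1 (xs n - ?z)) / n"
      unfolding C0_def C1_def by (intro divide_right_mono stime_difference_L1) simp
    also have "2 * (C0 + C1 * norm1 (xs n - ?z)) / n = 2 * C0 / n + 2 * C1 * (norm1 (xs n - ?z) / n)"
      by (simp add: add_divide_distrib)
    also have "norm1 (xs n - ?z) / n = l1 ((1 / real n) *\<^sub>R vec_of_int (xs n) - (real (j n) / real n) *\<^sub>R vec_of_int v)"
    proof -
      have "(1 / real n) *\<^sub>R vec_of_int (xs n) - (real (j n) / real n) *\<^sub>R vec_of_int v = (1 / real n) *\<^sub>R vec_of_int (xs n - ?z)"
        by (simp add: vec_of_int_diff vec_of_int_smult scaleR_right_diff_distrib)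
      then show ?thesis by (simp add: l1_scaleR l1_vec_of_int)
    qed
    finally have "expectation (\<lambda>w. \<bar>stime w 0 (xs n) / n - \<mu> \<xi>\<bar>) \<le> Q n" by (simp add: Q_def)
    moreover have "0 \<le> expectation (\<lambda>w. \<bar>stime w 0 (xs n) / n - \<mu> \<xi>\<bar>)" by (intro integral_nonneg_AE) simp
    ultimately show ?thesis using N[of n] n by simp
  qed
  then show "\<exists>N. \<forall>n\<ge>N. norm (expectation (\<lambda>w. \<bar>stime w 0 (xs n) / n - \<mu> \<xi>\<bar>) - 0) < e" by blast
qed

text \<open>The two times differ by the gain at the end point; by stationarity its mean does not
  depend on the end point and disappears after division by \<open>n\<close>.\<close>

theorem rtime_L1:
  fixes \<xi> :: "real ^ 'd"
  assumes xs: "(\<lambda>n. (1 / real n) *\<^sub>R vec_of_int (xs n)) \<longlonglongrightarrow> \<xi>"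
  shows "(\<lambda>n. expectation (\<lambda>w. \<bar>rtime w 0 (xs n) / n - \<mu> \<xi>\<bar>)) \<longlonglongrightarrow> 0"
proof (rule tendsto_sandwich)
  show "(\<lambda>_. 0) \<longlonglongrightarrow> 0" by simp
  have "(\<lambda>n. expectation (\<lambda>w. \<bar>stime w 0 (xs n) / n - \<mu> \<xi>\<bar>) + expectation (\<lambda>w. gain w 0) / n) \<longlonglongrightarrow> 0 + 0"
    by (intro tendsto_add stime_L1[OF xs] lim_const_over_n)
  then show "(\<lambda>n. expectation (\<lambda>w. \<bar>stime w 0 (xs n) / n - \<mu> \<xi>\<bar>) + expectation (\<lambda>w. gain w 0) / n) \<longlonglongrightarrow> 0" by simp
  show "\<forall>\<^sub>F n in sequentially. expectation (\<lambda>w. \<bar>rtime w 0 (xs n) / n - \<mu> \<xi>\<bar>)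
     \<le> expectation (\<lambda>w. \<bar>stime w 0 (xs n) / n - \<mu> \<xi>\<bar>) + expectation (\<lambda>w. gain w 0) / n"
  proof (rule always_eventually, rule allI)
    fix n
    have ig: "integrable P (\<lambda>w. gain w (xs n) / n)" using gain_integrable by auto
    have "expectation (\<lambda>w. \<bar>rtime w 0 (xs n) / n - \<mu> \<xi>\<bar>) \<le> expectation (\<lambda>w. \<bar>stime w 0 (xs n) / n - \<mu> \<xi>\<bar> + gain w (xs n) / n)"
    proof (rule integral_mono_AE)
      show "AE w in P. \<bar>rtime w 0 (xs n) / n - \<mu> \<xi>\<bar> \<le> \<bar>stime w 0 (xs n) / n - \<mu> \<xi>\<bar> + gain w (xs n) / n"
        using AE_rtime_eq
      proof eventually_elim
        case (elim w)
        have "rtime w 0 (xs n) / n - \<mu> \<xi> = (stime w 0 (xs n) / n - \<mu> \<xi>) - gain w (xs n) / n"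
          using elim by (simp add: diff_divide_distrib)
        moreover have "0 \<le> gain w (xs n) / n" using gain_nonneg[of w "xs n"] by simp
        ultimately show ?case by linarith
      qed
      show "integrable P (\<lambda>w. \<bar>rtime w 0 (xs n) / n - \<mu> \<xi>\<bar>)"
        using rtime_integrable by (intro Bochner_Integration.integrable_abs Bochner_Integration.integrable_diff) auto
    qed (intro Bochner_Integration.integrable_add integrable_abs_diff ig)
    also have "\<dots> = expectation (\<lambda>w. \<bar>stime w 0 (xs n) / n - \<mu> \<xi>\<bar>) + expectation (\<lambda>w. gain w (xs n)) / n"
      using integrable_abs_diff ig by simp
    also have "expectation (\<lambda>w. gain w (xs n)) = expectation (\<lambda>w. gain w 0)"
      unfolding gain_shift[of _ "xs n"] by (rule integral_shift) simp
    finally show "expectation (\<lambda>w. \<bar>rtime w 0 (xs n) / n - \<mu> \<xi>\<bar>)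
     \<le> expectation (\<lambda>w. \<bar>stime w 0 (xs n) / n - \<mu> \<xi>\<bar>) + expectation (\<lambda>w. gain w 0) / n" .
  qed
qed (intro always_eventually allI integral_nonneg_AE, simp)

end

subsection \<open>A Borel--Cantelli lemma on the lattice\<close>

lemma finite_norm1_ball: "finite {x :: int ^ 'd. norm1 x \<le> r}"
  and card_norm1_ball: "0 \<le> r \<Longrightarrow> card {x :: int ^ 'd. norm1 x \<le> r} \<le> nat (2 * r + 1) ^ CARD('d)"
proof -
  let ?B = "{x :: int ^ 'd. norm1 x \<le> r}" and ?F = "PiE (UNIV :: 'd set) (\<lambda>_. {-r..r})"
  have sub: "?B \<subseteq> vec_lambda ` ?F"
  proof
    fix x :: "int ^ 'd" assume "x \<in> ?B"
    then have "\<bar>x $ i\<bar> \<le> r" for i using component_le_norm1[of x i] by simp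
    then have "(\<lambda>i. x $ i) \<in> ?F" by (auto simp: abs_le_iff PiE_iff) (metis minus_le_iff)
    then show "x \<in> vec_lambda ` ?F" by (intro image_eqI[of _ _ "\<lambda>i. x $ i"]) simp_all
  qed
  have F: "finite ?F" by (intro finite_PiE) auto
  show "finite ?B" using finite_subset[OF sub] F by simp
  assume "0 \<le> r"
  have "card ?B \<le> card (vec_lambda ` ?F)" using F by (intro card_mono sub) auto
  also have "\<dots> \<le> card ?F" using F by (rule card_image_le)
  also have "\<dots> = nat (2 * r + 1) ^ CARD('d)" by (simp add: card_PiE)
  finally show "card ?B \<le> nat (2 * r + 1) ^ CARD('d)" .
qed

lemma geometric_sum_le:
  fixes q :: real assumes "q \<ge> 2" shows "(\<Sum>k\<le>n. q ^ k) \<le> 2 * q ^ n"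
proof (induction n)
  case (Suc n)
  have "2 * q ^ n \<le> q * q ^ n" using assms by (intro mult_right_mono) auto
  then show ?case using Suc by simp
qed simp

text \<open>The sum is geometric with ratio at least 2 and so at most twice its last nonzero term,
  whose index satisfies \<open>2 ^ k < y\<close>.\<close>

lemma dyadic_sum_le:
  fixes y :: real assumes "d \<ge> 1" "0 \<le> y"
  shows "(\<Sum>k<n. (2 ^ d) ^ k * of_bool (2 ^ k < y)) \<le> 2 * y ^ d"
proof (induction n)
  case 0 then show ?case using assms by simp
next
  case (Suc n)
  show ?case
  proof (cases "2 ^ n < y")
    case True
    have "(2 :: real) \<le> 2 ^ d" using assms(1) self_le_power[of "2 :: real" d] by simp
    have "(\<Sum>k<Suc n. (2 ^ d) ^ k * of_bool (2 ^ k < y)) \<le> (\<Sum>k\<le>n. ((2 :: real) ^ d) ^ k)"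
      unfolding lessThan_Suc_atMost by (intro sum_mono) auto
    also have "\<dots> \<le> 2 * (2 ^ d) ^ n" using \<open>2 \<le> 2 ^ d\<close> by (rule geometric_sum_le)
    also have "\<dots> = 2 * (2 ^ n) ^ d" by (simp add: power_mult[symmetric] mult.commute)
    also have "\<dots> \<le> 2 * y ^ d" using True by (intro mult_left_mono power_mono) auto
    finally show ?thesis .
  next
    case False then show ?thesis using Suc by simp
  qed
qed

context prob_space
begin

text \<open>Group the lattice into dyadic shells with O(\<open>2^(d k)\<close>) points. Summed over
  shells, the first part of the bound is controlled by the \<open>d\<close>-th moment of
  \<open>Y\<close> through \<open>dyadic_sum_le\<close>; the second is geometric because its
  exponent exceeds \<open>d\<close> by one.\<close>

lemma lattice_borel_cantelli:
  fixes G :: "int ^ 'd \<Rightarrow> 'a set" and Y :: "'a \<Rightarrow> real"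
  assumes G: "\<And>x. G x \<in> events"
    and Y: "Y \<in> borel_measurable M" "\<And>\<omega>. 0 \<le> Y \<omega>" "integrable M (\<lambda>\<omega>. Y \<omega> ^ CARD('d))"
    and c: "0 < c" "0 \<le> K" "0 \<le> K'"
    and bound: "\<And>x k. 2 ^ k \<le> norm1 x \<Longrightarrow> norm1 x < 2 ^ Suc k \<Longrightarrow>
      prob (G x) \<le> K * prob {\<omega> \<in> space M. c * 2 ^ k < Y \<omega>} + K' / (2 ^ k) ^ (CARD('d) + 1)"
  shows "AE \<omega> in M. \<exists>R. \<forall>x. R \<le> norm1 x \<longrightarrow> \<omega> \<notin> G x"
proof -
  let ?d = "CARD('d)"
  have [measurable]: "Y \<in> borel_measurable M" by (rule Y)
  define I where "I k = {x :: int ^ 'd. 2 ^ k \<le> norm1 x \<and> norm1 x < 2 ^ Suc k}" for k :: nat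
  define p where "p k = prob {\<omega> \<in> space M. c * 2 ^ k < Y \<omega>}" for k :: nat
  define F where "F k = (\<Union>x\<in>I k. G x)" for k
  have Ifin: "finite (I k)" for k
    by (rule finite_subset[OF _ finite_norm1_ball[of "2 ^ Suc k"]]) (auto simp: I_def)
  have Icard: "real (card (I k)) \<le> 5 ^ ?d * (2 ^ ?d) ^ k" for k
  proof -
    have "card (I k) \<le> card {x :: int ^ 'd. norm1 x \<le> 2 ^ Suc k}"
      by (intro card_mono finite_norm1_ball) (auto simp: I_def)
    also have "\<dots> \<le> nat (2 * 2 ^ Suc k + 1) ^ ?d" by (intro card_norm1_ball) simp
    also have "nat (2 * 2 ^ Suc k + 1) \<le> 5 * 2 ^ k"
    proof -
      have "(1 :: int) \<le> 2 ^ k" by simp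
      then have "(2 * 2 ^ Suc k + 1 :: int) \<le> int (5 * 2 ^ k)" by simp
      then show ?thesis by (simp add: nat_le_iff)
    qed
    then have "nat (2 * 2 ^ Suc k + 1) ^ ?d \<le> (5 * 2 ^ k) ^ ?d" by (intro power_mono) auto
    finally have "real (card (I k)) \<le> real ((5 * 2 ^ k) ^ ?d)" by (simp only: of_nat_le_iff)
    also have "\<dots> = 5 ^ ?d * (2 ^ ?d) ^ k" by (simp add: power_mult_distrib power_mult[symmetric] mult.commute)
    finally show ?thesis .
  qed
  have FM: "F k \<in> events" for k unfolding F_def using G Ifin by auto
  have Fle: "prob (F k) \<le> 5 ^ ?d * K * ((2 ^ ?d) ^ k * p k) + 5 ^ ?d * K' * (1 / 2) ^ k" for k
  proof -
    have "prob (F k) \<le> (\<Sum>x\<in>I k. prob (G x))"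
      unfolding F_def using G Ifin by (intro finite_measure_subadditive_finite) auto
    also have "\<dots> \<le> (\<Sum>x\<in>I k. K * p k + K' / (2 ^ k) ^ (?d + 1))"
      using bound by (intro sum_mono) (auto simp: I_def p_def)
    also have "\<dots> = real (card (I k)) * (K * p k + K' / (2 ^ k) ^ (?d + 1))" by simp
    also have "\<dots> \<le> (5 ^ ?d * (2 ^ ?d) ^ k) * (K * p k + K' / (2 ^ k) ^ (?d + 1))"
      using c by (intro mult_right_mono Icard) (auto simp: p_def)
    also have "\<dots> = 5 ^ ?d * K * ((2 ^ ?d) ^ k * p k) + 5 ^ ?d * K' * ((2 ^ ?d) ^ k / (2 ^ k) ^ (?d + 1))"
      by (simp add: algebra_simps)
    also have "((2 :: real) ^ ?d) ^ k / (2 ^ k) ^ (?d + 1) = (1 / 2) ^ k"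
      by (simp add: power_mult[symmetric] mult.commute power_one_over divide_simps flip: power_add)
    finally show ?thesis .
  qed
  have "summable (\<lambda>k. (2 ^ ?d) ^ k * p k)"
  proof (rule bounded_imp_summable)
    show "0 \<le> (2 ^ ?d) ^ k * p k" for k by (simp add: p_def)
    fix n
    let ?f = "\<lambda>k \<omega>. (2 ^ ?d) ^ k * of_bool (2 ^ k < Y \<omega> / c) :: real"
    have fi: "integrable M (?f k)" for k
      by (intro integrable_mult_right integrable_const_bound[where B = 1]) auto
    have pe: "p k = expectation (\<lambda>\<omega>. of_bool (2 ^ k < Y \<omega> / c))" for k
    proof -
      have "p k = expectation (indicator {\<omega> \<in> space M. c * 2 ^ k < Y \<omega>})" by (simp add: p_def Int_absorb2)
      also have "\<dots> = expectation (\<lambda>\<omega>. of_bool (2 ^ k < Y \<omega> / c))"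
        using c by (intro Bochner_Integration.integral_cong) (auto simp: indicator_def field_simps)
      finally show ?thesis .
    qed
    have "(\<Sum>k<Suc n. (2 ^ ?d) ^ k * p k) = expectation (\<lambda>\<omega>. \<Sum>k<Suc n. ?f k \<omega>)"
      using fi by (subst Bochner_Integration.integral_sum) (auto simp: pe)
    also have "\<dots> \<le> expectation (\<lambda>\<omega>. 2 / c ^ ?d * Y \<omega> ^ ?d)"
    proof (rule integral_mono)
      show "(\<Sum>k<Suc n. ?f k \<omega>) \<le> 2 / c ^ ?d * Y \<omega> ^ ?d" for \<omega>
        using dyadic_sum_le[of ?d "Y \<omega> / c" "Suc n"] c Y(2)[of \<omega>] by (simp add: power_divide)
    next
      show "integrable M (\<lambda>\<omega>. \<Sum>k<Suc n. ?f k \<omega>)" by (rule Bochner_Integration.integrable_sum) (rule fi)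
    qed (use Y(3) in auto)
    finally show "(\<Sum>k\<le>n. (2 ^ ?d) ^ k * p k) \<le> expectation (\<lambda>\<omega>. 2 / c ^ ?d * Y \<omega> ^ ?d)"
      by (simp only: lessThan_Suc_atMost)
  qed
  then have "summable (\<lambda>k. 5 ^ ?d * K * ((2 ^ ?d) ^ k * p k) + 5 ^ ?d * K' * (1 / 2) ^ k)"
    by (intro summable_add summable_mult summable_geometric) auto
  then have "summable (\<lambda>k. prob (F k))"
    using Fle by (rule_tac summable_comparison_test') auto
  then have "AE \<omega> in M. \<forall>\<^sub>F k in sequentially. \<omega> \<in> space M - F k"
    using FM by (intro borel_cantelli_AE1) (auto simp: emeasure_eq_measure)
  then show ?thesis
  proof eventually_elim
    case (elim \<omega>)
    then obtain k0 where k0: "\<And>k. k \<ge> k0 \<Longrightarrow> \<omega> \<notin> F k" by (auto simp: eventually_sequentially)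
    show ?case
    proof (intro exI[of _ "2 ^ k0"] allI impI)
      fix x :: "int ^ 'd" assume x: "2 ^ k0 \<le> norm1 x"
      have "(1 :: int) \<le> 2 ^ k0" by simp
      then have "1 \<le> nat (norm1 x)" using x by linarith
      then obtain k where k: "2 ^ k \<le> nat (norm1 x)" "nat (norm1 x) < 2 ^ (k + 1)"
        using ex_power_ivl1[of 2 "nat (norm1 x)"] by auto
      have k': "2 ^ k \<le> norm1 x" "norm1 x < 2 ^ Suc k"
      proof -
        have "int (2 ^ k) \<le> int (nat (norm1 x))" "int (nat (norm1 x)) < int (2 ^ (k + 1))"
          using k by (simp_all only: of_nat_le_iff of_nat_less_iff)
        then show "2 ^ k \<le> norm1 x" "norm1 x < 2 ^ Suc k" by simp_all
      qed
      have "k0 \<le> k"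
      proof (rule ccontr)
        assume "\<not> k0 \<le> k"
        then have "(2 :: int) ^ Suc k \<le> 2 ^ k0" by (intro power_increasing) auto
        then show False using x k' by linarith
      qed
      then have "\<omega> \<notin> F k" by (rule k0)
      then show "\<omega> \<notin> G x" using k' by (auto simp: F_def I_def)
    qed
  qed
qed

end

subsection \<open>Tails of passage times\<close>

locale first_passage_moments = first_passage N P for N and P :: "('d::finite) config measure" +
  assumes min_power_integrable: "integrable P (\<lambda>w. Min ((\<lambda>u. max 0 (w {0, u})) ` units) ^ CARD('d))"
    and gain_power_finite: "(\<integral>\<^sup>+w. e2ennreal (loop_gain w 0) ^ CARD('d) \<partial>P) < \<infinity>"
begin

text \<open>Since \<open>d \<ge> 2\<close>, a square is at most 1 plus the \<open>d\<close>-th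
  power; this makes Chebyshev's inequality available for corridors.\<close>

lemma step_cost_square_integrable: "integrable P (\<lambda>w. step_cost w ^ 2)"
proof (rule Bochner_Integration.integrable_bound)
  show "integrable P (\<lambda>w. 1 + step_cost w ^ CARD('d))"
    using step_cost_power_integrable[OF min_power_integrable] by simp
  show "AE w in P. norm (step_cost w ^ 2) \<le> norm (1 + step_cost w ^ CARD('d))"
  proof (rule AE_I2)
    fix w :: "'d config"
    have "step_cost w ^ 2 \<le> 1 + step_cost w ^ CARD('d)"
    proof (cases "step_cost w \<le> 1")
      case True
      then have "step_cost w ^ 2 \<le> 1" by (intro power_le_one) auto
      moreover have "0 \<le> step_cost w ^ CARD('d)" by simp
      ultimately show ?thesis by linarith
    next
      case False
      then have "step_cost w ^ 2 \<le> step_cost w ^ CARD('d)" using dim by (intro power_increasing) auto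
      then show ?thesis by linarith
    qed
    then show "norm (step_cost w ^ 2) \<le> norm (1 + step_cost w ^ CARD('d))" by simp
  qed
qed simp

definition centred :: "int ^ 'd \<Rightarrow> 'd config \<Rightarrow> real" where
  "centred x w = step_cost (shift x w) - expectation step_cost"

lemma centred_measurable [measurable]: "centred x \<in> borel_measurable P"
  unfolding centred_def[abs_def] by measurable

lemma centred_integrable: "integrable P (centred x)"
  unfolding centred_def[abs_def] using step_cost_integrable by auto

lemma expectation_centred: "expectation (centred x) = 0"
  unfolding centred_def[abs_def] using step_cost_integrable by (simp add: integral_shift prob_space)

definition step_variance :: real where
  "step_variance = expectation (\<lambda>w. centred 0 w ^ 2)"

lemma centred_square_integrable: "integrable P (\<lambda>w. centred x w ^ 2)"
  and expectation_centred_square: "expectation (\<lambda>w. centred x w ^ 2) = step_variance"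
proof -
  let ?h = "expectation step_cost"
  have "integrable P (\<lambda>w. step_cost w ^ 2 - 2 * ?h * step_cost w + ?h ^ 2)"
    using step_cost_square_integrable step_cost_power_integrable[of 1] min_integrable by auto
  moreover have "step_cost w ^ 2 - 2 * ?h * step_cost w + ?h ^ 2 = (step_cost w - ?h) ^ 2" for w :: "'d config"
    by (simp add: power2_eq_square algebra_simps)
  ultimately have i: "integrable P (\<lambda>w. (step_cost w - ?h) ^ 2)" by simp
  show "integrable P (\<lambda>w. centred x w ^ 2)"
    unfolding centred_def using integrable_shift[OF i] .
  show "expectation (\<lambda>w. centred x w ^ 2) = step_variance"
    unfolding step_variance_def centred_def
    using integral_shift[of "\<lambda>w. (step_cost w - ?h) ^ 2"] by simp
qed

lemma step_variance_nonneg: "0 \<le> step_variance"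
  unfolding step_variance_def by (intro integral_nonneg_AE) simp

lemma centred_product_integrable: "integrable P (\<lambda>w. centred x w * centred y w)"
  and expectation_centred_product_le: "expectation (\<lambda>w. centred x w * centred y w) \<le> step_variance"
proof -
  have i: "integrable P (\<lambda>w. (centred x w ^ 2 + centred y w ^ 2) / 2)"
    using centred_square_integrable by auto
  have le: "\<bar>a * b\<bar> \<le> (a ^ 2 + b ^ 2) / 2" for a b :: real
  proof -
    have "0 \<le> (\<bar>a\<bar> - \<bar>b\<bar>) ^ 2" by simp
    then show ?thesis by (simp add: power2_eq_square algebra_simps abs_mult)
  qed
  show p: "integrable P (\<lambda>w. centred x w * centred y w)"
    by (rule Bochner_Integration.integrable_bound[OF i]) (use le in auto)
  have "expectation (\<lambda>w. centred x w * centred y w) \<le> expectation (\<lambda>w. (centred x w ^ 2 + centred y w ^ 2) / 2)"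
  proof (rule integral_mono[OF p i])
    fix w show "centred x w * centred y w \<le> (centred x w ^ 2 + centred y w ^ 2) / 2"
      using le[of "centred x w" "centred y w"] by (simp add: abs_le_iff)
  qed
  also have "\<dots> = step_variance"
    using centred_square_integrable expectation_centred_square by simp
  finally show "expectation (\<lambda>w. centred x w * centred y w) \<le> step_variance" .
qed

definition separated :: "int \<Rightarrow> bool" where
  "separated R \<longleftrightarrow> 0 \<le> R \<and>
    (\<forall>x y :: int ^ 'd. norm1 (x - y) > R \<longrightarrow> (`) ((+) x) ` step_support \<inter> (`) ((+) y) ` step_support = {})"

lemma separated_exists: obtains R where "separated R"
proof -
  obtain R where R: "\<And>x y :: int ^ 'd. norm1 (x - y) > R \<Longrightarrow> (`) ((+) x) ` step_support \<inter> (`) ((+) y) ` step_support = {}"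
    using far_translates_disjoint[OF step_support] by blast
  then have "separated (max 0 R)" by (auto simp: separated_def)
  then show ?thesis by (rule that)
qed

lemma translate_step_support: "(`) ((+) x) ` step_support \<subseteq> lattice_edges"
  using step_support(2) image_edge_in_lattice by blast

lemma centred_uncorrelated:
  assumes "separated R" "norm1 (x - y) > R"
  shows "expectation (\<lambda>w. centred x w * centred y w) = 0"
proof -
  define z where "z b = (if b then x else y)" for b
  have "indep_vars (\<lambda>_. borel) (\<lambda>b. centred (z b)) UNIV"
  proof (rule indep_local[where F = "\<lambda>b. (`) ((+) (z b)) ` step_support"])
    have d: "(`) ((+) x) ` step_support \<inter> (`) ((+) y) ` step_support = {}"
      using assms by (auto simp: separated_def)
    show "disjoint_family_on (\<lambda>b. (`) ((+) (z b)) ` step_support) UNIV"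
      unfolding disjoint_family_on_def
    proof (intro ballI impI)
      fix b b' :: bool assume "b \<noteq> b'"
      then show "(`) ((+) (z b)) ` step_support \<inter> (`) ((+) (z b')) ` step_support = {}"
        using d by (cases b; cases b') (simp_all add: z_def Int_commute)
    qed
    show "centred (z b) w = centred (z b) w'"
      if "\<And>e. e \<in> (`) ((+) (z b)) ` step_support \<Longrightarrow> w e = w' e" for b w w'
      unfolding centred_def using step_cost_shift_local[of "z b" w w'] that by simp
  qed (use translate_step_support in auto)
  then have "expectation (\<lambda>w. \<Prod>b\<in>UNIV. centred (z b) w) = (\<Prod>b\<in>UNIV. expectation (centred (z b)))"
    by (intro indep_vars_lebesgue_integral centred_integrable) auto
  then show ?thesis by (simp add: UNIV_bool z_def expectation_centred mult.commute)
qed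

text \<open>Along a geodesic, index differences are distances, so each term is correlated with at
  most \<open>2 * R + 1\<close> terms; the variance grows linearly in the length.\<close>

lemma corridor_variance:
  fixes n :: nat and x :: "nat \<Rightarrow> int ^ 'd"
  assumes R: "separated R"
    and x: "\<And>i j. i < n \<Longrightarrow> j < n \<Longrightarrow> norm1 (x i - x j) = \<bar>int i - int j\<bar>"
  shows "integrable P (\<lambda>w. (\<Sum>i<n. centred (x i) w) ^ 2)"
    and "expectation (\<lambda>w. (\<Sum>i<n. centred (x i) w) ^ 2) \<le> n * (real_of_int (2 * R + 1) * step_variance)"
proof -
  have eq: "(\<Sum>i<n. centred (x i) w) ^ 2 = (\<Sum>i<n. \<Sum>j<n. centred (x i) w * centred (x j) w)" for w
    by (simp add: power2_eq_square sum_product)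
  show "integrable P (\<lambda>w. (\<Sum>i<n. centred (x i) w) ^ 2)"
    unfolding eq using centred_product_integrable by auto
  have "expectation (\<lambda>w. (\<Sum>i<n. centred (x i) w) ^ 2)
      = (\<Sum>i<n. \<Sum>j<n. expectation (\<lambda>w. centred (x i) w * centred (x j) w))"
    unfolding eq using centred_product_integrable by simp
  also have "\<dots> \<le> (\<Sum>i<n. real_of_int (2 * R + 1) * step_variance)"
  proof (rule sum_mono)
    fix i assume i: "i \<in> {..<n}"
    define near where "near = {j \<in> {..<n}. \<bar>int i - int j\<bar> \<le> R}"
    have "(\<Sum>j<n. expectation (\<lambda>w. centred (x i) w * centred (x j) w))
        \<le> (\<Sum>j<n. if j \<in> near then step_variance else 0)"
    proof (rule sum_mono)
      fix j assume j: "j \<in> {..<n}"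
      show "expectation (\<lambda>w. centred (x i) w * centred (x j) w) \<le> (if j \<in> near then step_variance else 0)"
        using expectation_centred_product_le[of "x i" "x j"] centred_uncorrelated[OF R, of "x i" "x j"] x[of i j] i j
        by (auto simp: near_def)
    qed
    also have "\<dots> = real (card near) * step_variance"
      by (subst sum.If_cases) (auto simp: near_def Int_def)
    also have "real (card near) \<le> real_of_int (2 * R + 1)"
    proof -
      have "card near = card (int ` near)" by (simp add: card_image)
      also have "\<dots> \<le> card {int i - R..int i + R}" by (intro card_mono) (auto simp: near_def)
      also have "\<dots> = nat (2 * R + 1)" by simp
      finally have "int (card near) \<le> 2 * R + 1" using R unfolding separated_def by linarith
      then show ?thesis by (metis of_int_le_iff of_int_of_nat_eq)
    qed
    finally show "(\<Sum>j<n. expectation (\<lambda>w. centred (x i) w * centred (x j) w)) \<le> real_of_int (2 * R + 1) * step_variance"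
      using step_variance_nonneg by (simp add: mult_right_mono)
  qed
  finally show "expectation (\<lambda>w. (\<Sum>i<n. centred (x i) w) ^ 2) \<le> n * (real_of_int (2 * R + 1) * step_variance)" by simp
qed

text \<open>The mean of the sum is at most \<open>expectation step_cost * r\<close>, so the event
  forces a deviation of at least \<open>r\<close>; Chebyshev's inequality with a variance of order
  \<open>r\<close> gives order \<open>1 / r\<close>.\<close>

lemma corridor_tail:
  fixes n :: nat and x :: "nat \<Rightarrow> int ^ 'd"
  assumes R: "separated R"
    and x: "\<And>i j. i < n \<Longrightarrow> j < n \<Longrightarrow> norm1 (x i - x j) = \<bar>int i - int j\<bar>"
    and r: "real n \<le> r" "1 \<le> r"
  shows "prob {w \<in> space P. (expectation step_cost + 1) * r < (\<Sum>i<n. step_cost (shift (x i) w))}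
    \<le> real_of_int (2 * R + 1) * step_variance / r"
proof -
  let ?h = "expectation step_cost"
  define Z where "Z w = (\<Sum>i<n. centred (x i) w)" for w
  have h: "0 \<le> ?h" by (intro integral_nonneg_AE AE_I2 step_cost_nonneg)
  have Z: "(\<Sum>i<n. step_cost (shift (x i) w)) = Z w + n * ?h" for w
    by (simp add: Z_def centred_def sum_subtractf)
  have [measurable]: "Z \<in> borel_measurable P" unfolding Z_def[abs_def] by measurable
  have "prob {w \<in> space P. (?h + 1) * r < (\<Sum>i<n. step_cost (shift (x i) w))}
      \<le> prob {w \<in> space P. r ^ 2 \<le> Z w ^ 2}"
  proof (intro finite_measure_mono subsetI)
    fix w assume "w \<in> {w \<in> space P. (?h + 1) * r < (\<Sum>i<n. step_cost (shift (x i) w))}"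
    then have w: "w \<in> space P" "(?h + 1) * r < Z w + n * ?h" by (auto simp: Z)
    have "n * ?h \<le> r * ?h" using r h by (intro mult_right_mono)
    then have "r \<le> Z w" using w(2) by (simp add: algebra_simps)
    then have "r ^ 2 \<le> Z w ^ 2" using r by (intro power_mono) auto
    then show "w \<in> {w \<in> space P. r ^ 2 \<le> Z w ^ 2}" using w by simp
  qed simp
  also have "\<dots> \<le> expectation (\<lambda>w. Z w ^ 2) / r ^ 2"
    using r corridor_variance(1)[OF R x] by (intro integral_Markov_inequality_measure[where A = "{}"]) (auto simp: Z_def)
  also have "\<dots> \<le> n * (real_of_int (2 * R + 1) * step_variance) / r ^ 2"
    using corridor_variance(2)[OF R x] by (intro divide_right_mono) (auto simp: Z_def)
  also have "\<dots> \<le> r * (real_of_int (2 * R + 1) * step_variance) / r ^ 2"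
    using r R step_variance_nonneg by (intro divide_right_mono mult_right_mono) (auto simp: separated_def)
  also have "\<dots> = real_of_int (2 * R + 1) * step_variance / r" using r by (simp add: power2_eq_square)
  finally show ?thesis .
qed

text \<open>The offsets move forward along axis \<open>k\<close> and backward along axis
  \<open>l\<close>, relative to the signs of the path. The difference of two path points has the
  same sign in both signed coordinates, so in one of the two it reinforces the offset instead of
  cancelling it.\<close>

lemma offsets_separated:
  fixes \<gamma> :: "nat \<Rightarrow> int ^ 'd"
  assumes \<gamma>: "monotone_path \<sigma> n \<gamma>" and kl: "k \<noteq> l" and L: "0 \<le> L" "a \<noteq> b" and ij: "i \<le> n" "j \<le> n"
  shows "norm1 ((axis k (int a * L * \<sigma> k) - axis l (int a * L * \<sigma> l) + \<gamma> i)
    - (axis k (int b * L * \<sigma> k) - axis l (int b * L * \<sigma> l) + \<gamma> j)) \<ge> L"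
proof -
  define D where "D = (axis k (int a * L * \<sigma> k) - axis l (int a * L * \<sigma> l) + \<gamma> i)
    - (axis k (int b * L * \<sigma> k) - axis l (int b * L * \<sigma> l) + \<gamma> j)"
  define m where "m = (int a - int b) * L"
  have \<sigma>: "\<bar>\<sigma> i\<bar> = 1" for i using \<gamma> by (auto simp: monotone_path_def)
  then have ss: "\<sigma> i * \<sigma> i = 1" for i by (metis abs_mult_self_eq mult_1)
  have Dk: "\<sigma> k * D $ k = m + \<sigma> k * (\<gamma> i - \<gamma> j) $ k"
    using kl ss[of k] by (simp add: D_def axis_def m_def algebra_simps)
  have Dl: "\<sigma> l * D $ l = - m + \<sigma> l * (\<gamma> i - \<gamma> j) $ l"
    using kl ss[of l] by (simp add: D_def axis_def m_def algebra_simps)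
  have m: "L \<le> \<bar>m\<bar>"
  proof -
    have "1 \<le> \<bar>int a - int b\<bar>" using L(2) by linarith
    then have "1 * L \<le> \<bar>int a - int b\<bar> * L" using L(1) by (rule mult_right_mono)
    then show ?thesis using L(1) by (simp add: m_def abs_mult)
  qed
  have comp: "\<bar>\<sigma> i * D $ i\<bar> \<le> norm1 D" for i
    using component_le_norm1[of D i] \<sigma>[of i] by (simp add: abs_mult)
  have "(0 \<le> \<sigma> k * (\<gamma> i - \<gamma> j) $ k \<and> 0 \<le> \<sigma> l * (\<gamma> i - \<gamma> j) $ l) \<or>
        (\<sigma> k * (\<gamma> i - \<gamma> j) $ k \<le> 0 \<and> \<sigma> l * (\<gamma> i - \<gamma> j) $ l \<le> 0)"
  proof (cases "j \<le> i")
    case True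
    then show ?thesis using monotone_path_increasing(1)[OF \<gamma> True ij(1)] by blast
  next
    case False
    then have "0 \<le> \<sigma> q * (\<gamma> j - \<gamma> i) $ q" for q using monotone_path_increasing(1)[OF \<gamma> _ ij(2), of i] by simp
    then have "\<sigma> q * (\<gamma> i - \<gamma> j) $ q \<le> 0" for q by (simp add: algebra_simps)
    then show ?thesis by blast
  qed
  then have "L \<le> \<bar>\<sigma> k * D $ k\<bar> \<or> L \<le> \<bar>\<sigma> l * D $ l\<bar>" using Dk Dl m by linarith
  then show ?thesis using comp[of k] comp[of l] unfolding D_def by linarith
qed

text \<open>One variable with finite \<open>d\<close>-th moment that pays for reaching any vertex of
  the ball from the origin.\<close>

definition ball_cost :: "int \<Rightarrow> 'd config \<Rightarrow> real" where
  "ball_cost \<rho> w = (\<Sum>x | norm1 x \<le> \<rho>. step_cost (shift x w))"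

lemma ball_cost_nonneg: "0 \<le> ball_cost \<rho> w"
  by (simp add: ball_cost_def sum_nonneg)

lemma ball_cost_measurable [measurable]: "ball_cost \<rho> \<in> borel_measurable P"
  unfolding ball_cost_def[abs_def] by measurable

lemma ball_cost_power_integrable: "integrable P (\<lambda>w. ball_cost \<rho> w ^ CARD('d))"
  unfolding ball_cost_def
proof (rule integrable_sum_power[OF finite_norm1_ball])
  show "integrable P (\<lambda>w. step_cost (shift x w) ^ CARD('d))" for x
    using integrable_shift[OF step_cost_power_integrable[OF min_power_integrable], of x] by simp
qed auto

text \<open>A geodesic from the origin visits distinct vertices of the ball, so its step costs form
  a subsum of the ball's.\<close>

lemma reach_ball_cost:
  assumes "norm1 x \<le> \<rho>" shows "reach w 0 x (ball_cost \<rho> w)"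
proof -
  define n where "n = nat (norm1 x)"
  obtain \<gamma> where \<gamma>: "monotone_path (orientation x) n \<gamma>" "\<gamma> 0 = 0" "\<gamma> n = x"
    using path_from_origin unfolding n_def .
  have inj: "inj_on \<gamma> {..<n}"
  proof (rule linorder_inj_onI')
    fix i j assume "i < j" "j \<in> {..<n}"
    then have "norm1 (\<gamma> j - \<gamma> i) = int (j - i)" using monotone_path_increasing(2)[OF \<gamma>(1)] by simp
    then show "\<gamma> i \<noteq> \<gamma> j" using \<open>i < j\<close> by auto
  qed
  have "(\<Sum>i<n. step_cost (shift (\<gamma> i) w)) = (\<Sum>x\<in>\<gamma> ` {..<n}. step_cost (shift x w))"
    using inj by (simp add: sum.reindex)
  also have "\<dots> \<le> ball_cost \<rho> w"
    unfolding ball_cost_def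
  proof (intro sum_mono2 finite_norm1_ball subsetI)
    fix y assume "y \<in> \<gamma> ` {..<n}"
    then obtain i where i: "i < n" "y = \<gamma> i" by auto
    then have "norm1 y = int i" using monotone_path_increasing(2)[OF \<gamma>(1), of 0 i] \<gamma>(2) by simp
    then show "y \<in> {x. norm1 x \<le> \<rho>}" using i assms by (simp add: n_def)
  qed simp
  finally show ?thesis
    using reach_monotone_path[OF dim \<gamma>(1), of w 0] \<gamma> by (auto intro: reach_mono)
qed

text \<open>The factor \<open>CARD('d) + 1\<close> in the exponent is the number of disjoint corridors from a neighbourhood of
  the origin to a neighbourhood of \<^term>\<open>y\<close>: they are independent, and each is expensive with probability \<open>O(1/r)\<close>.\<close>
lemma passage_tail:
  obtains \<rho> c K where "0 \<le> c" "0 \<le> K"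
    "\<And>y r. real_of_int (norm1 y) \<le> r \<Longrightarrow> 1 \<le> r \<Longrightarrow> \<exists>G\<in>events. (\<forall>w\<in>space P - G. reach w 0 y (c * r)) \<and>
      prob G \<le> 2 * prob {w \<in> space P. r < ball_cost \<rho> w} + K / r ^ (CARD('d) + 1)"
proof -
  obtain R where R: "separated R" by (rule separated_exists)
  have "1 < card (UNIV :: 'd set)" using dim by simp
  then obtain k l :: 'd where kl: "k \<noteq> l" by (metis card_2_iff' card_le_Suc0_iff_eq finite_class.finite_UNIV UNIV_I not_less_eq_eq One_nat_def Suc_le_lessD less_le_not_le)
  \<comment> \<open>Consecutive offsets differ by more than the range of dependence, so different
    corridors use disjoint sets of edges.\<close>
  define L where "L = R + 1"
  have L: "0 \<le> L" using R by (simp add: L_def separated_def)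
  define d where "d = CARD('d)"
  \<comment> \<open>Large enough to contain all \<open>d + 1\<close> corridor ends, since the
    farthest offset moves \<open>d * L\<close> along each of two axes.\<close>
  define \<rho> where "\<rho> = 2 * int d * L"
  define h where "h = expectation step_cost"
  have h: "0 \<le> h" unfolding h_def by (intro integral_nonneg_AE AE_I2 step_cost_nonneg)
  define C where "C = real_of_int (2 * R + 1) * step_variance"
  have C: "0 \<le> C" unfolding C_def using R step_variance_nonneg by (auto simp: separated_def)
  show ?thesis
  \<comment> \<open>\<open>(h + 1) * r\<close> pays for the cheap corridor, and \<open>r\<close> for
    the local connection at each of its ends.\<close>
  proof (rule that[of "h + 3" "C ^ (d + 1)" \<rho>])
    fix y :: "int ^ 'd" and r :: real assume r: "norm1 y \<le> r" "1 \<le> r"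
    define n where "n = nat (norm1 y)"
    define \<sigma> where "\<sigma> = orientation y"
    obtain \<gamma> where \<gamma>: "monotone_path \<sigma> n \<gamma>" "\<gamma> 0 = 0" "\<gamma> n = y"
      using path_from_origin unfolding n_def \<sigma>_def .
    define off where "off a = axis k (int a * L * \<sigma> k) - axis l (int a * L * \<sigma> l)" for a
    have off: "norm1 (off a) \<le> \<rho>" if "a \<le> d" for a
    proof -
      have "\<bar>\<sigma> i\<bar> = 1" for i using \<gamma> by (auto simp: monotone_path_def)
      then have "norm1 (off a) \<le> int a * L + int a * L"
        using norm1_triangle[of "axis k (int a * L * \<sigma> k)" "- axis l (int a * L * \<sigma> l)"] L
        by (simp add: off_def abs_mult)
      also have "\<dots> \<le> int d * L + int d * L" using that L by (intro add_mono mult_right_mono) auto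
      finally show ?thesis by (simp add: \<rho>_def algebra_simps)
    qed
    define S where "S a w = (\<Sum>i<n. step_cost (shift (off a + \<gamma> i) w))" for a w
    have S [measurable]: "S a \<in> borel_measurable P" for a unfolding S_def[abs_def] by measurable
    define V0 where "V0 = {w \<in> space P. r < ball_cost \<rho> w}"
    define V1 where "V1 = {w \<in> space P. shift y w \<in> V0}"
    define E where "E a = {w \<in> space P. (h + 1) * r < S a w}" for a
    have ev: "V0 \<in> events" "V1 \<in> events" "E a \<in> events" for a
      by (auto simp: V0_def V1_def E_def)
    \<comment> \<open>Failure means an expensive neighbourhood of one of the end points, or all
      corridors expensive at once; only the corridors need to be independent of each other.\<close>
    define G where "G = V0 \<union> V1 \<union> (\<Inter>a\<in>{..d}. E a)"
    have rnn: "real n \<le> r" using r by (simp add: n_def)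
    have "indep_vars (\<lambda>_. borel) S {..d}"
    proof (rule indep_local[where F = "\<lambda>a. \<Union>i<n. (`) ((+) (off a + \<gamma> i)) ` step_support"])
      show "disjoint_family_on (\<lambda>a. \<Union>i<n. (`) ((+) (off a + \<gamma> i)) ` step_support) {..d}"
        unfolding disjoint_family_on_def
      proof (intro ballI impI)
        fix a b :: nat assume "a \<noteq> b"
        have "(`) ((+) (off a + \<gamma> i)) ` step_support \<inter> (`) ((+) (off b + \<gamma> j)) ` step_support = {}"
          if "i < n" "j < n" for i j
        proof -
          have "L \<le> norm1 ((off a + \<gamma> i) - (off b + \<gamma> j))"
            unfolding off_def using that by (intro offsets_separated[OF \<gamma>(1) kl L \<open>a \<noteq> b\<close>]) auto
          then have "R < norm1 ((off a + \<gamma> i) - (off b + \<gamma> j))" by (simp add: L_def)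
          then show ?thesis using R unfolding separated_def by blast
        qed
        then show "(\<Union>i<n. (`) ((+) (off a + \<gamma> i)) ` step_support) \<inter> (\<Union>i<n. (`) ((+) (off b + \<gamma> i)) ` step_support) = {}"
          by blast
      qed
      show "S a w = S a w'" if "\<And>e. e \<in> (\<Union>i<n. (`) ((+) (off a + \<gamma> i)) ` step_support) \<Longrightarrow> w e = w' e" for a w w'
        unfolding S_def by (intro sum.cong refl step_cost_shift_local that) auto
    qed (use translate_step_support in auto)
    then have "prob (\<Inter>a\<in>{..d}. S a -` {(h + 1) * r<..} \<inter> space P) = (\<Prod>a\<in>{..d}. prob (S a -` {(h + 1) * r<..} \<inter> space P))"
      by (rule indep_varsD) auto
    moreover have "S a -` {(h + 1) * r<..} \<inter> space P = E a" for a by (auto simp: E_def)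
    ultimately have "prob (\<Inter>a\<in>{..d}. E a) = (\<Prod>a\<in>{..d}. prob (E a))" by simp
    also have "\<dots> \<le> (\<Prod>a\<in>{..d}. C / r)"
    proof (intro prod_mono conjI)
      fix a
      have "norm1 ((off a + \<gamma> i) - (off a + \<gamma> j)) = \<bar>int i - int j\<bar>" if "i < n" "j < n" for i j
      proof (cases "j \<le> i")
        case True
        then show ?thesis using monotone_path_increasing(2)[OF \<gamma>(1) True] that by simp
      next
        case False
        then have "norm1 (\<gamma> j - \<gamma> i) = int (j - i)" using monotone_path_increasing(2)[OF \<gamma>(1), of i j] that by simp
        then show ?thesis using False by (simp add: norm1_minus_commute[of "\<gamma> i"])
      qed
      then show "prob (E a) \<le> C / r"
        unfolding E_def S_def h_def C_def using corridor_tail[OF R, of n "\<lambda>i. off a + \<gamma> i" r] rnn r(2) by simp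
    qed simp
    also have "\<dots> = C ^ (d + 1) / r ^ (d + 1)" by (simp add: power_divide)
    finally have PE: "prob (\<Inter>a\<in>{..d}. E a) \<le> C ^ (d + 1) / r ^ (d + 1)" .
    have IE: "(\<Inter>a\<in>{..d}. E a) \<in> events" using ev by (intro sets.finite_INT) auto
    have "prob G \<le> prob (V0 \<union> V1) + prob (\<Inter>a\<in>{..d}. E a)"
      unfolding G_def using ev IE by (intro measure_Un_le) auto
    also have "prob (V0 \<union> V1) \<le> prob V0 + prob V1" using ev by (intro measure_Un_le) auto
    also have "prob V1 = prob V0" unfolding V1_def by (rule prob_shift[OF ev(1)])
    finally have "prob G \<le> 2 * prob V0 + C ^ (d + 1) / r ^ (d + 1)" using PE by linarith
    moreover have "reach w 0 y ((h + 3) * r)" if w: "w \<in> space P - G" for w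
    proof -
      have "w \<notin> V0" "w \<notin> V1" using w by (auto simp: G_def)
      then have v: "ball_cost \<rho> w \<le> r" "ball_cost \<rho> (shift y w) \<le> r" using w by (auto simp: V0_def V1_def)
      obtain a where a: "a \<le> d" "w \<notin> E a" using w by (auto simp: G_def)
      then have s: "S a w \<le> (h + 1) * r" using w by (auto simp: E_def)
      have "reach w 0 (off a) (ball_cost \<rho> w)" by (rule reach_ball_cost[OF off[OF a(1)]])
      moreover have "reach w (off a) (off a + y) (S a w)"
        using reach_monotone_path[OF dim \<gamma>(1), of w "off a"] \<gamma> by (simp add: S_def)
      moreover have "reach w (off a + y) y (ball_cost \<rho> (shift y w))"
        using reach_commute[OF reach_shift[OF reach_ball_cost[OF off[OF a(1)], of "shift y w"]]] by (simp add: add.commute)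
      ultimately have "reach w 0 y (ball_cost \<rho> w + S a w + ball_cost \<rho> (shift y w))"
        by (blast intro: reach_trans)
      moreover have "ball_cost \<rho> w + S a w + ball_cost \<rho> (shift y w) \<le> (h + 3) * r"
        using v s by (simp add: algebra_simps)
      ultimately show ?thesis by (rule reach_mono)
    qed
    moreover have "G \<in> events" unfolding G_def using ev IE by auto
    ultimately show "\<exists>G\<in>events. (\<forall>w\<in>space P - G. reach w 0 y ((h + 3) * r)) \<and>
      prob G \<le> 2 * prob {w \<in> space P. r < ball_cost \<rho> w} + C ^ (d + 1) / r ^ (CARD('d) + 1)"
      by (intro bexI[of _ G]) (auto simp: V0_def d_def)
  qed (use h C in auto)
qed

end

subsection \<open>The shape theorem\<close>

text \<open>Divide \<open>x\<close> coordinatewise by \<open>q = j * k\<close>, with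
  \<open>j\<close> chosen so that \<open>norm1 x / q\<close> lies between \<open>m\<close> and
  \<open>2 * m\<close>. The quotient \<open>v\<close> then ranges over a finite set, and the
  remainder is below \<open>q\<close> in every coordinate, hence small relative to \<open>x\<close>
  when \<open>m\<close> is large.\<close>

lemma lattice_approximation:
  fixes x :: "int ^ 'd"
  assumes m: "m \<ge> 1" and k: "k \<ge> 1" and x: "int (m * k) \<le> norm1 x"
  obtains j v where "j \<ge> 1" "norm1 v \<le> int (2 * m + CARD('d))" "int (j * k * m) \<le> norm1 x"
    "norm1 x < int (2 * j * k * m)" "norm1 (x - int (j * k) *s v) \<le> int (CARD('d) * (j * k))"
proof -
  define n where "n = nat (norm1 x)"
  have n: "norm1 x = int n" by (simp add: n_def)
  define j where "j = n div (m * k)"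
  have mk: "m * k > 0" using m k by simp
  have "m * k \<le> n" using x unfolding n by (simp only: of_nat_le_iff)
  then have j: "j \<ge> 1" using mk by (simp add: j_def div_greater_zero_iff Suc_le_eq)
  have jn: "j * (m * k) \<le> n" by (simp add: j_def)
  have "n < (j + 1) * (m * k)" using mk dividend_less_div_times[of "m * k" n] by (simp add: j_def algebra_simps)
  also have "\<dots> \<le> (2 * j) * (m * k)" using j by (intro mult_right_mono) auto
  finally have nj: "n < 2 * j * k * m" by (simp add: algebra_simps)
  define q where "q = int (j * k)"
  have q: "q > 0" using j k by (simp add: q_def)
  define v :: "int ^ 'd" where "v = (\<chi> i. x $ i div q)"
  have "(x - q *s v) $ i = x $ i mod q" for i
    by (simp add: v_def minus_mult_div_eq_mod)
  then have "\<bar>(x - q *s v) $ i\<bar> \<le> q" for i using q by (simp add: abs_of_nonneg less_imp_le)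
  then have diff: "norm1 (x - q *s v) \<le> int CARD('d) * q"
    unfolding norm1_def using sum_bounded_above[of UNIV "\<lambda>i. \<bar>(x - q *s v) $ i\<bar>" q] by simp
  have "norm1 (q *s v) \<le> norm1 x + norm1 (x - q *s v)"
    using norm1_triangle[of x "q *s v - x"] by (simp add: norm1_minus_commute)
  also have "\<dots> \<le> q * (2 * int m) + int CARD('d) * q"
  proof -
    have "int n \<le> int (2 * j * k * m)" using nj by (simp only: of_nat_le_iff less_imp_le)
    then show ?thesis using diff n by (simp add: q_def algebra_simps)
  qed
  also have "\<dots> = q * int (2 * m + CARD('d))" by (simp add: algebra_simps)
  finally have "q * norm1 v \<le> q * int (2 * m + CARD('d))" using q by (simp add: norm1_smult)
  then have "norm1 v \<le> int (2 * m + CARD('d))" using q by simp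
  then show ?thesis
  proof (rule that[OF j])
    show "int (j * k * m) \<le> norm1 x" using jn by (simp only: n of_nat_le_iff) (simp add: ac_simps)
    show "norm1 x < int (2 * j * k * m)" using nj by (simp only: n of_nat_less_iff)
    show "norm1 (x - int (j * k) *s v) \<le> int (CARD('d) * (j * k))" using diff by (simp add: q_def)
  qed
qed

context first_passage_moments
begin

text \<open>For large \<open>k\<close> the mean over one step of length \<open>k\<close> times
  \<open>v\<close> is nearly \<open>k\<close> times the limit, so the upper bound from
  \<open>multiples_upper\<close> matches the lower bound up to \<eta>.\<close>

lemma multiples_both:
  fixes v :: "int ^ 'd"
  assumes k: "k \<ge> 1" and \<eta>: "0 < \<eta>" and mean: "mean_time (int k *s v) < real k * (\<mu> (vec_of_int v) + \<eta>)"
  shows "AE w in P. \<forall>\<^sub>F j in sequentially.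
    \<bar>stime w 0 (int (j * k) *s v) - real (j * k) * \<mu> (vec_of_int v)\<bar> \<le> gain w 0 + \<eta> * real (j * k)"
proof (cases "v = 0")
  case True
  have "vec_of_int v = (0 :: real ^ 'd)" using True by (simp add: vec_of_int_def vec_eq_iff)
  moreover have "\<mu> 0 = 0" using limit.limit_homogeneous[of 0 0] by simp
  ultimately have "\<mu> (vec_of_int v) = 0" by simp
  then show ?thesis
    using True stime_le_of_reach[OF dim reach_refl, of _ 0] stime_nonneg[OF dim, of _ 0 0] \<eta>
    by (auto intro!: AE_I2 always_eventually intro: add_increasing2)
next
  case False
  let ?v = "int k *s v" and ?m = "\<mu> (vec_of_int v)"
  have v: "?v \<noteq> 0" using False k by (simp add: vec_eq_iff)
  have mv: "\<mu> (vec_of_int ?v) = real k * ?m" by (simp add: vec_of_int_smult limit.limit_homogeneous)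
  have jk: "int j *s ?v = int (j * k) *s v" for j by (simp add: vector_smult_assoc)
  have k0: "0 < real k * \<eta>" using k \<eta> by simp
  have "AE w in P. \<forall>\<^sub>F j in sequentially. (real k * ?m - real k * \<eta>) * real j \<le> stime w 0 (int (j * k) *s v)"
    using multiples_lower[OF v, of "real k * ?m - real k * \<eta>"] k0 unfolding mv jk by simp
  moreover have "AE w in P. \<forall>\<^sub>F j in sequentially. stime w 0 (int (j * k) *s v) \<le> gain w 0 + real k * (?m + \<eta>) * real j"
    using multiples_upper[OF v mean] unfolding jk .
  ultimately show ?thesis
  proof eventually_elim
    case (elim w)
    from elim show ?case
    proof eventually_elim
      case (elim j)
      then show ?case using gain_nonneg[of w 0] by (simp add: abs_le_iff algebra_simps)
    qed
  qed
qed

text \<open>By stationarity the gain at \<open>x\<close> has the law of the gain at 0, so its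
  \<open>d\<close>-th moment alone feeds the Borel-Cantelli lemma.\<close>

lemma gain_sublinear:
  fixes \<epsilon> :: real
  assumes "0 < \<epsilon>"
  shows "AE w in P. \<exists>R. \<forall>x. R \<le> norm1 x \<longrightarrow> gain w x \<le> \<epsilon> * norm1 x"
proof -
  have "AE w in P. \<exists>R. \<forall>x :: int ^ 'd. R \<le> norm1 x \<longrightarrow> w \<notin> {w \<in> space P. \<epsilon> * norm1 x < gain w x}"
  proof (rule lattice_borel_cantelli[where Y = "\<lambda>w. gain w 0" and c = \<epsilon> and K = 1 and K' = 0])
    fix x :: "int ^ 'd" and k :: nat assume k: "2 ^ k \<le> norm1 x"
    have "prob {w \<in> space P. \<epsilon> * norm1 x < gain w x} = prob {w \<in> space P. shift x w \<in> {w \<in> space P. \<epsilon> * norm1 x < gain w 0}}"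
      by (simp add: gain_shift[of _ x])
    also have "\<dots> = prob {w \<in> space P. \<epsilon> * norm1 x < gain w 0}" by (rule prob_shift) simp
    also have "\<dots> \<le> prob {w \<in> space P. \<epsilon> * 2 ^ k < gain w 0}"
    proof (intro finite_measure_mono subsetI)
      fix w assume w: "w \<in> {w \<in> space P. \<epsilon> * norm1 x < gain w 0}"
      have "real_of_int (2 ^ k) \<le> real_of_int (norm1 x)" using k by (simp only: of_int_le_iff)
      then have "\<epsilon> * 2 ^ k \<le> \<epsilon> * norm1 x" using assms by simp
      then show "w \<in> {w \<in> space P. \<epsilon> * 2 ^ k < gain w 0}" using w by auto
    qed simp
    finally show "prob {w \<in> space P. \<epsilon> * norm1 x < gain w x}
        \<le> 1 * prob {w \<in> space P. \<epsilon> * 2 ^ k < gain w 0} + 0 / (2 ^ k) ^ (CARD('d) + 1)" by simp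
  qed (use assms gain_nonneg gain_power_integrable[OF gain_power_finite] in auto)
  then show ?thesis
  proof (rule AE_mp, intro AE_I2 impI)
    fix w assume "w \<in> space P" and "\<exists>R. \<forall>x :: int ^ 'd. R \<le> norm1 x \<longrightarrow> w \<notin> {w \<in> space P. \<epsilon> * norm1 x < gain w x}"
    then show "\<exists>R. \<forall>x. R \<le> norm1 x \<longrightarrow> gain w x \<le> \<epsilon> * norm1 x" by (auto simp: not_less)
  qed
qed

text \<open>The constant \<open>c\<close> depends neither on \<delta> nor on the choice of nearby
  points \<open>z\<close>. Hence \<delta> can be picked afterwards so small that the connections are
  cheap relative to any tolerance.\<close>

lemma short_connections:
  obtains c where "0 \<le> c"
    "\<And>(\<delta> :: real) z. 0 < \<delta> \<Longrightarrow> (\<And>x. 1 \<le> \<delta> * norm1 x \<Longrightarrow> norm1 (x - z x) \<le> \<delta> * norm1 x) \<Longrightarrow>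
      AE w in P. \<exists>R. \<forall>x. R \<le> norm1 x \<longrightarrow> reach w (z x) x (c * (\<delta> * norm1 x))"
proof -
  obtain \<rho> c K where c: "0 \<le> c" "0 \<le> K"
    and tail: "\<And>y r. real_of_int (norm1 y) \<le> r \<Longrightarrow> 1 \<le> r \<Longrightarrow> \<exists>G\<in>events. (\<forall>w\<in>space P - G. reach w 0 y (c * r)) \<and>
      prob G \<le> 2 * prob {w \<in> space P. r < ball_cost \<rho> w} + K / r ^ (CARD('d) + 1)"
    by (rule passage_tail) (rule that)
  show ?thesis
  proof (rule that[OF c(1)])
    fix \<delta> :: real and z :: "int ^ 'd \<Rightarrow> int ^ 'd"
    assume \<delta>: "0 < \<delta>" and z: "\<And>x. 1 \<le> \<delta> * norm1 x \<Longrightarrow> norm1 (x - z x) \<le> \<delta> * norm1 x"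
    let ?b = "\<lambda>r. 2 * prob {w \<in> space P. r < ball_cost \<rho> w} + K / r ^ (CARD('d) + 1)"
    have ex: "\<exists>G\<in>events. (1 \<le> \<delta> * norm1 x \<longrightarrow> (\<forall>w\<in>space P - G. reach w (z x) x (c * (\<delta> * norm1 x)))) \<and>
      (x \<noteq> 0 \<longrightarrow> prob G \<le> ?b (\<delta> * norm1 x))" for x
    proof (cases "1 \<le> \<delta> * norm1 x")
      case True
      from tail[OF z[OF True] True] obtain G where G: "G \<in> events"
        "\<And>w. w \<in> space P - G \<Longrightarrow> reach w 0 (x - z x) (c * (\<delta> * norm1 x))" "prob G \<le> ?b (\<delta> * norm1 x)" by blast
      let ?G = "{w \<in> space P. shift (z x) w \<in> G}"
      have "?G \<in> events" using G(1) by measurable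
      moreover have "prob ?G = prob G" by (rule prob_shift[OF G(1)])
      moreover have "reach w (z x) x (c * (\<delta> * norm1 x))" if "w \<in> space P - ?G" for w
        using reach_shift[OF G(2), of "z x" w] that by simp
      ultimately show ?thesis using G(3) by (intro bexI[of _ ?G]) auto
    next
      case False
      \<comment> \<open>Too near the origin for the tail bound, which needs radius at least 1; the
        empty exceptional event satisfies the requirement.\<close>
      then show ?thesis using c \<delta> by (intro bexI[of _ "{}"]) (auto simp: not_le)
    qed
    have "\<exists>G. \<forall>x. G x \<in> events \<and>
      (1 \<le> \<delta> * norm1 x \<longrightarrow> (\<forall>w\<in>space P - G x. reach w (z x) x (c * (\<delta> * norm1 x)))) \<and>
      (x \<noteq> 0 \<longrightarrow> prob (G x) \<le> ?b (\<delta> * norm1 x))"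
      by (rule choice) (use ex in \<open>simp only: Bex_def conj_assoc, blast\<close>)
    then obtain G where "\<forall>x. G x \<in> events \<and>
      (1 \<le> \<delta> * norm1 x \<longrightarrow> (\<forall>w\<in>space P - G x. reach w (z x) x (c * (\<delta> * norm1 x)))) \<and>
      (x \<noteq> 0 \<longrightarrow> prob (G x) \<le> ?b (\<delta> * norm1 x))" ..
    then have G: "\<And>x. G x \<in> events"
      "\<And>x w. 1 \<le> \<delta> * norm1 x \<Longrightarrow> w \<in> space P - G x \<Longrightarrow> reach w (z x) x (c * (\<delta> * norm1 x))"
      "\<And>x. x \<noteq> 0 \<Longrightarrow> prob (G x) \<le> ?b (\<delta> * norm1 x)" by blast+
    have "AE w in P. \<exists>R. \<forall>x :: int ^ 'd. R \<le> norm1 x \<longrightarrow> w \<notin> G x"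
    proof (rule lattice_borel_cantelli[where Y = "ball_cost \<rho>" and c = \<delta> and K = 2 and K' = "K / \<delta> ^ (CARD('d) + 1)"])
      fix x :: "int ^ 'd" and k :: nat assume k: "2 ^ k \<le> norm1 x"
      have "real_of_int (2 ^ k) \<le> real_of_int (norm1 x)" using k by (simp only: of_int_le_iff)
      then have le: "\<delta> * 2 ^ k \<le> \<delta> * norm1 x" using \<delta> by simp
      have pos: "0 < \<delta> * 2 ^ k" using \<delta> by simp
      have "(0 :: int) < 2 ^ k" by simp
      then have nx: "0 < norm1 x" using k by linarith
      then have "x \<noteq> 0" by auto
      then have "prob (G x) \<le> ?b (\<delta> * norm1 x)" by (rule G(3))
      also have "\<dots> \<le> ?b (\<delta> * 2 ^ k)"
      proof (intro add_mono mult_left_mono finite_measure_mono)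
        show "{w \<in> space P. \<delta> * norm1 x < ball_cost \<rho> w} \<subseteq> {w \<in> space P. \<delta> * 2 ^ k < ball_cost \<rho> w}"
          using le by auto
        show "K / (\<delta> * norm1 x) ^ (CARD('d) + 1) \<le> K / (\<delta> * 2 ^ k) ^ (CARD('d) + 1)"
          using c(2) le pos \<delta> nx by (intro divide_left_mono power_mono mult_pos_pos zero_less_power) auto
      qed auto
      also have "K / (\<delta> * 2 ^ k) ^ (CARD('d) + 1) = K / \<delta> ^ (CARD('d) + 1) / (2 ^ k) ^ (CARD('d) + 1)"
        by (simp add: power_mult_distrib)
      finally show "prob (G x) \<le> 2 * prob {w \<in> space P. \<delta> * 2 ^ k < ball_cost \<rho> w}
          + K / \<delta> ^ (CARD('d) + 1) / (2 ^ k) ^ (CARD('d) + 1)" .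
    qed (use G(1) c \<delta> ball_cost_nonneg ball_cost_power_integrable in auto)
    then show "AE w in P. \<exists>R. \<forall>x. R \<le> norm1 x \<longrightarrow> reach w (z x) x (c * (\<delta> * norm1 x))"
    proof (rule AE_mp, intro AE_I2 impI)
      fix w assume w: "w \<in> space P" and "\<exists>R. \<forall>x :: int ^ 'd. R \<le> norm1 x \<longrightarrow> w \<notin> G x"
      then obtain R where R: "\<And>x :: int ^ 'd. R \<le> norm1 x \<Longrightarrow> w \<notin> G x" by blast
      show "\<exists>R. \<forall>x. R \<le> norm1 x \<longrightarrow> reach w (z x) x (c * (\<delta> * norm1 x))"
      proof (intro exI[of _ "max R \<lceil>1 / \<delta>\<rceil>"] allI impI)
        fix x :: "int ^ 'd" assume x: "max R \<lceil>1 / \<delta>\<rceil> \<le> norm1 x"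
        then have "1 / \<delta> \<le> norm1 x" by (simp add: ceiling_le_iff)
        then have "1 \<le> \<delta> * norm1 x" using \<delta> by (simp add: field_simps)
        then show "reach w (z x) x (c * (\<delta> * norm1 x))" using G(2) R[of x] x w by simp
      qed
    qed
  qed
qed

lemma shape_fixed_tolerance:
  fixes \<epsilon> :: real
  assumes \<epsilon>: "0 < \<epsilon>"
  shows "AE w in P. \<exists>R. \<forall>x. R \<le> norm1 x \<longrightarrow> \<bar>rtime w 0 x - \<mu> (vec_of_int x)\<bar> \<le> \<epsilon> * norm1 x"
proof -
  define C1 where "C1 = expectation step_cost"
  have C1: "0 \<le> C1" unfolding C1_def using limit.C by simp
  obtain c where c: "0 \<le> c" and conn: "\<And>(\<delta> :: real) z. 0 < \<delta> \<Longrightarrow> (\<And>x. 1 \<le> \<delta> * norm1 x \<Longrightarrow> norm1 (x - z x) \<le> \<delta> * norm1 x) \<Longrightarrow>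
      AE w in P. \<exists>R. \<forall>x. R \<le> norm1 x \<longrightarrow> reach w (z x) x (c * (\<delta> * norm1 x))"
    using short_connections by blast
  \<comment> \<open>The first bound makes \<delta> at most one half, so \<open>z x\<close> stays at
    least half as far out as \<open>x\<close>; the second makes connections plus the change of the
    limit function cost at most \<epsilon>/4 per unit distance.\<close>
  obtain m :: nat where m: "m > max (2 * CARD('d)) (4 * (c + C1) * CARD('d) / \<epsilon>)" using reals_Archimedean2 by blast
  have m1: "m \<ge> 1" using m by (cases m) auto
  define \<delta> where "\<delta> = real CARD('d) / m"
  have \<delta>: "0 < \<delta>" "\<delta> \<le> 1 / 2" "(c + C1) * \<delta> \<le> \<epsilon> / 4"
    using m m1 \<epsilon> by (simp_all add: \<delta>_def field_simps)
  define \<eta> where "\<eta> = \<epsilon> / 16"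
  have \<eta>: "0 < \<eta>" using \<epsilon> by (simp add: \<eta>_def)
  define V where "V = {v :: int ^ 'd. norm1 v \<le> int (2 * m + CARD('d))}"
  have V: "finite V" unfolding V_def by (rule finite_norm1_ball)
  have "\<forall>v\<in>V. \<forall>\<^sub>F k in sequentially. mean_time (int k *s v) / k < \<mu> (vec_of_int v) + \<eta>"
  proof
    fix v
    have "(\<lambda>n. mean_time (int n *s v) / n) \<longlonglongrightarrow> \<mu> (vec_of_int v)"
      by (rule limit.lattice_limit[OF multiples_limit])
    then show "\<forall>\<^sub>F k in sequentially. mean_time (int k *s v) / k < \<mu> (vec_of_int v) + \<eta>"
      using \<eta> by (intro order_tendstoD(2)) auto
  qed
  then have "\<forall>\<^sub>F k in sequentially. \<forall>v\<in>V. mean_time (int k *s v) / k < \<mu> (vec_of_int v) + \<eta>"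
    by (rule eventually_ball_finite[OF V])
  then obtain k0 where k0: "\<And>k v. k \<ge> k0 \<Longrightarrow> v \<in> V \<Longrightarrow> mean_time (int k *s v) / k < \<mu> (vec_of_int v) + \<eta>"
    by (auto simp: eventually_sequentially)
  define k where "k = max 1 k0"
  have k1: "k \<ge> 1" by (simp add: k_def)
  have mean: "mean_time (int k *s v) < real k * (\<mu> (vec_of_int v) + \<eta>)" if "v \<in> V" for v
    using k0[of k v] that k1 by (simp add: k_def field_simps)
  have "\<exists>j v. int (m * k) \<le> norm1 x \<longrightarrow> (j \<ge> 1 \<and> v \<in> V \<and> int (j * k * m) \<le> norm1 x
      \<and> norm1 x < int (2 * j * k * m) \<and> norm1 (x - int (j * k) *s v) \<le> int (CARD('d) * (j * k)))" for x :: "int ^ 'd"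
    using lattice_approximation[OF m1 k1, of x] unfolding V_def by (metis mem_Collect_eq)
  then obtain j v where jv: "\<And>x. int (m * k) \<le> norm1 x \<Longrightarrow> j x \<ge> 1 \<and> v x \<in> V \<and> int (j x * k * m) \<le> norm1 x
      \<and> norm1 x < int (2 * j x * k * m) \<and> norm1 (x - int (j x * k) *s v x) \<le> int (CARD('d) * (j x * k))"
    by metis
  define z where "z x = (if int (m * k) \<le> norm1 x then int (j x * k) *s v x else x)" for x
  have z: "norm1 (x - z x) \<le> \<delta> * norm1 x" for x
  proof (cases "int (m * k) \<le> norm1 x")
    case True
    have "real_of_int (norm1 (x - z x)) \<le> real_of_int (int (CARD('d) * (j x * k)))"
      using jv[OF True] True by (simp only: of_int_le_iff z_def if_True)
    also have "\<dots> = \<delta> * real_of_int (int (j x * k * m))" using m1 by (simp add: \<delta>_def)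
    also have "\<dots> \<le> \<delta> * real_of_int (norm1 x)"
      using jv[OF True] \<delta>(1) by (intro mult_left_mono) (simp_all only: of_int_le_iff less_imp_le)
    finally show ?thesis .
  next
    case False
    then show ?thesis using \<delta> by (simp add: z_def)
  qed
  have "AE w in P. \<exists>R. \<forall>x. R \<le> norm1 x \<longrightarrow> reach w (z x) x (c * (\<delta> * norm1 x))"
    by (rule conn[OF \<delta>(1) z])
  moreover have "AE w in P. \<exists>R. \<forall>x. R \<le> norm1 x \<longrightarrow> gain w x \<le> \<eta> * norm1 x"
    by (rule gain_sublinear[OF \<eta>])
  moreover have "AE w in P. \<forall>v\<in>V. \<forall>\<^sub>F j in sequentially.
      \<bar>stime w 0 (int (j * k) *s v) - real (j * k) * \<mu> (vec_of_int v)\<bar> \<le> gain w 0 + \<eta> * real (j * k)"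
    by (intro AE_finite_allI V multiples_both[OF k1 \<eta>] mean)
  moreover note AE_rtime_eq
  ultimately show ?thesis
  proof eventually_elim
    case (elim w)
    obtain R1 where R1: "\<And>x. R1 \<le> norm1 x \<Longrightarrow> reach w (z x) x (c * (\<delta> * norm1 x))" using elim(1) by blast
    obtain R2 where R2: "\<And>x. R2 \<le> norm1 x \<Longrightarrow> gain w x \<le> \<eta> * norm1 x" using elim(2) by blast
    have "\<forall>\<^sub>F j in sequentially. \<forall>v\<in>V.
      \<bar>stime w 0 (int (j * k) *s v) - real (j * k) * \<mu> (vec_of_int v)\<bar> \<le> gain w 0 + \<eta> * real (j * k)"
      by (rule eventually_ball_finite[OF V elim(3)])
    then obtain J where J: "\<And>j v. j \<ge> J \<Longrightarrow> v \<in> V \<Longrightarrow>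
      \<bar>stime w 0 (int (j * k) *s v) - real (j * k) * \<mu> (vec_of_int v)\<bar> \<le> gain w 0 + \<eta> * real (j * k)"
      by (auto simp: eventually_sequentially)
    \<comment> \<open>The factor 2 at \<open>R2\<close> transfers the gain bound to
      \<open>z x\<close>; the fourth entry forces \<open>j x\<close> to reach the threshold
      \<open>J\<close>; the last makes the gain at 0 at most \<epsilon>/4 times the
      distance.\<close>
    define R where "R = Max {R1, 2 * \<bar>R2\<bar>, int (m * k), int (2 * J * k * m), \<lceil>4 * gain w 0 / \<epsilon>\<rceil>}"
    show ?case
    proof (intro exI[of _ R] allI impI)
      fix x :: "int ^ 'd" assume "R \<le> norm1 x"
      then have x: "R1 \<le> norm1 x" "2 * \<bar>R2\<bar> \<le> norm1 x" "int (m * k) \<le> norm1 x" "int (2 * J * k * m) \<le> norm1 x"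
        "\<lceil>4 * gain w 0 / \<epsilon>\<rceil> \<le> norm1 x" by (auto simp: R_def)
      note jvx = jv[OF x(3)]
      define n where "n = real_of_int (norm1 x)"
      have zx: "z x = int (j x * k) *s v x" using x(3) by (simp add: z_def)
      have "J \<le> j x"
      proof (rule ccontr)
        assume "\<not> J \<le> j x"
        then have "2 * j x * k * m \<le> 2 * J * k * m" by (intro mult_right_mono) auto
        then have "int (2 * j x * k * m) \<le> int (2 * J * k * m)" by (simp only: of_nat_le_iff)
        then show False using jvx x(4) by linarith
      qed
      have "real (j x * k) * \<mu> (vec_of_int (v x)) = \<mu> (vec_of_int (z x))"
        unfolding zx vec_of_int_smult by (simp add: limit.limit_homogeneous)
      then have 1: "\<bar>stime w 0 (z x) - \<mu> (vec_of_int (z x))\<bar> \<le> gain w 0 + \<eta> * real (j x * k)"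
        using J[OF \<open>J \<le> j x\<close>, of "v x"] jvx unfolding zx by simp
      have jk: "real (j x * k) \<le> n"
      proof -
        have "j x * k * 1 \<le> j x * k * m" using m1 by (intro mult_left_mono) auto
        then have "int (j x * k) \<le> norm1 x" using jvx by (metis mult.right_neutral of_nat_le_iff order_trans)
        then have "real_of_int (int (j x * k)) \<le> real_of_int (norm1 x)" by (simp only: of_int_le_iff)
        then show ?thesis by (simp add: n_def)
      qed
      have dist: "norm1 (x - z x) \<le> \<delta> * n" unfolding n_def by (rule z)
      have n0: "0 \<le> n" by (simp add: n_def)
      have gx: "gain w x \<le> \<eta> * n" unfolding n_def using x(2) by (intro R2) linarith
      have gz: "gain w (z x) \<le> 2 * \<eta> * n"
      proof -
        have dn: "\<delta> * n \<le> n / 2" using mult_right_mono[OF \<delta>(2) n0] by simp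
        have "norm1 x \<le> norm1 (z x) + norm1 (x - z x)" "norm1 (z x) \<le> norm1 x + norm1 (x - z x)"
          using norm1_triangle[of "z x" "x - z x"] norm1_triangle[of x "z x - x"]
          by (simp_all add: norm1_minus_commute)
        then have "n \<le> norm1 (z x) + norm1 (x - z x)" "norm1 (z x) \<le> n + norm1 (x - z x)"
          unfolding n_def by (simp_all only: of_int_add[symmetric] of_int_le_iff)
        then have lo: "n / 2 \<le> norm1 (z x)" and hi: "norm1 (z x) \<le> 2 * n" using dist dn by linarith+
        have "real_of_int (2 * \<bar>R2\<bar>) \<le> n" using x(2) unfolding n_def by (simp only: of_int_le_iff)
        then have "real_of_int R2 \<le> norm1 (z x)" using lo by simp
        then have "gain w (z x) \<le> \<eta> * norm1 (z x)" by (intro R2) simp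
        also have "\<dots> \<le> \<eta> * (2 * n)" using hi \<eta> by (intro mult_left_mono) auto
        finally show ?thesis by simp
      qed
      have r: "reach w (z x) x (c * (\<delta> * n))" unfolding n_def by (rule R1[OF x(1)])
      have cn: "0 \<le> c * (\<delta> * n)" using c \<delta> n0 by simp
      have 2: "stime w (z x) x \<le> c * (\<delta> * n) + gain w x" "stime w x (z x) \<le> c * (\<delta> * n) + gain w (z x)"
        using stime_le_of_reach[OF dim r cn] stime_le_of_reach[OF dim reach_commute[OF r] cn] .
      have 3: "\<bar>\<mu> (vec_of_int x) - \<mu> (vec_of_int (z x))\<bar> \<le> C1 * (\<delta> * n)"
      proof -
        have "\<bar>\<mu> (vec_of_int x) - \<mu> (vec_of_int (z x))\<bar> \<le> C1 * norm1 (x - z x)"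
          using limit.limit_lipschitz[of "vec_of_int x" "vec_of_int (z x)"]
          by (simp add: C1_def l1_vec_of_int vec_of_int_diff[symmetric])
        also have "\<dots> \<le> C1 * (\<delta> * n)" using C1 dist by (intro mult_left_mono)
        finally show ?thesis .
      qed
      have 4: "stime w 0 x \<le> stime w 0 (z x) + stime w (z x) x" "stime w 0 (z x) \<le> stime w 0 x + stime w x (z x)"
        by (rule stime_triangle[OF dim])+
      have 5: "rtime w 0 x = stime w 0 x - gain w x" using elim(4) by blast
      define E where "E = \<epsilon> * n"
      have E: "0 \<le> E" unfolding E_def using \<epsilon> n0 by simp
      have \<eta>n: "\<eta> * n = E / 16" by (simp add: \<eta>_def E_def)
      have 6: "c * (\<delta> * n) + C1 * (\<delta> * n) \<le> E / 4"
        using mult_right_mono[OF \<delta>(3) n0] by (simp add: E_def algebra_simps)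
      have 7: "gain w 0 \<le> E / 4"
      proof -
        have "4 * gain w 0 / \<epsilon> \<le> n" using x(5) by (simp add: n_def ceiling_le_iff)
        then show ?thesis using \<epsilon> by (simp add: E_def field_simps)
      qed
      have 8: "\<eta> * real (j x * k) \<le> E / 16"
        unfolding \<eta>n[symmetric] using jk \<eta> by (intro mult_left_mono) auto
      have 9: "gain w x \<le> E / 16" "gain w (z x) \<le> E / 8"
        using gx gz \<eta>n by (simp_all add: mult.assoc)
      \<comment> \<open>The errors add up to at most three quarters of \<open>E\<close>:
        \<open>E/4\<close> for the gain at 0, \<open>E/16\<close> along multiples,
        \<open>E/4\<close> for connection and limit function, \<open>E/16\<close> and
        \<open>E/8\<close> for the gains at \<open>x\<close> and \<open>z x\<close>.\<close>
      have "\<bar>rtime w 0 x - \<mu> (vec_of_int x)\<bar> \<le> E"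
      proof (rule abs_leI)
        show "rtime w 0 x - \<mu> (vec_of_int x) \<le> E"
          using abs_le_D1[OF 1] 2(1) abs_le_D2[OF 3] 4(1) 5 6 7 8 9 E gain_nonneg[of w x] by linarith
        show "- (rtime w 0 x - \<mu> (vec_of_int x)) \<le> E"
          using abs_le_D2[OF 1] 2(2) abs_le_D1[OF 3] 4(2) 5 6 7 8 9 E gain_nonneg[of w x] by linarith
      qed
      then have "\<bar>rtime w 0 x - \<mu> (vec_of_int x)\<bar> \<le> \<epsilon> * n" by (simp only: E_def)
      then show "\<bar>rtime w 0 x - \<mu> (vec_of_int x)\<bar> \<le> \<epsilon> * norm1 x" by (simp add: n_def)
    qed
  qed
qed

text \<open>A deterministic statement about one configuration, from which both almost sure
  conclusions follow. All sequences \<open>xs\<close> and directions are thus handled on a single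
  event of full measure.\<close>

definition shape_property :: "'d config \<Rightarrow> bool" where
  "shape_property w \<longleftrightarrow> (\<forall>x. ptime w 0 x = ereal (rtime w 0 x)) \<and>
    (\<forall>\<epsilon>>0::real. \<exists>R. \<forall>x. R \<le> norm1 x \<longrightarrow> \<bar>rtime w 0 x - \<mu> (vec_of_int x)\<bar> \<le> \<epsilon> * norm1 x)"

theorem AE_shape: "AE w in P. shape_property w"
proof -
  have "AE w in P. \<forall>i. \<exists>R. \<forall>x. R \<le> norm1 x \<longrightarrow> \<bar>rtime w 0 x - \<mu> (vec_of_int x)\<bar> \<le> 1 / Suc i * norm1 x"
    unfolding AE_all_countable by (intro allI shape_fixed_tolerance) simp
  then show ?thesis
    using AE_rtime_eq
  proof eventually_elim
    case (elim w)
    have "\<exists>R. \<forall>x. R \<le> norm1 x \<longrightarrow> \<bar>rtime w 0 x - \<mu> (vec_of_int x)\<bar> \<le> \<epsilon> * norm1 x" if \<epsilon>: "\<epsilon> > 0" for \<epsilon> :: real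
    proof -
      obtain i :: nat where i: "1 / Suc i < \<epsilon>" by (rule nat_approx_posE[OF \<epsilon>])
      obtain R where R: "\<And>x. R \<le> norm1 x \<Longrightarrow> \<bar>rtime w 0 x - \<mu> (vec_of_int x)\<bar> \<le> 1 / Suc i * norm1 x"
        using elim(1) by blast
      have "1 / Suc i * norm1 x \<le> \<epsilon> * norm1 x" for x :: "int ^ 'd" using i by (intro mult_right_mono) auto
      then show ?thesis using R order_trans by blast
    qed
    then show ?case using elim(2) by (simp add: shape_property_def)
  qed
qed

lemma shape_sup:
  assumes "shape_property w"
  shows "(\<lambda>n::nat. SUP x \<in> {x. norm1 x \<ge> int n}.
    \<bar>ptime w 0 x - ereal (\<mu> (vec_of_int x))\<bar> / ereal (real_of_int (norm1 x))) \<longlonglongrightarrow> 0"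
proof (rule order_tendstoI)
  let ?f = "\<lambda>x. \<bar>ptime w 0 x - ereal (\<mu> (vec_of_int x))\<bar> / ereal (real_of_int (norm1 x))"
  have f: "?f x = ereal (\<bar>rtime w 0 x - \<mu> (vec_of_int x)\<bar> / norm1 x)" if "1 \<le> norm1 x" for x
  proof -
    have "x \<noteq> 0" using that by auto
    then show ?thesis using assms by (simp add: shape_property_def)
  qed
  fix a :: ereal
  show "\<forall>\<^sub>F n in sequentially. a < (SUP x \<in> {x. norm1 x \<ge> int n}. ?f x)" if "a < 0"
  proof (rule eventually_sequentiallyI[of 1])
    fix n :: nat assume n: "1 \<le> n"
    \<comment> \<open>A witness that the index set is nonempty; an empty supremum of extended reals
      would be minus infinity.\<close>
    define x :: "int ^ 'd" where "x = axis undefined (int n)"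
    have x: "norm1 x = int n" by (simp add: x_def)
    have "0 \<le> ?f x" using f[of x] x n by simp
    also have "\<dots> \<le> (SUP x \<in> {x. norm1 x \<ge> int n}. ?f x)" by (rule SUP_upper) (simp add: x)
    finally show "a < (SUP x \<in> {x. norm1 x \<ge> int n}. ?f x)" using that by simp
  qed
  show "\<forall>\<^sub>F n in sequentially. (SUP x \<in> {x. norm1 x \<ge> int n}. ?f x) < a" if a: "0 < a"
  proof -
    obtain \<epsilon> where \<epsilon>: "0 < ereal \<epsilon>" "ereal \<epsilon> < a" using ereal_dense2[OF a] by auto
    then have "0 < \<epsilon>" by simp
    then obtain R where R: "\<And>x. R \<le> norm1 x \<Longrightarrow> \<bar>rtime w 0 x - \<mu> (vec_of_int x)\<bar> \<le> \<epsilon> * norm1 x"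
      using assms unfolding shape_property_def by blast
    show ?thesis
    proof (rule eventually_sequentiallyI[of "nat (max 1 R)"])
      fix n assume n: "nat (max 1 R) \<le> n"
      have "(SUP x \<in> {x. norm1 x \<ge> int n}. ?f x) \<le> ereal \<epsilon>"
      proof (rule SUP_least)
        fix x :: "int ^ 'd" assume "x \<in> {x. norm1 x \<ge> int n}"
        then have x: "1 \<le> norm1 x" "R \<le> norm1 x" using n by auto
        have "0 < real_of_int (norm1 x)" using x(1) by simp
        then have "\<bar>rtime w 0 x - \<mu> (vec_of_int x)\<bar> / norm1 x \<le> \<epsilon>" using R[OF x(2)] by (simp add: pos_divide_le_eq)
        then show "?f x \<le> ereal \<epsilon>" using f[OF x(1)] by simp
      qed
      then show "(SUP x \<in> {x. norm1 x \<ge> int n}. ?f x) < a" using \<epsilon>(2) by (rule le_less_trans)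
    qed
  qed
qed

lemma shape_directional:
  fixes \<xi> :: "real ^ 'd"
  assumes w: "shape_property w" and xs: "(\<lambda>n. (1 / real n) *\<^sub>R vec_of_int (xs n)) \<longlonglongrightarrow> \<xi>"
  shows "(\<lambda>n. ptime w 0 (xs n) / ereal (real n)) \<longlonglongrightarrow> ereal (\<mu> \<xi>)"
proof -
  define \<zeta> where "\<zeta> n = (1 / real n) *\<^sub>R vec_of_int (xs n)" for n
  have "(\<lambda>n. \<mu> (\<zeta> n)) \<longlonglongrightarrow> \<mu> \<xi>"
    using limit.limit_continuous xs unfolding \<zeta>_def
    by (auto simp: continuous_on_eq_continuous_at intro: isCont_tendsto_compose)
  moreover have "(\<lambda>n. rtime w 0 (xs n) / n - \<mu> (\<zeta> n)) \<longlonglongrightarrow> 0"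
  proof (rule LIMSEQ_I)
    fix e :: real assume e: "e > 0"
    define \<Lambda> where "\<Lambda> = l1 \<xi> + 1"
    have \<Lambda>: "\<Lambda> \<ge> 1" by (simp add: \<Lambda>_def)
    have "(\<lambda>n. l1 (\<zeta> n)) \<longlonglongrightarrow> l1 \<xi>" unfolding l1_def \<zeta>_def by (intro tendsto_intros xs)
    then have "\<forall>\<^sub>F n in sequentially. l1 (\<zeta> n) < \<Lambda>" by (rule order_tendstoD(2)) (simp add: \<Lambda>_def)
    then obtain N1 where N1: "\<And>n. n \<ge> N1 \<Longrightarrow> l1 (\<zeta> n) < \<Lambda>" by (auto simp: eventually_sequentially)
    define \<epsilon> where "\<epsilon> = e / (2 * \<Lambda>)"
    have \<epsilon>: "\<epsilon> > 0" using e \<Lambda> by (simp add: \<epsilon>_def)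
    obtain R where R: "\<And>x. R \<le> norm1 x \<Longrightarrow> \<bar>rtime w 0 x - \<mu> (vec_of_int x)\<bar> \<le> \<epsilon> * norm1 x"
      using w \<epsilon> unfolding shape_property_def by blast
    define g where "g x = \<bar>rtime w 0 x - \<mu> (vec_of_int x)\<bar>" for x
    \<comment> \<open>The points \<open>xs n\<close> need not leave bounded sets, for instance when
      \<xi> is 0. The finitely many points within radius \<open>R\<close> are charged to the
      constant \<open>S\<close>, which vanishes after division by \<open>n\<close>.\<close>
    define S where "S = (\<Sum>x | norm1 x \<le> R. g x)"
    have S0: "0 \<le> S" unfolding S_def g_def by (simp add: sum_nonneg)
    have gle: "g x \<le> \<epsilon> * norm1 x + S" for x
    proof (cases "R \<le> norm1 x")
      case True
      then show ?thesis using R[OF True] S0 by (simp add: g_def)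
    next
      case False
      then have "g x \<le> S" unfolding S_def
        by (intro member_le_sum finite_norm1_ball) (auto simp: g_def)
      moreover have "0 \<le> \<epsilon> * norm1 x" using \<epsilon> by simp
      ultimately show ?thesis by linarith
    qed
    obtain N2 :: nat where N2: "N2 > 2 * S / e" using reals_Archimedean2 by blast
    have "norm (rtime w 0 (xs n) / n - \<mu> (\<zeta> n) - 0) < e" if n: "n \<ge> max 1 (max N1 N2)" for n
    proof -
      have n0: "real n > 0" using n by simp
      have "\<mu> (\<zeta> n) = \<mu> (vec_of_int (xs n)) / n"
        unfolding \<zeta>_def by (subst limit.limit_homogeneous) auto
      then have "norm (rtime w 0 (xs n) / n - \<mu> (\<zeta> n) - 0) = g (xs n) / n"
        by (simp add: g_def diff_divide_distrib[symmetric])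
      also have "\<dots> \<le> (\<epsilon> * norm1 (xs n) + S) / n" using gle by (intro divide_right_mono) auto
      also have "\<dots> = \<epsilon> * l1 (\<zeta> n) + S / n"
        using n0 by (simp add: \<zeta>_def l1_scaleR l1_vec_of_int add_divide_distrib)
      also have "\<dots> < \<epsilon> * \<Lambda> + e / 2"
      proof (rule add_strict_mono)
        show "\<epsilon> * l1 (\<zeta> n) < \<epsilon> * \<Lambda>" using N1[of n] n \<epsilon> by (intro mult_strict_left_mono) auto
        have "2 * S / e < n" using N2 n by linarith
        then show "S / n < e / 2" using e n0 by (simp add: field_simps)
      qed
      also have "\<dots> = e" using \<Lambda> by (simp add: \<epsilon>_def)
      finally show ?thesis .
    qed
    then show "\<exists>N. \<forall>n\<ge>N. norm (rtime w 0 (xs n) / n - \<mu> (\<zeta> n) - 0) < e" by blast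
  qed
  ultimately have "(\<lambda>n. rtime w 0 (xs n) / n - \<mu> (\<zeta> n) + \<mu> (\<zeta> n)) \<longlonglongrightarrow> 0 + \<mu> \<xi>" by (intro tendsto_add)
  then have "(\<lambda>n. ereal (rtime w 0 (xs n) / n)) \<longlonglongrightarrow> ereal (\<mu> \<xi>)" by simp
  moreover have "\<forall>\<^sub>F n in sequentially. ereal (rtime w 0 (xs n) / n) = ptime w 0 (xs n) / ereal (real n)"
    using w by (intro eventually_sequentiallyI[of 1]) (simp add: shape_property_def)
  ultimately show ?thesis by (rule Lim_transform_eventually)
qed

end

section \<open>Transfer from the product space to an arbitrary i.i.d. family\<close>

theorem theoremA4:
  fixes M :: "'w measure"
    and t :: "(int ^ 'd) set \<Rightarrow> 'w \<Rightarrow> real"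
  assumes dim: "CARD('d) \<ge> 2"
    and prob: "prob_space M"
    and indep: "prob_space.indep_vars M (\<lambda>_. borel) t lattice_edges"
    and ident: "\<forall>e\<in>lattice_edges. \<forall>e'\<in>lattice_edges. distr M borel (t e) = distr M borel (t e')"
    and min_L1: "integrable M (min_pos_origin t)"
    and A_L1: "(\<integral>\<^sup>+ \<omega>. e2ennreal (A_var t \<omega>) \<partial>M) < \<infinity>"
  shows
    "(\<forall>x y. (AE \<omega> in M. \<bar>passage_time t x y \<omega>\<bar> \<noteq> \<infinity>) \<and>
            integrable M (\<lambda>\<omega>. real_of_ereal (passage_time t x y \<omega>))) \<and>
     (\<exists>\<mu> :: real ^ 'd \<Rightarrow> real.
        (\<forall>\<xi>. \<mu> \<xi> \<ge> 0) \<and>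
        (\<forall>c \<xi>. c \<ge> 0 \<longrightarrow> \<mu> (c *\<^sub>R \<xi>) = c * \<mu> \<xi>) \<and>
        continuous_on UNIV \<mu> \<and>
        convex_on UNIV \<mu> \<and>
        (\<forall>(xs :: nat \<Rightarrow> int ^ 'd) \<xi>.
           (\<lambda>n. (1 / real n) *\<^sub>R vec_of_int (xs n)) \<longlonglongrightarrow> \<xi> \<longrightarrow>
           (\<lambda>n. \<integral>\<omega>. \<bar>real_of_ereal (passage_time t 0 (xs n) \<omega>) / real n - \<mu> \<xi>\<bar> \<partial>M)
             \<longlonglongrightarrow> 0) \<and>
        ((integrable M (\<lambda>\<omega>. (min_pos_origin t \<omega>) ^ CARD('d)) \<and>
          (\<integral>\<^sup>+ \<omega>. (e2ennreal (A_var t \<omega>)) ^ CARD('d) \<partial>M) < \<infinity>) \<longrightarrow>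
          (AE \<omega> in M.
             (\<lambda>n::nat. SUP x \<in> {x. norm1 x \<ge> int n}.
                 \<bar>passage_time t 0 x \<omega> - ereal (\<mu> (vec_of_int x))\<bar> / ereal (real_of_int (norm1 x)))
               \<longlonglongrightarrow> 0 \<and>
             (\<forall>(xs :: nat \<Rightarrow> int ^ 'd) \<xi>.
                (\<lambda>n. (1 / real n) *\<^sub>R vec_of_int (xs n)) \<longlonglongrightarrow> \<xi> \<longrightarrow>
                (\<lambda>n. passage_time t 0 (xs n) \<omega> / ereal (real n)) \<longlonglongrightarrow> ereal (\<mu> \<xi>)))))"
proof -
  interpret M: prob_space M by (rule prob)
  obtain u :: "int ^ 'd" where "u \<in> units" using units_nonempty by blast
  then have "{0, u} \<in> lattice_edges" by (intro edge_in_lattice) (simp add: adjacent_iff_unit)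
  then obtain e0 :: "(int ^ 'd) set" where e0: "e0 \<in> lattice_edges" by blast
  have rv [measurable]: "t e \<in> borel_measurable M" if "e \<in> lattice_edges" for e
    using indep that by (simp add: M.indep_vars_def)
  define N where "N = distr M borel (t e0)"
  define P where "P = PiM (lattice_edges :: (int ^ 'd) set set) (\<lambda>_. N)"
  \<comment> \<open>Independence and equal marginals say precisely that this map pushes
    \<open>M\<close> to the product measure. The passage times, \<open>A\<close> and the minimum are
    functions of \<open>X \<omega>\<close>, as they involve lattice edges only.\<close>
  define X where "X \<omega> = (\<lambda>e\<in>lattice_edges. t e \<omega>)" for \<omega>
  have N: "distr M borel (t e) = N" if "e \<in> lattice_edges" for e
    unfolding N_def by (rule ident[rule_format, OF that e0])
  interpret iid_weights N P
  proof (rule iid_weights.intro)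
    show "prob_space N" unfolding N_def using rv[OF e0] by (rule M.prob_space_distr)
  qed (simp_all add: N_def P_def dim)
  have setsP: "sets (PiM lattice_edges (\<lambda>_. borel)) = sets P"
    unfolding P_def by (intro sets_PiM_cong) (simp_all add: N_def)
  have X: "X \<in> measurable M P"
    unfolding X_def[abs_def] P_def by (intro measurable_restrict) (simp add: N_def rv)
  have distr_X: "distr M P X = P"
  proof -
    have "distr M P X = distr M (PiM lattice_edges (\<lambda>_. borel)) X"
      by (intro distr_cong) (simp_all add: setsP)
    also have "\<dots> = PiM lattice_edges (\<lambda>e. distr M borel (t e))"
      unfolding X_def[abs_def] using e0 indep rv
      by (intro M.indep_vars_iff_distr_eq_PiM'[THEN iffD1]) auto
    also have "\<dots> = P" unfolding P_def by (intro PiM_cong N refl)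
    finally show ?thesis .
  qed
  have time: "passage_time t x y \<omega> = ptime (X \<omega>) x y" for x y \<omega>
    unfolding passage_time_eq_ptime by (intro ptime_cong) (simp add: X_def)
  have gain: "A_var t \<omega> = loop_gain (X \<omega>) 0" for \<omega>
    unfolding A_var_eq_loop_gain by (intro loop_gain_cong) (simp add: X_def)
  have min: "min_pos_origin t \<omega> = Min ((\<lambda>u. max 0 (X \<omega> {0, u})) ` units)" for \<omega>
    unfolding min_pos_origin_def edges_at_zero image_image
    by (intro arg_cong[of _ _ Min] image_cong refl)
      (simp add: X_def edge_in_lattice adjacent_iff_unit)
  have edges: "(\<lambda>u. {0, u}) \<in> (units :: (int ^ 'd) set) \<rightarrow> lattice_edges"
    by (auto simp: adjacent_iff_unit intro!: edge_in_lattice)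
  have min_int: "integrable P (\<lambda>w. Min ((\<lambda>u. max 0 (w {0, u})) ` units) ^ p)"
    if "integrable M (\<lambda>\<omega>. min_pos_origin t \<omega> ^ p)" for p
    using that integrable_distr_eq[OF X borel_measurable_power[OF Min_measurable[OF edges]], of p]
    by (simp add: min distr_X)
  have gain_fin: "(\<integral>\<^sup>+w. e2ennreal (loop_gain w 0) ^ p \<partial>P) < \<infinity>"
    if "(\<integral>\<^sup>+ \<omega>. e2ennreal (A_var t \<omega>) ^ p \<partial>M) < \<infinity>" for p
  proof -
    have "(\<integral>\<^sup>+w. e2ennreal (loop_gain w 0) ^ p \<partial>distr M P X) = (\<integral>\<^sup>+ \<omega>. e2ennreal (A_var t \<omega>) ^ p \<partial>M)"
      by (subst nn_integral_distr[OF X]) (simp_all add: gain)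
    then show ?thesis using that by (simp add: distr_X)
  qed
  interpret first_passage N P
    using min_int[of 1] min_L1 gain_fin[of 1] A_L1 by unfold_locales simp_all
  have AE_M: "AE \<omega> in M. Q (X \<omega>)" if "AE w in P. Q w" for Q
  proof (rule AE_distrD[OF X])
    show "AE w in distr M P X. Q w" using that by (simp only: distr_X)
  qed
  have finite: "(AE \<omega> in M. \<bar>passage_time t x y \<omega>\<bar> \<noteq> \<infinity>) \<and>
      integrable M (\<lambda>\<omega>. real_of_ereal (passage_time t x y \<omega>))" for x y
  proof
    have "AE w in P. \<bar>ptime w x y\<bar> \<noteq> \<infinity>" using AE_rtime_eq by eventually_elim simp
    then show "AE \<omega> in M. \<bar>passage_time t x y \<omega>\<bar> \<noteq> \<infinity>" unfolding time by (rule AE_M)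
    have "integrable (distr M P X) (\<lambda>w. rtime w x y)" by (simp add: distr_X rtime_integrable)
    then show "integrable M (\<lambda>\<omega>. real_of_ereal (passage_time t x y \<omega>))"
      using integrable_distr[OF X] by (simp add: time rtime_def)
  qed
  have L1: "(\<lambda>n. \<integral>\<omega>. \<bar>real_of_ereal (passage_time t 0 (xs n) \<omega>) / real n - \<mu> \<xi>\<bar> \<partial>M) \<longlonglongrightarrow> 0"
    if "(\<lambda>n. (1 / real n) *\<^sub>R vec_of_int (xs n)) \<longlonglongrightarrow> \<xi>" for xs :: "nat \<Rightarrow> int ^ 'd" and \<xi>
  proof -
    have "(\<integral>\<omega>. \<bar>real_of_ereal (passage_time t 0 (xs n) \<omega>) / real n - \<mu> \<xi>\<bar> \<partial>M)
        = (\<integral>w. \<bar>rtime w 0 (xs n) / real n - \<mu> \<xi>\<bar> \<partial>distr M P X)" for n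
      by (subst integral_distr[OF X]) (simp_all add: time rtime_def)
    then show ?thesis using rtime_L1[OF that] by (simp add: distr_X)
  qed
  have shape: "AE \<omega> in M.
      (\<lambda>n::nat. SUP x \<in> {x. norm1 x \<ge> int n}.
        \<bar>passage_time t 0 x \<omega> - ereal (\<mu> (vec_of_int x))\<bar> / ereal (real_of_int (norm1 x))) \<longlonglongrightarrow> 0 \<and>
      (\<forall>(xs :: nat \<Rightarrow> int ^ 'd) \<xi>. (\<lambda>n. (1 / real n) *\<^sub>R vec_of_int (xs n)) \<longlonglongrightarrow> \<xi> \<longrightarrow>
        (\<lambda>n. passage_time t 0 (xs n) \<omega> / ereal (real n)) \<longlonglongrightarrow> ereal (\<mu> \<xi>))"
    if "integrable M (\<lambda>\<omega>. (min_pos_origin t \<omega>) ^ CARD('d))"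
      "(\<integral>\<^sup>+ \<omega>. (e2ennreal (A_var t \<omega>)) ^ CARD('d) \<partial>M) < \<infinity>"
  proof -
    \<comment> \<open>Interpreted only under the extra moments, and over the same \<open>N\<close>
      and \<open>P\<close>, so the limit function is the one already obtained for convergence in
      mean.\<close>
    interpret first_passage_moments N P
      using min_int[OF that(1)] gain_fin[OF that(2)] by unfold_locales
    have "AE \<omega> in M. shape_property (X \<omega>)" by (rule AE_M[OF AE_shape])
    then show ?thesis
      unfolding time by eventually_elim (blast intro: shape_sup shape_directional)
  qed
  show ?thesis
  proof (intro conjI exI[of _ \<mu>])
    show "\<forall>x y. (AE \<omega> in M. \<bar>passage_time t x y \<omega>\<bar> \<noteq> \<infinity>) \<and>
            integrable M (\<lambda>\<omega>. real_of_ereal (passage_time t x y \<omega>))"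
      using finite by blast
    show "\<forall>\<xi>. \<mu> \<xi> \<ge> 0" using limit.limit_nonneg by blast
    show "\<forall>c \<xi>. c \<ge> 0 \<longrightarrow> \<mu> (c *\<^sub>R \<xi>) = c * \<mu> \<xi>" using limit.limit_homogeneous by blast
    show "continuous_on UNIV \<mu>" by (rule limit.limit_continuous)
    show "convex_on UNIV \<mu>" by (rule limit.limit_convex)
  qed (use L1 shape in blast)+
qed

end
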